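(* Let $X=(W,Q,\pi,I)$ be a root independent irreducible quadruple (an object of $\mathscr D$) such that the underlying graph of $\Gamma_X$ is a tree. The Hall algebra $\mathcal H(\mathcal S_X)$ is isomorphic to the Hall algebra $\mathbf H(\Gamma_X)$ of the category of (nilpotent) representations of $\Gamma_X$ over $\mathbb F_1$.
   Context: $k$ is a field containing $\mathbb Z$; algebras are over $k$. Quadruples. For a Coxeter group $W$ of finite rank with simple reflections $s_1,\dots,s_n$, let $V$ be the real vector space with basis the simple roots $\alpha_1,\dots,\alpha_n$, with the form $\langle\alpha_i,\alpha_j\rangle=-\cos(\pi/\operatorname{ord}(s_is_j))$ and the usual geometric action of $W$. Write $[m]=\{1,\dots,m\}$. For a word $Q=s_{i_1}\cdots s_{i_m}$ and $\pi\in W$, the subword complex $\mathcal{SC}_W(Q,\pi)$ has as faces the subsets $I\subseteq[m]$ such that the subword of $Q$ at positions $[m]\setminus I$ contains a reduced expression of $\pi$. A quadruple is $X=(W,Q,\pi,I)$ with $I$ a maximal face of $\mathcal{SC}_W(Q,\pi)$. The root function is $r(l)=\big(\prod_{j\in[l-1]\setminus I}s_{i_j}\big)(\alpha_{i_l})$, $l\in[m]$ (product in increasing order of $j$). $X$ is irreducible if $\{r(i)\}_{i\in I}$ spans $V$; it is moreover root independent if $\{r(i)\}_{i\in I}$ is a basis of $V$. Root configuration quiver. $\Gamma_X$ has vertex set (labelled by) $I$, and there is a (single) arrow $i\to j$ if and only if $(i-j)\cdot\langle r(i),r(j)\rangle>0$. The subobjects of $X$ are indexed by subsets $J\subseteq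 I$; the subobject $X(J)$ has root configuration quiver $\Gamma_{X(J)}$, identified with the full subquiver of $\Gamma_X$ on $J$. $\mathcal S_X$: objects are finite disjoint unions $\bigsqcup_{i=1}^t\Gamma_{X(J_i)}$ of labelled quivers, $J_i\subseteq I$ (repetitions allowed); morphisms $A\to B$ are label-preserving partial isomorphisms, i.e. diagrams $A\hookleftarrow P\hookrightarrow B$ given by an $I$-labelled quiver $P$ identified, preserving labels, with a (full) subquiver of $A$ and of $B$; composition is by intersection in the middle object. Direct sums are disjoint unions. Proto-exact structure. For $a,b\in I$ put $a\preceq b$ iff there is a path from $b$ to $a$ in $\Gamma_X$. For $J\subseteq H\subseteq I$, $\Gamma_{X(J)}\hookleftarrow\Gamma_{X(J)}\hookrightarrow\Gamma_{X(H)}$ is a basic admissible monomorphism iff $\{b\in H\mid b\preceq a\}\subseteq J$ for all $a\in J$; for $K\subseteq H$, $\Gamma_{X(H)}\hookleftarrow\Gamma_{X(K)}\hookrightarrow\Gamma_{X(K)}$ is a basic admissible epimorphism iff $\{b\in H\mid a\preceq b\}\subseteq K$ for all $a\in K$. Admissible monomorphisms (epimorphisms) are finite disjoint unions of basic ones. An admissible proto-exact sequence $A\to B\to C$ is an admissible monomorphism $i:A\to B$ and an admissible epimorphism $p:B\to C$ forming with $A\to0\to C$ a biCartesian square. $\operatorname{Ext}_{\mathcal S_X}(C,A)_B$ is the set of equivalence classes (isomorphism of middle terms inducing identities on $A$ and $C$) of admissible proto-exact sequences $A\to B'\to C$ with $B'\cong B$. $\mathcal H(\mathcal S_X)$ is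 the $k$-vector space on isomorphism classes of objects of $\mathcal S_X$ with product $[\Gamma_1]\cdot[\Gamma_2]=\sum_{K}|\operatorname{Ext}_{\mathcal S_X}(\Gamma_2,\Gamma_1)_K|\,[K]$, $K$ over isomorphism classes. Representations over $\mathbb F_1$. $Vect(\mathbb F_1)$ has as objects finite pointed sets $(V,0_V)$ and as morphisms maps $f:V\to W$ with $f(0_V)=0_W$ and $f|_{V\setminus f^{-1}(0_W)}$ injective. A representation of a quiver $Q$ over $\mathbb F_1$ is a functor from its path category (objects: vertices; morphisms: oriented paths) to $Vect(\mathbb F_1)$; morphisms are natural transformations. It is nilpotent if all sufficiently long paths act by $0$. The quotient of pointed sets $V/U$ collapses $U$ to $0$. $\mathbf H(Q)$ is the Hall algebra of nilpotent representations in the sense of Szczesny: the $k$-vector space on isomorphism classes with $[M]\cdot[N]=\sum_R|\{L\subseteq R\text{ subrepresentation}: L\cong N,\ R/L\cong M\}|\,[R]$. *)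

theory Defs
  imports
    "HOL-Analysis.Cartesian_Space"
    "HOL-Library.Sublist"
    "HOL-Algebra.Multiplicative_Group"
    "HOL-Algebra.QuotRing"
    "HOL-Algebra.Module"
    "Graph_Theory.Graph_Theory"
begin

section \<open>Coxeter systems and the geometric representation\<close>

text \<open>
  The simple reflections are a family \<open>s\<close> indexed by a finite type, so that the rank is
  the cardinality of that type, and words in the simple reflections are lists of indices.
\<close>

definition word_prod :: "('g, 'm) monoid_scheme \<Rightarrow> ('n \<Rightarrow> 'g) \<Rightarrow> 'n list \<Rightarrow> 'g" where
  "word_prod W s w = foldr (\<lambda>i x. s i \<otimes>\<^bsub>W\<^esub> x) w \<one>\<^bsub>W\<^esub>"

text \<open>
  The congruence on words generated by the relations \<open>(s\<^sub>i s\<^sub>j)^m(i,j) = 1\<close>.  The value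
  \<open>m i j = 0\<close> stands for infinite order and imposes no relation; \<open>m i i = 1\<close> gives
  \<open>s\<^sub>i s\<^sub>i = 1\<close>, so that the quotient monoid is a group.
\<close>

inductive coxeter_cong :: "('n \<Rightarrow> 'n \<Rightarrow> nat) \<Rightarrow> 'n list \<Rightarrow> 'n list \<Rightarrow> bool"
  for m :: "'n \<Rightarrow> 'n \<Rightarrow> nat" where
  refl: "coxeter_cong m u u"
| sym: "coxeter_cong m u v \<Longrightarrow> coxeter_cong m v u"
| trans: "coxeter_cong m u v \<Longrightarrow> coxeter_cong m v w \<Longrightarrow> coxeter_cong m u w"
| relation: "coxeter_cong m (u @ concat (replicate (m i j) [i, j]) @ v) (u @ v)"

definition cox_ord :: "('g, 'm) monoid_scheme \<Rightarrow> ('n \<Rightarrow> 'g) \<Rightarrow> 'n \<Rightarrow> 'n \<Rightarrow> nat" where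
  "cox_ord W s i j = group.ord W (s i \<otimes>\<^bsub>W\<^esub> s j)"

text \<open>\<open>W\<close> is presented by the involutions \<open>s\<^sub>i\<close> and the relations \<open>(s\<^sub>i s\<^sub>j)^ord(s\<^sub>i s\<^sub>j) = 1\<close>.\<close>

definition coxeter_system :: "('g, 'm) monoid_scheme \<Rightarrow> ('n::finite \<Rightarrow> 'g) \<Rightarrow> bool" where
  "coxeter_system W s \<longleftrightarrow>
     group W \<and> inj s \<and> (\<forall>i. s i \<in> carrier W \<and> group.ord W (s i) = 2) \<and>
     carrier W = range (word_prod W s) \<and>
     (\<forall>u v. word_prod W s u = word_prod W s v \<longleftrightarrow> coxeter_cong (cox_ord W s) u v)"

definition simple_root :: "'n::finite \<Rightarrow> real ^ 'n" where
  "simple_root i = axis i 1"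

text \<open>
  For \<open>s\<^sub>i s\<^sub>j\<close> of infinite order, \<open>ord\<close> is \<open>0\<close> and \<open>pi / 0 = 0\<close>, so the coefficient is
  \<open>- cos 0 = -1\<close>, in agreement with the convention \<open>\<pi> / \<infinity> = 0\<close>.
\<close>

definition cox_form ::
    "('g, 'm) monoid_scheme \<Rightarrow> ('n::finite \<Rightarrow> 'g) \<Rightarrow> real ^ 'n \<Rightarrow> real ^ 'n \<Rightarrow> real" where
  "cox_form W s x y =
     (\<Sum>i\<in>UNIV. \<Sum>j\<in>UNIV. x $ i * y $ j * (- cos (pi / real (cox_ord W s i j))))"

definition simple_refl ::
    "('g, 'm) monoid_scheme \<Rightarrow> ('n::finite \<Rightarrow> 'g) \<Rightarrow> 'n \<Rightarrow> real ^ 'n \<Rightarrow> real ^ 'n" where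
  "simple_refl W s i v = v - (2 * cox_form W s (simple_root i) v) *\<^sub>R simple_root i"

text \<open>The geometric action of the element \<open>word_prod W s w\<close>; the leftmost letter acts last.\<close>

definition geom_action ::
    "('g, 'm) monoid_scheme \<Rightarrow> ('n::finite \<Rightarrow> 'g) \<Rightarrow> 'n list \<Rightarrow> real ^ 'n \<Rightarrow> real ^ 'n" where
  "geom_action W s w v = foldr (simple_refl W s) w v"


section \<open>Subword complexes and quadruples\<close>

text \<open>Positions in a word of length \<open>m\<close> are \<open>0, \<dots>, m - 1\<close> instead of \<open>1, \<dots>, m\<close>.\<close>

definition reduced_expression ::
    "('g, 'm) monoid_scheme \<Rightarrow> ('n \<Rightarrow> 'g) \<Rightarrow> 'g \<Rightarrow> 'n list \<Rightarrow> bool" where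
  "reduced_expression W s \<pi> w \<longleftrightarrow>
     word_prod W s w = \<pi> \<and> (\<forall>w'. word_prod W s w' = \<pi> \<longrightarrow> length w \<le> length w')"

definition subword_complex ::
    "('g, 'm) monoid_scheme \<Rightarrow> ('n \<Rightarrow> 'g) \<Rightarrow> 'n list \<Rightarrow> 'g \<Rightarrow> nat set set" where
  "subword_complex W s Q \<pi> =
     {F. F \<subseteq> {..<length Q} \<and>
         (\<exists>w. subseq w (nths Q ({..<length Q} - F)) \<and> reduced_expression W s \<pi> w)}"

definition quadruple ::
    "('g, 'm) monoid_scheme \<Rightarrow> ('n::finite \<Rightarrow> 'g) \<Rightarrow> 'n list \<Rightarrow> 'g \<Rightarrow> nat set \<Rightarrow> bool" where
  "quadruple W s Q \<pi> I \<longleftrightarrow>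
     coxeter_system W s \<and> \<pi> \<in> carrier W \<and> I \<in> subword_complex W s Q \<pi> \<and>
     (\<forall>F \<in> subword_complex W s Q \<pi>. I \<subseteq> F \<longrightarrow> F = I)"

definition root_fn ::
    "('g, 'm) monoid_scheme \<Rightarrow> ('n::finite \<Rightarrow> 'g) \<Rightarrow> 'n list \<Rightarrow> nat set \<Rightarrow> nat \<Rightarrow> real ^ 'n" where
  "root_fn W s Q I l = geom_action W s (nths Q ({..<l} - I)) (simple_root (Q ! l))"

definition irreducible_quadruple ::
    "('g, 'm) monoid_scheme \<Rightarrow> ('n::finite \<Rightarrow> 'g) \<Rightarrow> 'n list \<Rightarrow> 'g \<Rightarrow> nat set \<Rightarrow> bool" where
  "irreducible_quadruple W s Q \<pi> I \<longleftrightarrow>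
     quadruple W s Q \<pi> I \<and> span (root_fn W s Q I ` I) = UNIV"

text \<open>The family \<open>(r(i))\<close>, \<open>i \<in> I\<close>, is a basis: in particular its members are distinct.\<close>

definition root_independent ::
    "('g, 'm) monoid_scheme \<Rightarrow> ('n::finite \<Rightarrow> 'g) \<Rightarrow> 'n list \<Rightarrow> nat set \<Rightarrow> bool" where
  "root_independent W s Q I \<longleftrightarrow>
     inj_on (root_fn W s Q I) I \<and> independent (root_fn W s Q I ` I) \<and>
     span (root_fn W s Q I ` I) = UNIV"


section \<open>The root configuration quiver\<close>

definition root_config_quiver ::
    "('g, 'm) monoid_scheme \<Rightarrow> ('n::finite \<Rightarrow> 'g) \<Rightarrow> 'n list \<Rightarrow> nat set \<Rightarrow> nat pair_pre_digraph" where
  "root_config_quiver W s Q I =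
     \<lparr> pverts = I,
       parcs = {(i, j). i \<in> I \<and> j \<in> I \<and>
         (real i - real j) * cox_form W s (root_fn W s Q I i) (root_fn W s Q I j) > 0} \<rparr>"

text \<open>
  The library predicate \<^const>\<open>tree\<close> only excludes directed cycles.  Here the underlying
  undirected multigraph has to be a tree: (weakly) connected (and nonempty), no loops, no two
  arrows with the same pair of end points, and no cycle of length at least three in the
  symmetrised graph (where every edge gives a closed walk of length two).
\<close>

definition underlying_tree :: "('v, 'e) pre_digraph \<Rightarrow> bool" where
  "underlying_tree G \<longleftrightarrow>
     Digraph_Component.connected G \<and>
     (\<forall>e \<in> arcs G. tail G e \<noteq> head G e) \<and>
     inj_on (\<lambda>e. {tail G e, head G e}) (arcs G) \<and>
     \<not> (\<exists>p. pre_digraph.cycle (with_proj (mk_symmetric G)) p \<and> 3 \<le> length p)"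


section \<open>The category \<open>\<S>\<^sub>X\<close>\<close>

text \<open>
  Everything below depends on \<open>X\<close> only through the labelled quiver \<open>G = \<Gamma>\<^sub>X\<close>, the subobject
  \<open>X(J)\<close> being represented by the full subquiver on \<open>J\<close>.  The list \<open>[J\<^sub>1, \<dots>, J\<^sub>t]\<close> stands for
  the disjoint union of the full subquivers on \<open>J\<^sub>1, \<dots>, J\<^sub>t\<close>: its vertices are the pairs
  \<open>(k, v)\<close> with \<open>v \<in> J\<^sub>k\<close>, the label of \<open>(k, v)\<close> being \<open>v\<close>.
\<close>

type_synonym 'v sobj = "'v set list"
type_synonym 'v smor = "((nat \<times> 'v) \<times> (nat \<times> 'v)) set"

definition S_obj :: "'v pair_pre_digraph \<Rightarrow> 'v sobj set" where
  "S_obj G = {A. \<forall>J \<in> set A. J \<subseteq> pverts G}"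

definition S_verts :: "'v sobj \<Rightarrow> (nat \<times> 'v) set" where
  "S_verts A = {(k, v). k < length A \<and> v \<in> A ! k}"

definition S_arrows :: "'v pair_pre_digraph \<Rightarrow> 'v sobj \<Rightarrow> ((nat \<times> 'v) \<times> (nat \<times> 'v)) set" where
  "S_arrows G A =
     {(x, y). x \<in> S_verts A \<and> y \<in> S_verts A \<and> fst x = fst y \<and> (snd x, snd y) \<in> parcs G}"

text \<open>
  A diagram from \<open>A\<close> over \<open>P\<close> to \<open>B\<close> is recorded by the set of pairs of vertices of \<open>A\<close> and
  \<open>B\<close> that come from the same vertex of \<open>P\<close>.  Intersecting two diagrams in the middle object is
  relational composition, and \<open>f O g\<close> is \<open>f\<close> followed by \<open>g\<close>.
\<close>

definition S_hom :: "'v pair_pre_digraph \<Rightarrow> 'v sobj \<Rightarrow> 'v sobj \<Rightarrow> 'v smor set" where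
  "S_hom G A B =
     {P. P \<subseteq> S_verts A \<times> S_verts B \<and> single_valued P \<and> single_valued (P\<inverse>) \<and>
         (\<forall>(x, y) \<in> P. snd x = snd y) \<and>
         (\<forall>(x, y) \<in> P. \<forall>(x', y') \<in> P. (x, x') \<in> S_arrows G A \<longleftrightarrow> (y, y') \<in> S_arrows G B)}"

definition S_id :: "'v sobj \<Rightarrow> 'v smor" where
  "S_id A = Id_on (S_verts A)"

definition S_iso :: "'v pair_pre_digraph \<Rightarrow> 'v sobj \<Rightarrow> 'v sobj \<Rightarrow> 'v smor set" where
  "S_iso G A B = {f \<in> S_hom G A B. \<exists>g \<in> S_hom G B A. f O g = S_id A \<and> g O f = S_id B}"

text \<open>Squares \<open>A \<rightarrow> B\<close> (\<open>i\<close>), \<open>A \<rightarrow> Z\<close> (\<open>a\<close>), \<open>B \<rightarrow> C\<close> (\<open>p\<close>), \<open>Z \<rightarrow> C\<close> (\<open>b\<close>).\<close>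

definition S_pullback where
  "S_pullback G A B Z C i a p b \<longleftrightarrow> i O p = a O b \<and>
     (\<forall>T \<in> S_obj G. \<forall>f \<in> S_hom G T B. \<forall>g \<in> S_hom G T Z. f O p = g O b \<longrightarrow>
        (\<exists>!h. h \<in> S_hom G T A \<and> h O i = f \<and> h O a = g))"

definition S_pushout where
  "S_pushout G A B Z C i a p b \<longleftrightarrow> i O p = a O b \<and>
     (\<forall>T \<in> S_obj G. \<forall>f \<in> S_hom G B T. \<forall>g \<in> S_hom G Z T. i O f = a O g \<longrightarrow>
        (\<exists>!h. h \<in> S_hom G C T \<and> p O h = f \<and> b O h = g))"

text \<open>The empty list is the zero object and the empty relation is the zero morphism.\<close>

definition S_bicartesian where
  "S_bicartesian G A B C i p \<longleftrightarrow>
     S_pullback G A B [] C i {} p {} \<and> S_pushout G A B [] C i {} p {}"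

definition S_prec :: "'v pair_pre_digraph \<Rightarrow> 'v \<Rightarrow> 'v \<Rightarrow> bool" where
  "S_prec G a b \<longleftrightarrow> reachable (with_proj G) b a"

definition basic_mono :: "'v pair_pre_digraph \<Rightarrow> 'v set \<Rightarrow> 'v set \<Rightarrow> bool" where
  "basic_mono G J H \<longleftrightarrow> J \<subseteq> H \<and> H \<subseteq> pverts G \<and> (\<forall>a \<in> J. {b \<in> H. S_prec G b a} \<subseteq> J)"

definition basic_epi :: "'v pair_pre_digraph \<Rightarrow> 'v set \<Rightarrow> 'v set \<Rightarrow> bool" where
  "basic_epi G H K \<longleftrightarrow> K \<subseteq> H \<and> H \<subseteq> pverts G \<and> (\<forall>a \<in> K. {b \<in> H. S_prec G a b} \<subseteq> K)"

text \<open>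
  Disjoint unions are determined up to isomorphism only, so a morphism is admissible if, up to
  isomorphisms of its source and target, it is the disjoint union of basic admissible morphisms
  over two lists of the same length.  Both the disjoint union of the basic monomorphisms
  \<open>\<Gamma>(J\<^sub>k) \<rightarrow> \<Gamma>(H\<^sub>k)\<close> and that of the basic epimorphisms \<open>\<Gamma>(H\<^sub>k) \<rightarrow> \<Gamma>(J\<^sub>k)\<close> are, as relations,
  the identity on the vertices of \<open>[J\<^sub>1, \<dots>, J\<^sub>t]\<close>.
\<close>

definition S_adm_mono :: "'v pair_pre_digraph \<Rightarrow> 'v sobj \<Rightarrow> 'v sobj \<Rightarrow> 'v smor set" where
  "S_adm_mono G A B =
     {i. \<exists>Js Hs. \<exists>a \<in> S_iso G A Js. \<exists>b \<in> S_iso G Hs B.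
           list_all2 (basic_mono G) Js Hs \<and> i = a O Id_on (S_verts Js) O b}"

definition S_adm_epi :: "'v pair_pre_digraph \<Rightarrow> 'v sobj \<Rightarrow> 'v sobj \<Rightarrow> 'v smor set" where
  "S_adm_epi G B C =
     {p. \<exists>Hs Ks. \<exists>b \<in> S_iso G B Hs. \<exists>c \<in> S_iso G Ks C.
           list_all2 (basic_epi G) Hs Ks \<and> p = b O Id_on (S_verts Ks) O c}"

definition S_adm_seqs ::
    "'v pair_pre_digraph \<Rightarrow> 'v sobj \<Rightarrow> 'v sobj \<Rightarrow> 'v sobj \<Rightarrow> ('v sobj \<times> 'v smor \<times> 'v smor) set" where
  "S_adm_seqs G C A B =
     {(B', i, p). B' \<in> S_obj G \<and> S_iso G B' B \<noteq> {} \<and>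
        i \<in> S_adm_mono G A B' \<and> p \<in> S_adm_epi G B' C \<and> S_bicartesian G A B' C i p}"

definition S_ext_equiv ::
    "'v pair_pre_digraph \<Rightarrow> 'v sobj \<Rightarrow> 'v sobj \<Rightarrow> 'v sobj \<Rightarrow> ('v sobj \<times> 'v smor \<times> 'v smor) rel" where
  "S_ext_equiv G C A B =
     {((B1, i1, p1), (B2, i2, p2)).
        (B1, i1, p1) \<in> S_adm_seqs G C A B \<and> (B2, i2, p2) \<in> S_adm_seqs G C A B \<and>
        (\<exists>h \<in> S_iso G B1 B2. i1 O h = i2 \<and> h O p2 = p1)}"

text \<open>\<open>Ext(C, A)\<^sub>B\<close>, the classes of sequences \<open>A \<rightarrow> B' \<rightarrow> C\<close> with \<open>B'\<close> isomorphic to \<open>B\<close>.\<close>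

definition S_Ext ::
    "'v pair_pre_digraph \<Rightarrow> 'v sobj \<Rightarrow> 'v sobj \<Rightarrow> 'v sobj \<Rightarrow> ('v sobj \<times> 'v smor \<times> 'v smor) set set" where
  "S_Ext G C A B = S_adm_seqs G C A B // S_ext_equiv G C A B"


section \<open>Algebras with structure constants on isomorphism classes\<close>

text \<open>
  \<open>R\<close> is the isomorphism relation on the set \<open>Ob\<close> of objects, \<open>z\<close> the zero object, and
  \<open>[M] \<cdot> [N] = \<Sum> c M N K [K]\<close>.  A vector is the finitely supported function of its coefficients
  with respect to the basis of isomorphism classes.  The structure constants used below are
  invariant under isomorphism, so the choice of representatives is immaterial.
\<close>

definition hall_algebra ::
    "'a set \<Rightarrow> 'a rel \<Rightarrow> 'a \<Rightarrow> ('a \<Rightarrow> 'a \<Rightarrow> 'a \<Rightarrow> nat) \<Rightarrow> ('k::field, 'a set \<Rightarrow> 'k) module" where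
  "hall_algebra Ob R z c =
     \<lparr> carrier = {f. finite {K. f K \<noteq> 0} \<and> {K. f K \<noteq> 0} \<subseteq> Ob // R},
       monoid.mult = (\<lambda>f g K. if K \<in> Ob // R
         then \<Sum>M | f M \<noteq> 0. \<Sum>N | g N \<noteq> 0.
           f M * g N * of_nat (c (SOME A. A \<in> M) (SOME A. A \<in> N) (SOME A. A \<in> K))
         else 0),
       monoid.one = (\<lambda>K. if K = R `` {z} then 1 else 0),
       ring.zero = (\<lambda>K. 0),
       ring.add = (\<lambda>f g K. f K + g K),
       module.smult = (\<lambda>a f K. a * f K) \<rparr>"

definition algebra_isomorphic :: "('k, 'a) module \<Rightarrow> ('k, 'b) module \<Rightarrow> bool" where
  "algebra_isomorphic A B \<longleftrightarrow>
     (\<exists>\<phi> \<in> ring_iso A B. \<forall>a. \<forall>x \<in> carrier A. \<phi> (a \<odot>\<^bsub>A\<^esub> x) = a \<odot>\<^bsub>B\<^esub> \<phi> x)"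

definition S_iso_rel :: "'v pair_pre_digraph \<Rightarrow> 'v sobj rel" where
  "S_iso_rel G = {(A, B). A \<in> S_obj G \<and> B \<in> S_obj G \<and> S_iso G A B \<noteq> {}}"

text \<open>In the product \<open>[A] \<cdot> [C]\<close> the left factor is the subobject.\<close>

definition hall_S :: "'v pair_pre_digraph \<Rightarrow> ('k::field, 'v sobj set \<Rightarrow> 'k) module" where
  "hall_S G = hall_algebra (S_obj G) (S_iso_rel G) [] (\<lambda>A C B. card (S_Ext G C A B))"


section \<open>Representations over the field with one element\<close>

text \<open>
  The path category of a quiver \<open>G\<close> has the vertices as objects and the walks
  \<^term>\<open>pre_digraph.awalk G u p v\<close> as morphisms from \<open>u\<close> to \<open>v\<close>; the path \<open>p\<close> followed by \<open>q\<close> is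
  \<open>p @ q\<close>.  The pointed set at \<open>v\<close> is \<open>(pts M v, bpt M v)\<close>, and \<open>act M u p\<close> is the map
  assigned to the path \<open>p\<close> starting at \<open>u\<close>.  Finite sets may be taken to consist of natural
  numbers, up to isomorphism.
\<close>

record ('v, 'e) F1_rep =
  pts :: "'v \<Rightarrow> nat set"
  bpt :: "'v \<Rightarrow> nat"
  act :: "'v \<Rightarrow> 'e list \<Rightarrow> nat \<Rightarrow> nat"

definition F1_map :: "(nat \<Rightarrow> nat) \<Rightarrow> nat set \<Rightarrow> nat \<Rightarrow> nat set \<Rightarrow> nat \<Rightarrow> bool" where
  "F1_map f V v0 W w0 \<longleftrightarrow> f \<in> V \<rightarrow> W \<and> f v0 = w0 \<and> inj_on f {x \<in> V. f x \<noteq> w0}"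

definition is_F1_rep :: "('v, 'e) pre_digraph \<Rightarrow> ('v, 'e) F1_rep \<Rightarrow> bool" where
  "is_F1_rep G M \<longleftrightarrow>
     (\<forall>v \<in> verts G. finite (pts M v) \<and> bpt M v \<in> pts M v) \<and>
     (\<forall>u p v. pre_digraph.awalk G u p v \<longrightarrow>
        F1_map (act M u p) (pts M u) (bpt M u) (pts M v) (bpt M v)) \<and>
     (\<forall>v \<in> verts G. \<forall>x \<in> pts M v. act M v [] x = x) \<and>
     (\<forall>u p v q w. pre_digraph.awalk G u p v \<longrightarrow> pre_digraph.awalk G v q w \<longrightarrow>
        (\<forall>x \<in> pts M u. act M u (p @ q) x = act M v q (act M u p x)))"

definition F1_nilpotent :: "('v, 'e) pre_digraph \<Rightarrow> ('v, 'e) F1_rep \<Rightarrow> bool" where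
  "F1_nilpotent G M \<longleftrightarrow>
     (\<exists>N. \<forall>u p v. pre_digraph.awalk G u p v \<longrightarrow> N \<le> length p \<longrightarrow>
        (\<forall>x \<in> pts M u. act M u p x = bpt M v))"

definition F1_hom ::
    "('v, 'e) pre_digraph \<Rightarrow> ('v, 'e) F1_rep \<Rightarrow> ('v, 'e) F1_rep \<Rightarrow> ('v \<Rightarrow> nat \<Rightarrow> nat) set" where
  "F1_hom G M N =
     {\<phi>. (\<forall>v \<in> verts G. F1_map (\<phi> v) (pts M v) (bpt M v) (pts N v) (bpt N v)) \<and>
         (\<forall>u p v. pre_digraph.awalk G u p v \<longrightarrow>
            (\<forall>x \<in> pts M u. \<phi> v (act M u p x) = act N u p (\<phi> u x)))}"

definition F1_isomorphic ::
    "('v, 'e) pre_digraph \<Rightarrow> ('v, 'e) F1_rep \<Rightarrow> ('v, 'e) F1_rep \<Rightarrow> bool" where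
  "F1_isomorphic G M N \<longleftrightarrow>
     (\<exists>\<phi> \<in> F1_hom G M N. \<exists>\<psi> \<in> F1_hom G N M. \<forall>v \<in> verts G.
        (\<forall>x \<in> pts M v. \<psi> v (\<phi> v x) = x) \<and> (\<forall>y \<in> pts N v. \<phi> v (\<psi> v y) = y))"

definition F1_obj :: "('v, 'e) pre_digraph \<Rightarrow> ('v, 'e) F1_rep set" where
  "F1_obj G = {M. is_F1_rep G M \<and> F1_nilpotent G M}"

definition F1_iso_rel :: "('v, 'e) pre_digraph \<Rightarrow> ('v, 'e) F1_rep rel" where
  "F1_iso_rel G = {(M, N). M \<in> F1_obj G \<and> N \<in> F1_obj G \<and> F1_isomorphic G M N}"

text \<open>
  The family of subsets underlying a subrepresentation is normalised to be empty outside of the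
  vertices, so that distinct families are distinct subrepresentations.
\<close>

definition F1_subreps :: "('v, 'e) pre_digraph \<Rightarrow> ('v, 'e) F1_rep \<Rightarrow> ('v \<Rightarrow> nat set) set" where
  "F1_subreps G R =
     {U. (\<forall>v. v \<notin> verts G \<longrightarrow> U v = {}) \<and>
         (\<forall>v \<in> verts G. U v \<subseteq> pts R v \<and> bpt R v \<in> U v) \<and>
         (\<forall>u p v. pre_digraph.awalk G u p v \<longrightarrow> act R u p ` U u \<subseteq> U v)}"

definition F1_restrict :: "('v, 'e) F1_rep \<Rightarrow> ('v \<Rightarrow> nat set) \<Rightarrow> ('v, 'e) F1_rep" where
  "F1_restrict R U = \<lparr> pts = U, bpt = bpt R, act = act R \<rparr>"

text \<open>
  Collapsing \<open>U v\<close> to the base point amounts to removing the other elements of \<open>U v\<close>;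
  \<^term>\<open>pre_digraph.awlast G u p\<close> is the end point of the path \<open>p\<close> starting at \<open>u\<close>.
\<close>

definition F1_quotient ::
    "('v, 'e) pre_digraph \<Rightarrow> ('v, 'e) F1_rep \<Rightarrow> ('v \<Rightarrow> nat set) \<Rightarrow> ('v, 'e) F1_rep" where
  "F1_quotient G R U =
     \<lparr> pts = (\<lambda>v. insert (bpt R v) (pts R v - U v)),
       bpt = bpt R,
       act = (\<lambda>u p x. let v = pre_digraph.awlast G u p; y = act R u p x
                      in if y \<in> U v then bpt R v else y) \<rparr>"

definition F1_zero :: "('v, 'e) F1_rep" where
  "F1_zero = \<lparr> pts = (\<lambda>v. {0}), bpt = (\<lambda>v. 0), act = (\<lambda>u p x. x) \<rparr>"

text \<open>In the product \<open>[M] \<cdot> [N]\<close> the right factor is the subobject.\<close>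

definition hall_F1 :: "('v, 'e) pre_digraph \<Rightarrow> ('k::field, ('v, 'e) F1_rep set \<Rightarrow> 'k) module" where
  "hall_F1 G = hall_algebra (F1_obj G) (F1_iso_rel G) F1_zero
     (\<lambda>M N R. card {U \<in> F1_subreps G R.
        F1_isomorphic G (F1_restrict R U) N \<and> F1_isomorphic G (F1_quotient G R U) M})"

end

theory Submission
  imports Defs
begin

text \<open>
  Both sides are Hall algebras of one and the same groupoid of combinatorial objects.  Call a
  finite graph \<open>(V, E)\<close> with a map to the quiver \<open>G\<close> immersed if over every arrow of \<open>G\<close> its
  arrows form a partial bijection.  The base points being removed, a representation of a
  quiver over the field with one element is a family of partial injections, that is, an
  immersed graph; subrepresentations are the subsets of \<open>V\<close> closed under arrows, and quotients
  are their complements (\<open>F1_isomorphic_iff\<close>, \<open>F1_coeff_eq\<close>).  If \<open>G\<close> is a forest, a connected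
  immersed graph is embedded as a full subquiver, because its walks without backtracking map to
  walks without backtracking, which never return in a forest.  So every immersed graph is a
  disjoint union of quivers \<open>\<Gamma>\<^bsub>X(J)\<^esub>\<close> with \<open>J\<close> connected (\<open>immersed_realizable\<close>), and the category
  \<open>\<S>\<^sub>X\<close> has the same isomorphism classes.  An admissible exact sequence \<open>A \<rightarrow> B \<rightarrow> C\<close> is a
  successor-closed copy of \<open>A\<close> in \<open>B\<close> whose complement is a copy of \<open>C\<close>
  (\<open>adm_seq_split\<close>, \<open>split_adm_seq\<close>).

  Two differences remain.  First, the structure constants of \<open>\<H>(\<S>\<^sub>X)\<close> count classes of extensions,
  those of the other algebra count subobjects.  The automorphisms of \<open>B\<close> act freely on exact
  sequences with middle term \<open>B\<close>, which gives Riedtmann's formula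
  \<open>|Ext(C, A)\<^sub>B| |Aut B| = |Aut A| |Aut C| F\<^sup>B\<close>, where \<open>F\<^sup>B\<close> is the number of subobjects
  of \<open>B\<close> that are isomorphic to \<open>A\<close> and have a quotient isomorphic to \<open>C\<close> (\<open>card_S_split\<close>,
  \<open>card_S_Ext\<close>).  In characteristic zero one can therefore pass from one basis to the other by
  rescaling \<open>[A]\<close> with \<open>|Aut A|\<close>.

  Secondly, the left factor of a product is the subobject on one side and the quotient on the
  other, so that what has been obtained is an isomorphism with the opposite algebra.  The Hall
  algebra is a connected cocommutative bialgebra and its antipode is an involutive
  anti-automorphism.  Over a forest the antipode has a formula without cancellation: in terms of
  coordinate functions on isomorphism classes it sends \<open>f\<close> to the function
  \<open>(V, E) \<mapsto> \<Sum>F\<subseteq>E. (-1)^(|V| + |F|) f(V, F)\<close>.  That this map is involutive and reverses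
  products follows from this formula by cancelling alternating sums over sets of arrows
  (\<open>antipode_mult\<close>, \<open>antipode_involution\<close>).
\<close>

section \<open>Labelled graphs immersed in a quiver\<close>

text \<open>
  A vertex \<open>(n, v)\<close> has the label \<open>v\<close>, as in \<^const>\<open>S_verts\<close>; the number \<open>n\<close> will be the position
  of a summand or a point of a representation.  Isomorphisms are kept as relations, like the
  morphisms of \<open>\<S>\<^sub>X\<close>, so that a set of isomorphisms is finite and can be counted.
\<close>

type_synonym 'v lgraph = "(nat \<times> 'v) set \<times> 'v smor"

definition lg_iso :: "'v lgraph \<Rightarrow> 'v lgraph \<Rightarrow> 'v smor set" where
  "lg_iso X Y =
     {f. Domain f = fst X \<and> Range f = fst Y \<and> single_valued f \<and> single_valued (f\<inverse>) \<and>
         (\<forall>(x, y) \<in> f. snd x = snd y) \<and>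
         (\<forall>(x, y) \<in> f. \<forall>(x', y') \<in> f. (x, x') \<in> snd X \<longleftrightarrow> (y, y') \<in> snd Y)}"

definition lg_restrict :: "'v lgraph \<Rightarrow> (nat \<times> 'v) set \<Rightarrow> 'v lgraph" where
  "lg_restrict X U = (fst X \<inter> U, snd X \<inter> U \<times> U)"

definition succ_closed :: "'v lgraph \<Rightarrow> (nat \<times> 'v) set set" where
  "succ_closed X = {U. U \<subseteq> fst X \<and> snd X `` U \<subseteq> U}"

lemma lg_isoD:
  assumes "f \<in> lg_iso X Y"
  shows "Domain f = fst X" "Range f = fst Y" "single_valued f" "single_valued (f\<inverse>)"
    "(x, y) \<in> f \<Longrightarrow> snd x = snd y"
    "(x, y) \<in> f \<Longrightarrow> (x', y') \<in> f \<Longrightarrow> (x, x') \<in> snd X \<longleftrightarrow> (y, y') \<in> snd Y"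
    "(x, y) \<in> f \<Longrightarrow> (x, z) \<in> f \<Longrightarrow> y = z"
    "(x, z) \<in> f \<Longrightarrow> (y, z) \<in> f \<Longrightarrow> x = y"
    "(x, y) \<in> f \<Longrightarrow> x \<in> fst X" "(x, y) \<in> f \<Longrightarrow> y \<in> fst Y"
    "x \<in> fst X \<Longrightarrow> \<exists>y. (x, y) \<in> f" "y \<in> fst Y \<Longrightarrow> \<exists>x. (x, y) \<in> f"
  using assms unfolding lg_iso_def single_valued_def by blast+

lemma lg_isoI:
  assumes "Domain f = fst X" "Range f = fst Y"
    "\<And>x y z. (x, y) \<in> f \<Longrightarrow> (x, z) \<in> f \<Longrightarrow> y = z"
    "\<And>x y z. (x, z) \<in> f \<Longrightarrow> (y, z) \<in> f \<Longrightarrow> x = y"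
    "\<And>x y. (x, y) \<in> f \<Longrightarrow> snd x = snd y"
    "\<And>x y x' y'. (x, y) \<in> f \<Longrightarrow> (x', y') \<in> f \<Longrightarrow> (x, x') \<in> snd X \<longleftrightarrow> (y, y') \<in> snd Y"
  shows "f \<in> lg_iso X Y"
  using assms unfolding lg_iso_def single_valued_def by blast

lemma lg_iso_Id: "Id_on (fst X) \<in> lg_iso X X"
  by (rule lg_isoI) auto

lemma lg_iso_converse:
  assumes f: "f \<in> lg_iso X Y" shows "f\<inverse> \<in> lg_iso Y X"
proof (rule lg_isoI)
  show "Domain (f\<inverse>) = fst Y" "Range (f\<inverse>) = fst X" using lg_isoD(1,2)[OF f] by auto
  show "snd x = snd y" if "(x, y) \<in> f\<inverse>" for x y using that lg_isoD(5)[OF f, of y x] by simp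
  show "(x, x') \<in> snd Y \<longleftrightarrow> (y, y') \<in> snd X" if "(x, y) \<in> f\<inverse>" "(x', y') \<in> f\<inverse>" for x y x' y'
    using that lg_isoD(6)[OF f, of y x y' x'] by simp
  show "y = z" if "(x, y) \<in> f\<inverse>" "(x, z) \<in> f\<inverse>" for x y z
    using that lg_isoD(8)[OF f, of y x z] by simp
  show "x = y" if "(x, z) \<in> f\<inverse>" "(y, z) \<in> f\<inverse>" for x y z
    using that lg_isoD(7)[OF f, of z x y] by simp
qed

lemma lg_iso_O:
  assumes f: "f \<in> lg_iso X Y" and g: "g \<in> lg_iso Y Z" shows "f O g \<in> lg_iso X Z"
proof (rule lg_isoI)
  show "Domain (f O g) = fst X" "Range (f O g) = fst Z"
    using lg_isoD(1,2)[OF f] lg_isoD(1,2)[OF g] by blast+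
  show "y = z" if "(x, y) \<in> f O g" "(x, z) \<in> f O g" for x y z
    using that lg_isoD(3)[OF f] lg_isoD(3)[OF g] unfolding single_valued_def by blast
  show "x = y" if "(x, z) \<in> f O g" "(y, z) \<in> f O g" for x y z
    using that lg_isoD(4)[OF f] lg_isoD(4)[OF g] unfolding single_valued_def by blast
  show "snd x = snd y" if xy: "(x, y) \<in> f O g" for x y
  proof -
    obtain z where "(x, z) \<in> f" "(z, y) \<in> g" using xy by blast
    then show ?thesis using lg_isoD(5)[OF f, of x z] lg_isoD(5)[OF g, of z y] by simp
  qed
  show "(x, x') \<in> snd X \<longleftrightarrow> (y, y') \<in> snd Z" if xy: "(x, y) \<in> f O g" "(x', y') \<in> f O g" for x y x' y'
  proof -
    obtain z z' where "(x, z) \<in> f" "(z, y) \<in> g" "(x', z') \<in> f" "(z', y') \<in> g"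
      using xy by blast
    then show ?thesis using lg_isoD(6)[OF f, of x z x' z'] lg_isoD(6)[OF g, of z y z' y'] by simp
  qed
qed

lemma lg_iso_O_converse:
  assumes f: "f \<in> lg_iso X Y" shows "f O f\<inverse> = Id_on (fst X)" "f\<inverse> O f = Id_on (fst Y)"
  using lg_isoD(1-4)[OF f] unfolding single_valued_def by blast+

lemma lg_iso_subset: "f \<in> lg_iso X Y \<Longrightarrow> f \<subseteq> fst X \<times> fst Y"
  using lg_isoD(1,2)[of f X Y] DomainI RangeI by fast

lemma lg_iso_O_Id_on:
  assumes "f \<in> lg_iso X Y" shows "f O Id_on (fst Y) = f" "Id_on (fst X) O f = f"
  unfolding lg_isoD(1,2)[OF assms, symmetric] by auto

lemma finite_lg_iso:
  assumes "finite (fst X)" "finite (fst Y)" shows "finite (lg_iso X Y)"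
  by (rule finite_subset[of _ "Pow (fst X \<times> fst Y)"]) (use lg_iso_subset assms in \<open>blast, auto\<close>)

lemma lg_iso_restrict:
  assumes f: "f \<in> lg_iso X Y" and U: "U \<subseteq> fst X"
  shows "f \<inter> U \<times> UNIV \<in> lg_iso (lg_restrict X U) (lg_restrict Y (f `` U))"
proof (rule lg_isoI)
  show "Domain (f \<inter> U \<times> UNIV) = fst (lg_restrict X U)"
    "Range (f \<inter> U \<times> UNIV) = fst (lg_restrict Y (f `` U))"
    using U unfolding lg_restrict_def lg_isoD(1,2)[OF f, symmetric] by auto
  show "(x, x') \<in> snd (lg_restrict X U) \<longleftrightarrow> (y, y') \<in> snd (lg_restrict Y (f `` U))"
    if "(x, y) \<in> f \<inter> U \<times> UNIV" "(x', y') \<in> f \<inter> U \<times> UNIV" for x y x' y'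
    using that lg_isoD(6)[OF f, of x y x' y'] unfolding lg_restrict_def by auto
  show "y = z" if "(x, y) \<in> f \<inter> U \<times> UNIV" "(x, z) \<in> f \<inter> U \<times> UNIV" for x y z
    using that lg_isoD(7)[OF f, of x y z] by simp
  show "x = y" if "(x, z) \<in> f \<inter> U \<times> UNIV" "(y, z) \<in> f \<inter> U \<times> UNIV" for x y z
    using that lg_isoD(8)[OF f, of x z y] by simp
  show "snd x = snd y" if "(x, y) \<in> f \<inter> U \<times> UNIV" for x y
    using that lg_isoD(5)[OF f, of x y] by simp
qed

lemma lg_iso_Image_Diff:
  assumes f: "f \<in> lg_iso X Y" and U: "U \<subseteq> fst X"
  shows "f `` (fst X - U) = fst Y - f `` U"
proof -
  have "f `` (fst X - U) = f `` Domain f - f `` U"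
    using lg_isoD(8)[OF f] unfolding lg_isoD(1)[OF f, symmetric] by blast
  moreover have "f `` Domain f = Range f" by blast
  ultimately show ?thesis using lg_isoD(2)[OF f] by simp
qed

lemma lg_iso_succ_closed:
  assumes f: "f \<in> lg_iso X Y" and U: "U \<in> succ_closed X" and Y: "snd Y \<subseteq> fst Y \<times> fst Y"
  shows "f `` U \<in> succ_closed Y"
proof -
  have "y' \<in> f `` U" if xy: "(x, y) \<in> f" "x \<in> U" and yy: "(y, y') \<in> snd Y" for x y y'
  proof -
    obtain x' where x': "(x', y') \<in> f" using lg_isoD(12)[OF f, of y'] yy Y by blast
    then have "(x, x') \<in> snd X" using lg_isoD(6)[OF f xy(1) x'] yy by simp
    then show ?thesis using U xy x' unfolding succ_closed_def by blast
  qed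
  then show ?thesis unfolding succ_closed_def lg_isoD(2)[OF f, symmetric] by blast
qed

text \<open>
  Composing with \<open>f\<close> is a bijection onto \<open>lg_iso X Y\<close> from the automorphisms of either end.
\<close>

lemma card_lg_iso:
  assumes f: "f \<in> lg_iso X Y"
  shows "card (lg_iso X Y) = card (lg_iso X X)" "card (lg_iso X Y) = card (lg_iso Y Y)"
proof -
  note c = lg_iso_converse[OF f] and ff = lg_iso_O_converse[OF f]
  have "bij_betw (\<lambda>h. h O f) (lg_iso X X) (lg_iso X Y)"
    by (rule bij_betw_byWitness[where f' = "\<lambda>h. h O f\<inverse>"])
      (auto simp: O_assoc ff lg_iso_O_Id_on intro: lg_iso_O f c)
  then show "card (lg_iso X Y) = card (lg_iso X X)" by (metis bij_betw_same_card)
  have "bij_betw (\<lambda>h. f O h) (lg_iso Y Y) (lg_iso X Y)"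
    by (rule bij_betw_byWitness[where f' = "\<lambda>h. f\<inverse> O h"])
      (auto simp: O_assoc[symmetric] ff lg_iso_O_Id_on intro: lg_iso_O f c)
  then show "card (lg_iso X Y) = card (lg_iso Y Y)" by (metis bij_betw_same_card)
qed

text \<open>
  The Hall number \<open>F\<^sup>K\<^sub>M\<^sub>N\<close>, counting the subobjects of type \<open>N\<close> with quotient of type \<open>M\<close>.
\<close>

definition lg_coeff :: "'v lgraph \<Rightarrow> 'v lgraph \<Rightarrow> 'v lgraph \<Rightarrow> nat" where
  "lg_coeff M N K = card {U \<in> succ_closed K.
     lg_iso (lg_restrict K U) N \<noteq> {} \<and> lg_iso (lg_restrict K (fst K - U)) M \<noteq> {}}"

lemma lg_coeff_iso:
  assumes m: "m \<in> lg_iso M M'" and n: "n \<in> lg_iso N N'" and k: "k \<in> lg_iso K K'"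
    and K: "snd K \<subseteq> fst K \<times> fst K" and K': "snd K' \<subseteq> fst K' \<times> fst K'"
  shows "lg_coeff M N K = lg_coeff M' N' K'"
proof -
  let ?P = "\<lambda>M N K U. U \<in> succ_closed K \<and>
    lg_iso (lg_restrict K U) N \<noteq> {} \<and> lg_iso (lg_restrict K (fst K - U)) M \<noteq> {}"
  have P: "?P M' N' K' (k `` U)" if "?P M N K U" "m \<in> lg_iso M M'" "n \<in> lg_iso N N'" "k \<in> lg_iso K K'"
    "snd K' \<subseteq> fst K' \<times> fst K'" for M N K U m n k M' N' and K' :: "'a lgraph"
  proof -
    have U: "U \<subseteq> fst K" using that unfolding succ_closed_def by blast
    have "k `` U \<in> succ_closed K'" using that lg_iso_succ_closed by blast
    moreover have "lg_iso (lg_restrict K' (k `` U)) N' \<noteq> {}"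
      using that lg_iso_restrict[OF that(4) U] by (metis lg_iso_O lg_iso_converse empty_iff equals0I)
    moreover have "lg_iso (lg_restrict K' (fst K' - k `` U)) M' \<noteq> {}"
      using that lg_iso_restrict[OF that(4), of "fst K - U"] lg_iso_Image_Diff[OF that(4) U]
      by (metis lg_iso_O lg_iso_converse empty_iff equals0I Diff_subset)
    ultimately show ?thesis by blast
  qed
  note c = lg_iso_converse[OF m] lg_iso_converse[OF n] lg_iso_converse[OF k]
  have "bij_betw (\<lambda>U. k `` U) {U. ?P M N K U} {U. ?P M' N' K' U}"
  proof (rule bij_betw_byWitness[where f' = "\<lambda>U. k\<inverse> `` U"])
    show "\<forall>U\<in>{U. ?P M N K U}. k\<inverse> `` (k `` U) = U" "\<forall>U\<in>{U. ?P M' N' K' U}. k `` (k\<inverse> `` U) = U"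
      unfolding succ_closed_def lg_isoD(1,2)[OF k, symmetric]
      using lg_isoD(7,8)[OF k] by blast+
    show "(\<lambda>U. k `` U) ` {U. ?P M N K U} \<subseteq> {U. ?P M' N' K' U}" using P[OF _ m n k K'] by auto
    show "(\<lambda>U. k\<inverse> `` U) ` {U. ?P M' N' K' U} \<subseteq> {U. ?P M N K U}" using P[OF _ c K] by auto
  qed
  then show ?thesis unfolding lg_coeff_def by (simp add: bij_betw_same_card)
qed

text \<open>
  The last condition says that the arrows over a given arrow of \<open>G\<close> form the graph of a partial
  injection between the two fibres.
\<close>

definition immersed :: "'v pair_pre_digraph \<Rightarrow> 'v lgraph set" where
  "immersed G = {(V, E). finite V \<and> snd ` V \<subseteq> pverts G \<and> E \<subseteq> V \<times> V \<and>
     (\<forall>(x, y) \<in> E. (snd x, snd y) \<in> parcs G) \<and>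
     (\<forall>(x, y) \<in> E. \<forall>(x', y') \<in> E. snd x = snd x' \<and> snd y = snd y' \<longrightarrow> (x = x' \<longleftrightarrow> y = y'))}"

lemma immersedD:
  assumes "X \<in> immersed G"
  shows "finite (fst X)" "x \<in> fst X \<Longrightarrow> snd x \<in> pverts G" "snd X \<subseteq> fst X \<times> fst X"
    "(x, y) \<in> snd X \<Longrightarrow> (snd x, snd y) \<in> parcs G"
    "(x, y) \<in> snd X \<Longrightarrow> x \<in> fst X" "(x, y) \<in> snd X \<Longrightarrow> y \<in> fst X"
    "(x, y) \<in> snd X \<Longrightarrow> (x, y') \<in> snd X \<Longrightarrow> snd y = snd y' \<Longrightarrow> y = y'"
    "(x, y) \<in> snd X \<Longrightarrow> (x', y) \<in> snd X \<Longrightarrow> snd x = snd x' \<Longrightarrow> x = x'"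
proof -
  obtain V E where X: "X = (V, E)" by (cases X)
  note a = assms[unfolded X immersed_def, simplified]
  show "finite (fst X)" "snd X \<subseteq> fst X \<times> fst X" using a by (simp_all add: X)
  show "snd x \<in> pverts G" if "x \<in> fst X" for x using a that by (auto simp: X)
  show "(snd x, snd y) \<in> parcs G" "x \<in> fst X" "y \<in> fst X" if "(x, y) \<in> snd X" for x y
    using a that by (auto simp: X)
  have inj: "x = x' \<longleftrightarrow> y = y'"
    if "(x, y) \<in> snd X" "(x', y') \<in> snd X" "snd x = snd x'" "snd y = snd y'" for x y x' y'
    using assms[unfolded X immersed_def] that unfolding X by (force simp: X)
  show "y = y'" if "(x, y) \<in> snd X" "(x, y') \<in> snd X" "snd y = snd y'" for x y y'
    using inj[OF that(1,2)] that(3) by simp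
  show "x = x'" if "(x, y) \<in> snd X" "(x', y) \<in> snd X" "snd x = snd x'" for x x' y
    using inj[OF that(1,2)] that(3) by simp
qed

lemma immersedI:
  assumes "finite V" "\<And>x. x \<in> V \<Longrightarrow> snd x \<in> pverts G" "E \<subseteq> V \<times> V"
    "\<And>x y. (x, y) \<in> E \<Longrightarrow> (snd x, snd y) \<in> parcs G"
    "\<And>x y y'. (x, y) \<in> E \<Longrightarrow> (x, y') \<in> E \<Longrightarrow> snd y = snd y' \<Longrightarrow> y = y'"
    "\<And>x x' y. (x, y) \<in> E \<Longrightarrow> (x', y) \<in> E \<Longrightarrow> snd x = snd x' \<Longrightarrow> x = x'"
  shows "(V, E) \<in> immersed G"
proof -
  have "x = x' \<longleftrightarrow> y = y'" if "(x, y) \<in> E" "(x', y') \<in> E" "snd x = snd x'" "snd y = snd y'" for x y x' y'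
    using that assms(5)[of x y y'] assms(6)[of x y x'] by blast
  then show ?thesis unfolding immersed_def using assms(1-4) by blast
qed

lemma immersed_subgraph:
  assumes "(V, E) \<in> immersed G" "U \<subseteq> V" "F \<subseteq> E" "F \<subseteq> U \<times> U"
  shows "(U, F) \<in> immersed G"
proof (rule immersedI)
  note D = immersedD[OF assms(1), simplified]
  show "finite U" "F \<subseteq> U \<times> U" using D(1) assms(2,4) finite_subset by auto
  show "snd x \<in> pverts G" if "x \<in> U" for x using D(2) assms(2) that by blast
  show "(snd x, snd y) \<in> parcs G" if "(x, y) \<in> F" for x y using D(4)[of x y] assms(3) that by blast
  show "y = y'" if "(x, y) \<in> F" "(x, y') \<in> F" "snd y = snd y'" for x y y'
    using D(7)[of x y y'] assms(3) that by blast
  show "x = x'" if "(x, y) \<in> F" "(x', y) \<in> F" "snd x = snd x'" for x x' y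
    using D(8)[of x y x'] assms(3) that by blast
qed

lemma immersed_restrict:
  assumes "X \<in> immersed G" shows "lg_restrict X U \<in> immersed G"
  using immersed_subgraph[of "fst X" "snd X" G "fst X \<inter> U" "snd X \<inter> U \<times> U"] immersedD(3)[OF assms] assms
  unfolding lg_restrict_def by fastforce

lemma immersed_empty: "({}, {}) \<in> immersed G"
  by (simp add: immersed_def)

definition lg_iso_rel :: "'v pair_pre_digraph \<Rightarrow> 'v lgraph rel" where
  "lg_iso_rel G = {(X, Y). X \<in> immersed G \<and> Y \<in> immersed G \<and> lg_iso X Y \<noteq> {}}"

lemma equiv_lg_iso_rel: "equiv (immersed G) (lg_iso_rel G)"
proof (rule equivI)
  show "lg_iso_rel G \<subseteq> immersed G \<times> immersed G" unfolding lg_iso_rel_def by blast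
  show "refl_on (immersed G) (lg_iso_rel G)"
    unfolding refl_on_def lg_iso_rel_def using lg_iso_Id by blast
  show "sym (lg_iso_rel G)"
    unfolding sym_def lg_iso_rel_def using lg_iso_converse by blast
  show "trans (lg_iso_rel G)"
    unfolding trans_def lg_iso_rel_def using lg_iso_O by blast
qed

text \<open>
  In \<open>hall_lg\<close> the right factor of a product is the subobject, in \<open>hall_lg_op\<close> it is the left one.
\<close>

definition hall_lg :: "'v pair_pre_digraph \<Rightarrow> ('k::field, 'v lgraph set \<Rightarrow> 'k) module" where
  "hall_lg G = hall_algebra (immersed G) (lg_iso_rel G) ({}, {}) lg_coeff"

definition hall_lg_op :: "'v pair_pre_digraph \<Rightarrow> ('k::field, 'v lgraph set \<Rightarrow> 'k) module" where
  "hall_lg_op G = hall_algebra (immersed G) (lg_iso_rel G) ({}, {}) (\<lambda>M N. lg_coeff N M)"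

lemma lg_coeff_cong:
  assumes "(M, M') \<in> lg_iso_rel G" "(N, N') \<in> lg_iso_rel G" "(K, K') \<in> lg_iso_rel G"
  shows "lg_coeff M N K = lg_coeff M' N' K'"
  using assms lg_coeff_iso immersedD(3) unfolding lg_iso_rel_def by blast

section \<open>Transport of Hall algebras along equivalences\<close>

lemma rep_in_class: "equiv S R \<Longrightarrow> M \<in> S // R \<Longrightarrow> (SOME A. A \<in> M) \<in> M"
  using in_quotient_imp_non_empty[of S R M] some_in_eq[of M] by auto

lemma rep_in_set: "equiv S R \<Longrightarrow> M \<in> S // R \<Longrightarrow> (SOME A. A \<in> M) \<in> S"
  using rep_in_class in_quotient_imp_subset by blast

lemma class_of_member: "equiv S R \<Longrightarrow> M \<in> S // R \<Longrightarrow> A \<in> M \<Longrightarrow> R `` {A} = M"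
  by (elim quotientE) (auto dest: equiv_class_eq)

lemma class_of_rep: "equiv S R \<Longrightarrow> M \<in> S // R \<Longrightarrow> R `` {SOME A. A \<in> M} = M"
  by (rule class_of_member[OF _ _ rep_in_class])

lemma rep_of_class: "equiv S R \<Longrightarrow> A \<in> S \<Longrightarrow> (A, SOME B. B \<in> R `` {A}) \<in> R"
  using rep_in_class[of S R "R `` {A}"] by (simp add: quotientI)

text \<open>
  Structure constants that correspond to each other up to a weight \<open>w\<close> give isomorphic algebras:
  the map \<open>[A] \<mapsto> w A [g A]\<close> is multiplicative.  Weights are what turns the count of extensions into
  a count of subobjects.
\<close>

locale hall_equivalence =
  fixes Ob1 :: "'a set" and R1 z1 c1 and Ob2 :: "'b set" and R2 z2 c2
    and g :: "'a \<Rightarrow> 'b" and w :: "'a \<Rightarrow> 'k::field"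
  assumes equiv1: "equiv Ob1 R1" and equiv2: "equiv Ob2 R2"
    and g_in: "A \<in> Ob1 \<Longrightarrow> g A \<in> Ob2"
    and g_iso: "A \<in> Ob1 \<Longrightarrow> B \<in> Ob1 \<Longrightarrow> (g A, g B) \<in> R2 \<longleftrightarrow> (A, B) \<in> R1"
    and g_surj: "Y \<in> Ob2 \<Longrightarrow> \<exists>A \<in> Ob1. (g A, Y) \<in> R2"
    and z1_in: "z1 \<in> Ob1" and g_zero: "(g z1, z2) \<in> R2"
    and w_nonzero: "A \<in> Ob1 \<Longrightarrow> w A \<noteq> 0" and w_zero: "(z1, A) \<in> R1 \<Longrightarrow> w A = 1"
    and c_weighted: "A \<in> Ob1 \<Longrightarrow> B \<in> Ob1 \<Longrightarrow> K \<in> Ob1 \<Longrightarrow>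
      w K * of_nat (c1 A B K) = w A * w B * of_nat (c2 (g A) (g B) (g K))"
    and c2_cong: "(X, X') \<in> R2 \<Longrightarrow> (Y, Y') \<in> R2 \<Longrightarrow> (Z, Z') \<in> R2 \<Longrightarrow> c2 X Y Z = c2 X' Y' Z'"
begin

abbreviation (input) rep :: "'c set \<Rightarrow> 'c" where "rep M \<equiv> SOME A. A \<in> M"

abbreviation (input) "H1 \<equiv> hall_algebra Ob1 R1 z1 c1 :: ('k, 'a set \<Rightarrow> 'k) module"
abbreviation (input) "H2 \<equiv> hall_algebra Ob2 R2 z2 c2 :: ('k, 'b set \<Rightarrow> 'k) module"

definition pull :: "'b set \<Rightarrow> 'a set" where
  "pull N = {A \<in> Ob1. g A \<in> N}"

lemma pull_class: "A \<in> Ob1 \<Longrightarrow> pull (R2 `` {g A}) = R1 `` {A}"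
  using equiv_type[OF equiv1] g_iso unfolding pull_def by auto

lemma class2: "N \<in> Ob2 // R2 \<Longrightarrow> \<exists>A \<in> Ob1. N = R2 `` {g A}"
  by (elim quotientE) (metis equiv2 equiv_class_eq g_surj)

lemma pull_in: "N \<in> Ob2 // R2 \<Longrightarrow> pull N \<in> Ob1 // R1"
  using class2 pull_class quotientI by metis

lemma push_pull: "N \<in> Ob2 // R2 \<Longrightarrow> R2 `` {g (rep (pull N))} = N"
proof -
  assume N: "N \<in> Ob2 // R2"
  have "rep (pull N) \<in> pull N" using rep_in_class[OF equiv1 pull_in[OF N]] .
  then show ?thesis
    using class_of_member[OF equiv2 N] by (simp add: pull_def)
qed

lemma pull_push: "M \<in> Ob1 // R1 \<Longrightarrow> pull (R2 `` {g (rep M)}) = M"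
  using pull_class rep_in_set[OF equiv1] class_of_rep[OF equiv1] by metis

lemma pull_bij: "bij_betw pull (Ob2 // R2) (Ob1 // R1)"
  by (rule bij_betw_byWitness[where f' = "\<lambda>M. R2 `` {g (rep M)}"])
    (use push_pull pull_push pull_in g_in rep_in_set[OF equiv1] in \<open>auto intro!: quotientI\<close>)

text \<open>
  The chosen representatives of corresponding classes need not correspond, but are isomorphic.
\<close>

lemma rep_pull: "N \<in> Ob2 // R2 \<Longrightarrow> (g (rep (pull N)), rep N) \<in> R2"
  using push_pull[of N] rep_of_class[OF equiv2 g_in[OF rep_in_set[OF equiv1 pull_in]], of N] by simp

definition transport :: "('a set \<Rightarrow> 'k) \<Rightarrow> 'b set \<Rightarrow> 'k" where
  "transport f N = (if N \<in> Ob2 // R2 then w (rep (pull N)) * f (pull N) else 0)"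

lemma w_pull: "N \<in> Ob2 // R2 \<Longrightarrow> w (rep (pull N)) \<noteq> 0"
  using w_nonzero rep_in_set[OF equiv1] pull_in by blast

lemma support_bij:
  assumes "{M. f M \<noteq> 0} \<subseteq> Ob1 // R1"
  shows "bij_betw pull {N. transport f N \<noteq> 0} {M. f M \<noteq> 0}"
proof -
  have "{N. transport f N \<noteq> 0} = {N \<in> Ob2 // R2. f (pull N) \<noteq> 0}"
    unfolding transport_def using w_pull by auto
  moreover have "pull ` {N \<in> Ob2 // R2. f (pull N) \<noteq> 0} = {M. f M \<noteq> 0}"
  proof -
    have "{M. f M \<noteq> 0} \<subseteq> pull ` (Ob2 // R2)" using assms pull_bij unfolding bij_betw_def by simp
    then show ?thesis by blast
  qed
  ultimately show ?thesis
    using pull_bij unfolding bij_betw_def by (auto intro: inj_on_subset)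
qed

lemma transport_mult:
  assumes f: "f \<in> carrier H1" and h: "h \<in> carrier H1"
  shows "transport (f \<otimes>\<^bsub>H1\<^esub> h) = transport f \<otimes>\<^bsub>H2\<^esub> transport h"
proof
  fix K
  let ?t = "\<lambda>M N. w (rep (pull K)) * (f M * h N * of_nat (c1 (rep M) (rep N) (rep (pull K))))"
  have sf: "{M. f M \<noteq> 0} \<subseteq> Ob1 // R1" and sh: "{M. h M \<noteq> 0} \<subseteq> Ob1 // R1"
    using f h by (auto simp: hall_algebra_def)
  show "transport (f \<otimes>\<^bsub>H1\<^esub> h) K = (transport f \<otimes>\<^bsub>H2\<^esub> transport h) K"
  proof (cases "K \<in> Ob2 // R2")
    case True
    have summand: "?t (pull M) (pull N) = transport f M * transport h N * of_nat (c2 (rep M) (rep N) (rep K))"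
      if M: "M \<in> {M. transport f M \<noteq> 0}" and N: "N \<in> {N. transport h N \<noteq> 0}" for M N
    proof -
      have MN: "M \<in> Ob2 // R2" "N \<in> Ob2 // R2" using M N by (auto simp: transport_def split: if_splits)
      note i = rep_in_set[OF equiv1 pull_in]
      show ?thesis
        using MN True c_weighted[OF i[OF MN(1)] i[OF MN(2)] i[OF True]]
          c2_cong[OF rep_pull[OF MN(1)] rep_pull[OF MN(2)] rep_pull[OF True]]
        by (simp add: transport_def mult_ac)
    qed
    have "transport (f \<otimes>\<^bsub>H1\<^esub> h) K = (\<Sum>M | f M \<noteq> 0. \<Sum>N | h N \<noteq> 0. ?t M N)"
      using True pull_in[OF True] by (simp add: transport_def hall_algebra_def sum_distrib_left)
    also have "\<dots> = (\<Sum>M | transport f M \<noteq> 0. \<Sum>N | transport h N \<noteq> 0. ?t (pull M) (pull N))"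
      unfolding sum.reindex_bij_betw[OF support_bij[OF sf], symmetric]
        sum.reindex_bij_betw[OF support_bij[OF sh], symmetric] ..
    also have "\<dots> = (\<Sum>M | transport f M \<noteq> 0. \<Sum>N | transport h N \<noteq> 0.
        transport f M * transport h N * of_nat (c2 (rep M) (rep N) (rep K)))"
      by (rule sum.cong[OF HOL.refl], rule sum.cong[OF HOL.refl], rule summand)
    also have "\<dots> = (transport f \<otimes>\<^bsub>H2\<^esub> transport h) K"
      using True by (simp add: hall_algebra_def)
    finally show ?thesis .
  next
    case False
    then show ?thesis by (simp add: transport_def hall_algebra_def)
  qed
qed

lemma transport_one: "transport \<one>\<^bsub>H1\<^esub> = \<one>\<^bsub>H2\<^esub>"
proof
  fix K
  have z: "R2 `` {g z1} = R2 `` {z2}" using g_zero equiv2 by (metis equiv_class_eq)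
  have zq: "R2 `` {z2} \<in> Ob2 // R2" using z g_in z1_in quotientI by metis
  have p: "pull K = R1 `` {z1} \<longleftrightarrow> K = R2 `` {z2}" if "K \<in> Ob2 // R2"
    using pull_class[OF z1_in] z zq that pull_bij unfolding bij_betw_def inj_on_def by metis
  have "w (rep (pull (R2 `` {z2}))) = 1"
    using pull_class[OF z1_in] z w_zero rep_of_class[OF equiv1 z1_in] by simp
  then show "transport \<one>\<^bsub>H1\<^esub> K = \<one>\<^bsub>H2\<^esub> K"
    using p zq by (auto simp: transport_def hall_algebra_def)
qed

lemma transport_carrier: "f \<in> carrier H1 \<Longrightarrow> transport f \<in> carrier H2"
  using support_bij[of f] bij_betw_finite
  by (auto simp: hall_algebra_def transport_def split: if_splits)

lemma transport_iso: "algebra_isomorphic H1 H2"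
proof -
  let ?inv = "\<lambda>h M. if M \<in> Ob1 // R1 then h (R2 `` {g (rep M)}) / w (rep M) else 0"
  have "bij_betw transport (carrier H1) (carrier H2)"
  proof (rule bij_betw_byWitness[where f' = ?inv])
    show "\<forall>f \<in> carrier H1. ?inv (transport f) = f"
    proof
      fix f assume f: "f \<in> carrier H1"
      have "?inv (transport f) M = f M" for M
      proof (cases "M \<in> Ob1 // R1")
        case True
        then show ?thesis
          using pull_push[OF True] w_nonzero[OF rep_in_set[OF equiv1 True]]
            quotientI[OF g_in[OF rep_in_set[OF equiv1 True]], of R2]
          by (simp add: transport_def)
      next
        case False
        then show ?thesis using f by (auto simp: hall_algebra_def)
      qed
      then show "?inv (transport f) = f" by blast
    qed
    show "\<forall>h \<in> carrier H2. transport (?inv h) = h"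
    proof
      fix h assume h: "h \<in> carrier H2"
      have "transport (?inv h) N = h N" for N
        using h push_pull[of N] w_pull[of N] pull_in[of N]
        by (auto simp: transport_def hall_algebra_def)
      then show "transport (?inv h) = h" by blast
    qed
    show "transport ` carrier H1 \<subseteq> carrier H2" using transport_carrier by blast
    show "?inv ` carrier H2 \<subseteq> carrier H1"
    proof
      fix f assume "f \<in> ?inv ` carrier H2"
      then obtain h where h: "h \<in> carrier H2" and f: "f = ?inv h" by blast
      have "{M. f M \<noteq> 0} \<subseteq> pull ` {N. h N \<noteq> 0}"
      proof
        fix M assume "M \<in> {M. f M \<noteq> 0}"
        then have "M \<in> Ob1 // R1" "h (R2 `` {g (rep M)}) \<noteq> 0" unfolding f by (auto split: if_splits)
        then show "M \<in> pull ` {N. h N \<noteq> 0}" using pull_push by (metis (mono_tags, lifting) imageI mem_Collect_eq)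
      qed
      then have "finite {M. f M \<noteq> 0}" using h by (auto simp: hall_algebra_def intro: finite_subset)
      moreover have "{M. f M \<noteq> 0} \<subseteq> Ob1 // R1" unfolding f by (auto split: if_splits)
      ultimately show "f \<in> carrier H1" by (simp add: hall_algebra_def)
    qed
  qed
  moreover have "transport \<in> ring_hom H1 H2"
  proof (rule ring_hom_memI)
    fix f h assume fh: "f \<in> carrier H1" "h \<in> carrier H1"
    show "transport f \<in> carrier H2" by (rule transport_carrier[OF fh(1)])
    show "transport (f \<otimes>\<^bsub>H1\<^esub> h) = transport f \<otimes>\<^bsub>H2\<^esub> transport h" by (rule transport_mult[OF fh])
    show "transport (f \<oplus>\<^bsub>H1\<^esub> h) = transport f \<oplus>\<^bsub>H2\<^esub> transport h"
      by (auto simp: hall_algebra_def transport_def algebra_simps)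
  qed (rule transport_one)
  ultimately have "transport \<in> ring_iso H1 H2" unfolding ring_iso_def by blast
  moreover have "transport (a \<odot>\<^bsub>H1\<^esub> f) = a \<odot>\<^bsub>H2\<^esub> transport f" for a f
    by (auto simp: hall_algebra_def transport_def)
  ultimately show ?thesis unfolding algebra_isomorphic_def by blast
qed

end

lemma algebra_isomorphic_trans:
  assumes "algebra_isomorphic A B" "algebra_isomorphic B C"
  shows "algebra_isomorphic A C"
proof -
  obtain \<phi> \<psi> where \<phi>: "\<phi> \<in> ring_iso A B" "\<And>a x. x \<in> carrier A \<Longrightarrow> \<phi> (a \<odot>\<^bsub>A\<^esub> x) = a \<odot>\<^bsub>B\<^esub> \<phi> x"
    and \<psi>: "\<psi> \<in> ring_iso B C" "\<And>a x. x \<in> carrier B \<Longrightarrow> \<psi> (a \<odot>\<^bsub>B\<^esub> x) = a \<odot>\<^bsub>C\<^esub> \<psi> x"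
    using assms unfolding algebra_isomorphic_def by blast
  have "\<psi> \<circ> \<phi> \<in> ring_iso A C" using \<phi>(1) \<psi>(1) by (rule ring_iso_set_trans)
  moreover have "(\<psi> \<circ> \<phi>) (a \<odot>\<^bsub>A\<^esub> x) = a \<odot>\<^bsub>C\<^esub> (\<psi> \<circ> \<phi>) x" if "x \<in> carrier A" for a x
    using \<phi>(2)[OF that] \<psi>(2) ring_iso_memE(1)[OF \<phi>(1) that] by simp
  ultimately show ?thesis unfolding algebra_isomorphic_def by blast
qed

section \<open>The anti-automorphism that deletes arrows\<close>

lemma sum_Pow_sign:
  assumes "finite A"
  shows "(\<Sum>F\<in>Pow A. (- 1) ^ card F) = (if A = {} then 1 else (0 :: 'a::comm_ring_1))"
  using assms
proof (induction A rule: finite_induct)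
  case (insert a A)
  have "(\<Sum>F\<in>Pow (insert a A). (- 1) ^ card F :: 'a) =
      (\<Sum>F\<in>Pow A. (- 1) ^ card F) + (\<Sum>F\<in>insert a ` Pow A. (- 1) ^ card F)"
    unfolding Pow_insert using insert.hyps by (intro sum.union_disjoint) auto
  also have "(\<Sum>F\<in>insert a ` Pow A. (- 1) ^ card F :: 'a) = (\<Sum>F\<in>Pow A. (- 1) ^ card (insert a F))"
    using insert.hyps(2) by (subst sum.reindex) (auto simp: inj_on_def)
  also have "\<dots> = - (\<Sum>F\<in>Pow A. (- 1) ^ card F)"
    unfolding sum_negf[symmetric]
  proof (rule sum.cong[OF HOL.refl])
    fix F assume "F \<in> Pow A"
    then have "finite F" "a \<notin> F" using insert.hyps finite_subset by auto
    then show "(- 1) ^ card (insert a F) = - ((- 1) ^ card F :: 'a)" by simp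
  qed
  finally show ?case by simp
qed simp

lemma bij_betw_Pow_Un:
  assumes "A \<inter> B = {}"
  shows "bij_betw (\<lambda>(F, H). F \<union> H) (Pow A \<times> Pow B) (Pow (A \<union> B))"
  by (rule bij_betw_byWitness[where f' = "\<lambda>F. (F \<inter> A, F \<inter> B)"]) (use assms in auto)

text \<open>
  A product in a Hall algebra is a sum over pairs of classes; since every \<open>U\<close> contributes to one
  pair only, it can be evaluated as a sum over the subobjects \<open>U\<close>.
\<close>

lemma sum_card_fibres:
  fixes f :: "'m \<Rightarrow> 'k::comm_semiring_1" and g :: "'n \<Rightarrow> 'k"
  assumes "finite S" "finite A" "finite B" and f: "\<And>M. M \<notin> A \<Longrightarrow> f M = 0" and g: "\<And>N. N \<notin> B \<Longrightarrow> g N = 0"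
  shows "(\<Sum>M\<in>A. \<Sum>N\<in>B. f M * g N * of_nat (card {U \<in> S. a U = M \<and> b U = N})) = (\<Sum>U\<in>S. f (a U) * g (b U))"
proof -
  have "f M * g N * of_nat (card {U \<in> S. a U = M \<and> b U = N}) =
      (\<Sum>U\<in>S. (if M = a U then f M else 0) * (if N = b U then g N else 0))" for M N
  proof -
    have "f M * g N * of_nat (card {U \<in> S. a U = M \<and> b U = N}) =
        (\<Sum>U\<in>{U \<in> S. a U = M \<and> b U = N}. f M * g N)"
      by (simp add: mult.commute)
    also have "\<dots> = (\<Sum>U\<in>S. (if M = a U then f M else 0) * (if N = b U then g N else 0))"
      using assms(1) by (intro sum.mono_neutral_cong_left) auto
    finally show ?thesis .
  qed
  then have "(\<Sum>M\<in>A. \<Sum>N\<in>B. f M * g N * of_nat (card {U \<in> S. a U = M \<and> b U = N})) =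
      (\<Sum>M\<in>A. \<Sum>N\<in>B. \<Sum>U\<in>S. (if M = a U then f M else 0) * (if N = b U then g N else 0))"
    by simp
  also have "\<dots> = (\<Sum>M\<in>A. \<Sum>U\<in>S. \<Sum>N\<in>B. (if M = a U then f M else 0) * (if N = b U then g N else 0))"
    by (rule sum.cong[OF HOL.refl], rule sum.swap)
  also have "\<dots> = (\<Sum>U\<in>S. \<Sum>M\<in>A. \<Sum>N\<in>B. (if M = a U then f M else 0) * (if N = b U then g N else 0))"
    by (rule sum.swap)
  also have "\<dots> = (\<Sum>U\<in>S. (\<Sum>M\<in>A. if M = a U then f M else 0) * (\<Sum>N\<in>B. if N = b U then g N else 0))"
    by (simp add: sum_product)
  also have "\<dots> = (\<Sum>U\<in>S. f (a U) * g (b U))"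
    using assms by (intro sum.cong) (auto simp: sum.delta')
  finally show ?thesis .
qed

text \<open>
  One bijection of vertices serves all subsets \<open>F\<close> of the arrows at once, so that deleting arrows
  is compatible with isomorphisms.
\<close>

lemma lg_iso_function:
  assumes f: "f \<in> lg_iso X Y" and X: "X \<in> immersed G" and Y: "Y \<in> immersed G"
  obtains h where "bij_betw h (fst X) (fst Y)" "bij_betw (map_prod h h) (snd X) (snd Y)"
    "\<And>F. F \<subseteq> snd X \<Longrightarrow> f \<in> lg_iso (fst X, F) (fst Y, map_prod h h ` F)"
proof -
  define h where "h x = (THE y. (x, y) \<in> f)" for x
  have h: "h x = y" if "(x, y) \<in> f" for x y
    unfolding h_def using that lg_isoD(7)[OF f that] by blast
  have fh: "(x, h x) \<in> f" if "x \<in> fst X" for x using lg_isoD(11)[OF f that] h by metis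
  have inj: "inj_on h (fst X)"
    using fh lg_isoD(8)[OF f] by (metis inj_onI)
  have V: "bij_betw h (fst X) (fst Y)"
    unfolding bij_betw_def
  proof (intro conjI inj equalityI subsetI)
    show "y \<in> fst Y" if "y \<in> h ` fst X" for y using that fh lg_isoD(10)[OF f] by blast
    show "y \<in> h ` fst X" if "y \<in> fst Y" for y
      using lg_isoD(12)[OF f that] h lg_isoD(9)[OF f] by blast
  qed
  note DX = immersedD[OF X] and DY = immersedD[OF Y]
  have inj2: "inj_on (map_prod h h) (fst X \<times> fst X)" using inj by (rule map_prod_inj_on[OF _ inj])
  have E: "bij_betw (map_prod h h) (snd X) (snd Y)"
    unfolding bij_betw_def
  proof (intro conjI equalityI subsetI)
    show "inj_on (map_prod h h) (snd X)" using inj2 DX(3) by (rule inj_on_subset)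
    show "e \<in> snd Y" if e: "e \<in> map_prod h h ` snd X" for e
    proof -
      obtain x x' where x: "(x, x') \<in> snd X" "e = (h x, h x')" using e by auto
      then show ?thesis using lg_isoD(6)[OF f fh fh, of x x'] DX(5,6)[OF x(1)] by simp
    qed
    show "e \<in> map_prod h h ` snd X" if e: "e \<in> snd Y" for e
    proof -
      obtain y y' where y: "e = (y, y')" by (cases e)
      then have "y \<in> fst Y" "y' \<in> fst Y" using e DY(5,6) by blast+
      then obtain x x' where x: "(x, y) \<in> f" "(x', y') \<in> f" using lg_isoD(12)[OF f] by metis
      then have "(x, x') \<in> snd X" using lg_isoD(6)[OF f x] e y by simp
      then show ?thesis using h[OF x(1)] h[OF x(2)] y by force
    qed
  qed
  have "f \<in> lg_iso (fst X, F) (fst Y, map_prod h h ` F)" if F: "F \<subseteq> snd X" for F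
  proof (rule lg_isoI)
    show "(x, x') \<in> snd (fst X, F) \<longleftrightarrow> (y, y') \<in> snd (fst Y, map_prod h h ` F)"
      if xy: "(x, y) \<in> f" "(x', y') \<in> f" for x y x' y'
    proof -
      have "(x, x') \<in> fst X \<times> fst X" using xy lg_isoD(9)[OF f] by blast
      then have "map_prod h h (x, x') \<in> map_prod h h ` F \<longleftrightarrow> (x, x') \<in> F"
        by (rule inj_on_image_mem_iff[OF inj2 _ subset_trans[OF F DX(3)]])
      then show ?thesis using h[OF xy(1)] h[OF xy(2)] by simp
    qed
  qed (use lg_isoD(1,2)[OF f] in \<open>simp_all add: lg_isoD(5,7,8)[OF f]\<close>)
  then show thesis using that V E by blast
qed

locale quiver =
  fixes G :: "'v pair_pre_digraph"
begin

abbreviation (input) cls :: "'v lgraph \<Rightarrow> 'v lgraph set" where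
  "cls X \<equiv> lg_iso_rel G `` {X}"

abbreviation (input) iso_classes :: "'v lgraph set set" where
  "iso_classes \<equiv> immersed G // lg_iso_rel G"

lemma cls_eq_iff: "X \<in> immersed G \<Longrightarrow> Y \<in> immersed G \<Longrightarrow> cls X = cls Y \<longleftrightarrow> lg_iso X Y \<noteq> {}"
  using eq_equiv_class_iff[OF equiv_lg_iso_rel, of X G Y] by (simp add: lg_iso_rel_def)

lemma cls_in: "X \<in> immersed G \<Longrightarrow> cls X \<in> iso_classes"
  by (rule quotientI)

lemma iso_classes_cases:
  assumes "K \<in> iso_classes" obtains X where "X \<in> immersed G" "K = cls X"
  using assms by (rule quotientE)

lemma finite_succ_closed: "X \<in> immersed G \<Longrightarrow> finite (succ_closed X)"
  using immersedD(1)[of X G] unfolding succ_closed_def by (auto intro: finite_subset[of _ "Pow (fst X)"])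

text \<open>
  Choosing representatives in \<^const>\<open>hall_algebra\<close> is harmless, and for a given graph \<open>X\<close> the
  structure constants count subobjects by the classes of their two pieces.
\<close>

lemma lg_coeff_cls:
  assumes "M \<in> iso_classes" "N \<in> iso_classes" "X \<in> immersed G"
  shows "lg_coeff (SOME A. A \<in> M) (SOME A. A \<in> N) (SOME A. A \<in> cls X) =
    card {U \<in> succ_closed X. cls (lg_restrict X U) = N \<and> cls (lg_restrict X (fst X - U)) = M}"
proof -
  note eq = equiv_lg_iso_rel[of G]
  have r: "lg_iso Y (SOME A. A \<in> M) \<noteq> {} \<longleftrightarrow> cls Y = M" if "Y \<in> immersed G" "M \<in> iso_classes" for Y M
    using cls_eq_iff[OF that(1) rep_in_set[OF eq that(2)]] class_of_rep[OF eq that(2)] by simp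
  have rr: "(Y, Y) \<in> lg_iso_rel G" if "Y \<in> immersed G" for Y
    using that eq by (meson equivE refl_onD)
  have "lg_coeff (SOME A. A \<in> M) (SOME A. A \<in> N) (SOME A. A \<in> cls X) =
      lg_coeff (SOME A. A \<in> M) (SOME A. A \<in> N) X"
    by (rule lg_coeff_cong[symmetric, OF rr rr rep_of_class])
      (use eq assms rep_in_set[OF eq] in blast)+
  then show ?thesis
    unfolding lg_coeff_def using r immersed_restrict[OF assms(3)] assms(1,2) by simp
qed

text \<open>
  This is the transpose of \<open>[V, E] \<mapsto> \<Sum>F\<subseteq>E. (-1)^c(F) [V, F]\<close>, with \<open>c(F) = |V| - |F|\<close>.
  When \<open>G\<close> is a forest, \<open>c(F)\<close> is the number of components of \<open>(V, F)\<close>, and this is the antipode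
  of the dual Hopf algebra.  Indeed, Takeuchi's formula for it is an alternating sum over flags of
  closed subsets.  Collecting the flags whose layers fall apart into the components of \<open>(V, F)\<close> gives the value at \<open>-1\<close> of a strict order
  polynomial, which is \<open>(-1)^c(F)\<close> by reciprocity.
\<close>

definition antipode :: "('v lgraph set \<Rightarrow> 'k::field) \<Rightarrow> 'v lgraph set \<Rightarrow> 'k" where
  "antipode f K = (if K \<in> iso_classes then
     (let X = SOME X. X \<in> K in \<Sum>F\<in>Pow (snd X). (- 1) ^ (card (fst X) + card F) * f (cls (fst X, F)))
   else 0)"

lemma immersed_delete: "X \<in> immersed G \<Longrightarrow> F \<subseteq> snd X \<Longrightarrow> (fst X, F) \<in> immersed G"
  using immersed_subgraph[of "fst X" "snd X" G "fst X" F] immersedD(3)[of X G] by auto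

lemma antipode_cls:
  assumes X: "X \<in> immersed G"
  shows "antipode f (cls X) = (\<Sum>F\<in>Pow (snd X). (- 1) ^ (card (fst X) + card F) * f (cls (fst X, F)))"
proof -
  define Y where "Y = (SOME Y. Y \<in> cls X)"
  have "(X, Y) \<in> lg_iso_rel G" unfolding Y_def using rep_of_class[OF equiv_lg_iso_rel X] .
  then obtain b where Y: "Y \<in> immersed G" and b: "b \<in> lg_iso X Y" unfolding lg_iso_rel_def by blast
  obtain h where h: "bij_betw h (fst X) (fst Y)" "bij_betw (map_prod h h) (snd X) (snd Y)"
      "\<And>F. F \<subseteq> snd X \<Longrightarrow> b \<in> lg_iso (fst X, F) (fst Y, map_prod h h ` F)"
    using lg_iso_function[OF b X Y] by metis
  have "antipode f (cls X) = (\<Sum>F\<in>Pow (snd Y). (- 1) ^ (card (fst Y) + card F) * f (cls (fst Y, F)))"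
    using cls_in[OF X] unfolding antipode_def Y_def by (simp add: Let_def)
  also have "\<dots> = (\<Sum>F\<in>Pow (snd X). (- 1) ^ (card (fst Y) + card (map_prod h h ` F)) *
      f (cls (fst Y, map_prod h h ` F)))"
    using sum.reindex_bij_betw[OF bij_betw_Pow[OF h(2)], symmetric] .
  also have "\<dots> = (\<Sum>F\<in>Pow (snd X). (- 1) ^ (card (fst X) + card F) * f (cls (fst X, F)))"
  proof (rule sum.cong[OF HOL.refl])
    fix F assume "F \<in> Pow (snd X)"
    then have F: "F \<subseteq> snd X" by simp
    then have c: "card (map_prod h h ` F) = card F"
      using h(2) by (meson bij_betw_imp_inj_on card_image inj_on_subset)
    have F': "map_prod h h ` F \<subseteq> snd Y" using F h(2) unfolding bij_betw_def by blast
    have "cls (fst X, F) = cls (fst Y, map_prod h h ` F)"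
      using h(3)[OF F] cls_eq_iff[OF immersed_delete[OF X F] immersed_delete[OF Y F']] by blast
    then show "(- 1) ^ (card (fst Y) + card (map_prod h h ` F)) * f (cls (fst Y, map_prod h h ` F)) =
        (- 1) ^ (card (fst X) + card F) * f (cls (fst X, F))"
      using c bij_betw_same_card[OF h(1)] by simp
  qed
  finally show ?thesis .
qed

text \<open>
  A graph that becomes isomorphic to \<open>(V, F)\<close> when arrows are deleted is isomorphic to a graph on
  the vertex set \<open>V\<close>, and there are only finitely many of these.  Hence supports remain finite.
\<close>

lemma antipode_carrier:
  assumes "f \<in> carrier (hall_lg_op G)"
  shows "antipode f \<in> carrier (hall_lg G)"
proof -
  have f: "finite {K. f K \<noteq> 0}" "{K. f K \<noteq> 0} \<subseteq> iso_classes"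
    using assms by (auto simp: hall_lg_op_def hall_algebra_def)
  let ?S = "\<lambda>M. (\<lambda>E. cls (fst (SOME X. X \<in> M), E)) ` Pow (fst (SOME X. X \<in> M) \<times> fst (SOME X. X \<in> M))"
  have "{K. antipode f K \<noteq> 0} \<subseteq> (\<Union>M\<in>{K. f K \<noteq> 0}. ?S M)"
  proof
    fix K assume "K \<in> {K. antipode f K \<noteq> 0}"
    then have K: "antipode f K \<noteq> 0" "K \<in> iso_classes" unfolding antipode_def by (auto split: if_splits)
    from K(2) obtain X where X: "X \<in> immersed G" "K = cls X" by (rule iso_classes_cases)
    obtain F where F: "F \<subseteq> snd X" "f (cls (fst X, F)) \<noteq> 0"
    proof (rule ccontr)
      assume "\<not> thesis"
      then have "antipode f K = 0" unfolding X(2) antipode_cls[OF X(1)] using that by (intro sum.neutral) auto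
      then show False using K(1) by simp
    qed
    let ?M = "cls (fst X, F)"
    have XF: "(fst X, F) \<in> immersed G" using immersed_delete[OF X(1) F(1)] .
    obtain V E where VE: "(SOME X. X \<in> ?M) = (V, E)" by (cases "SOME X. X \<in> ?M")
    have "((fst X, F), (V, E)) \<in> lg_iso_rel G" using rep_of_class[OF equiv_lg_iso_rel XF] VE by simp
    then obtain b where Y: "(V, E) \<in> immersed G" and b: "b \<in> lg_iso (fst X, F) (V, E)"
      unfolding lg_iso_rel_def by blast
    \<comment> \<open>Carry the arrows of \<open>X\<close> over to the vertex set \<open>V\<close>.\<close>
    let ?E = "{(y, y'). \<exists>x x'. (x, x') \<in> snd X \<and> (x, y) \<in> b \<and> (x', y') \<in> b}"
    have mem: "(y, y') \<in> ?E \<longleftrightarrow> (\<exists>x x'. (x, x') \<in> snd X \<and> (x, y) \<in> b \<and> (x', y') \<in> b)" for y y'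
      by simp
    have bX: "b \<in> lg_iso X (V, ?E)"
    proof (rule lg_isoI)
      show "Domain b = fst X" "Range b = fst (V, ?E)" using lg_isoD(1,2)[OF b] by simp_all
      show "(x, x') \<in> snd X \<longleftrightarrow> (y, y') \<in> snd (V, ?E)" if "(x, y) \<in> b" "(x', y') \<in> b" for x y x' y'
      proof
        assume "(x, x') \<in> snd X"
        then show "(y, y') \<in> snd (V, ?E)" unfolding snd_conv mem using that by blast
      next
        assume "(y, y') \<in> snd (V, ?E)"
        then obtain z z' where "(z, z') \<in> snd X" "(z, y) \<in> b" "(z', y') \<in> b"
          unfolding snd_conv mem by blast
        then show "(x, x') \<in> snd X" using lg_isoD(8)[OF b] that by metis
      qed
    qed (rule lg_isoD(5,7,8)[OF b]; assumption)+
    have EV: "?E \<subseteq> V \<times> V" using lg_isoD(10)[OF b] by auto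
    note DX = immersedD[OF X(1)]
    have "(V, ?E) \<in> immersed G"
    proof (rule immersedI)
      show "finite V" "\<And>x. x \<in> V \<Longrightarrow> snd x \<in> pverts G" using immersedD(1,2)[OF Y] by auto
      show "?E \<subseteq> V \<times> V" by (rule EV)
      show "(snd y, snd y') \<in> parcs G" if "(y, y') \<in> ?E" for y y'
        using that DX(4) lg_isoD(5)[OF b] unfolding mem by metis
      show "y' = y''" if e: "(y, y') \<in> ?E" "(y, y'') \<in> ?E" "snd y' = snd y''" for y y' y''
      proof -
        obtain x x' where 1: "(x, x') \<in> snd X" "(x, y) \<in> b" "(x', y') \<in> b" using e(1) unfolding mem by blast
        obtain z x'' where 2: "(z, x'') \<in> snd X" "(z, y) \<in> b" "(x'', y'') \<in> b" using e(2) unfolding mem by blast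
        have "z = x" using lg_isoD(8)[OF b 2(2) 1(2)] .
        then have "x' = x''"
          using DX(7)[of x x' x''] 1 2 lg_isoD(5)[OF b 1(3)] lg_isoD(5)[OF b 2(3)] e(3) by simp
        then show ?thesis using lg_isoD(7)[OF b] 1(3) 2(3) by blast
      qed
      show "y' = y''" if e: "(y', y) \<in> ?E" "(y'', y) \<in> ?E" "snd y' = snd y''" for y y' y''
      proof -
        obtain x x' where 1: "(x', x) \<in> snd X" "(x, y) \<in> b" "(x', y') \<in> b" using e(1) unfolding mem by blast
        obtain z x'' where 2: "(x'', z) \<in> snd X" "(z, y) \<in> b" "(x'', y'') \<in> b" using e(2) unfolding mem by blast
        have "z = x" using lg_isoD(8)[OF b 2(2) 1(2)] .
        then have "x' = x''"
          using DX(8)[of x' x x''] 1 2 lg_isoD(5)[OF b 1(3)] lg_isoD(5)[OF b 2(3)] e(3) by simp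
        then show ?thesis using lg_isoD(7)[OF b] 1(3) 2(3) by blast
      qed
    qed
    then have "K = cls (V, ?E)" using X cls_eq_iff bX by blast
    then have "K \<in> ?S ?M" unfolding VE using EV by auto
    then show "K \<in> (\<Union>M\<in>{K. f K \<noteq> 0}. ?S M)" using F(2) by blast
  qed
  moreover have "finite (?S M)" if "M \<in> {K. f K \<noteq> 0}" for M
  proof -
    have "(SOME X. X \<in> M) \<in> immersed G" using rep_in_set[OF equiv_lg_iso_rel] that f(2) by blast
    then show ?thesis using immersedD(1) by blast
  qed
  ultimately have "finite {K. antipode f K \<noteq> 0}"
    using f(1) by (meson finite_UN finite_subset)
  moreover have "{K. antipode f K \<noteq> 0} \<subseteq> iso_classes" unfolding antipode_def by auto
  ultimately show ?thesis by (simp add: hall_lg_def hall_algebra_def)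
qed

lemma mult_op_cls:
  assumes f: "f \<in> carrier (hall_lg_op G)" and g: "g \<in> carrier (hall_lg_op G)" and X: "X \<in> immersed G"
  shows "(f \<otimes>\<^bsub>hall_lg_op G\<^esub> g) (cls X) =
    (\<Sum>U\<in>succ_closed X. f (cls (lg_restrict X U)) * g (cls (lg_restrict X (fst X - U))))"
proof -
  let ?a = "\<lambda>U. cls (lg_restrict X U)" and ?b = "\<lambda>U. cls (lg_restrict X (fst X - U))"
  have f': "finite {M. f M \<noteq> 0}" "{M. f M \<noteq> 0} \<subseteq> iso_classes"
    and g': "finite {M. g M \<noteq> 0}" "{M. g M \<noteq> 0} \<subseteq> iso_classes"
    using f g by (auto simp: hall_lg_op_def hall_algebra_def)
  have "(f \<otimes>\<^bsub>hall_lg_op G\<^esub> g) (cls X) = (\<Sum>M | f M \<noteq> 0. \<Sum>N | g N \<noteq> 0.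
      f M * g N * of_nat (card {U \<in> succ_closed X. ?a U = M \<and> ?b U = N}))"
    using cls_in[OF X] f'(2) g'(2) lg_coeff_cls[OF _ _ X]
    by (simp add: hall_lg_op_def hall_algebra_def subset_iff)
  also have "\<dots> = (\<Sum>U\<in>succ_closed X. f (?a U) * g (?b U))"
    by (rule sum_card_fibres) (use f' g' finite_succ_closed[OF X] in auto)
  finally show ?thesis .
qed

lemma mult_cls:
  assumes f: "f \<in> carrier (hall_lg G)" and g: "g \<in> carrier (hall_lg G)" and X: "X \<in> immersed G"
  shows "(f \<otimes>\<^bsub>hall_lg G\<^esub> g) (cls X) =
    (\<Sum>U\<in>succ_closed X. f (cls (lg_restrict X (fst X - U))) * g (cls (lg_restrict X U)))"
proof -
  let ?a = "\<lambda>U. cls (lg_restrict X U)" and ?b = "\<lambda>U. cls (lg_restrict X (fst X - U))"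
  have f': "finite {M. f M \<noteq> 0}" "{M. f M \<noteq> 0} \<subseteq> iso_classes"
    and g': "finite {M. g M \<noteq> 0}" "{M. g M \<noteq> 0} \<subseteq> iso_classes"
    using f g by (auto simp: hall_lg_def hall_algebra_def)
  have "(f \<otimes>\<^bsub>hall_lg G\<^esub> g) (cls X) = (\<Sum>M | f M \<noteq> 0. \<Sum>N | g N \<noteq> 0.
      f M * g N * of_nat (card {U \<in> succ_closed X. ?b U = M \<and> ?a U = N}))"
    using cls_in[OF X] f'(2) g'(2) lg_coeff_cls[OF _ _ X]
    by (simp add: hall_lg_def hall_algebra_def subset_iff conj_commute)
  also have "\<dots> = (\<Sum>U\<in>succ_closed X. f (?b U) * g (?a U))"
    by (rule sum_card_fibres) (use f' g' finite_succ_closed[OF X] in auto)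
  finally show ?thesis .
qed

text \<open>
  On a graph \<open>(V, E)\<close> the left-hand side is a sum over the pairs of a subset \<open>F\<close> of \<open>E\<close> and a subset
  \<open>U\<close> of \<open>V\<close> that is closed under the arrows in \<open>F\<close>.  For given \<open>U\<close>, such an \<open>F\<close> contains no arrow
  that leaves \<open>U\<close>, but any of the arrows that enter \<open>U\<close>, and the two pieces do not depend on which.
  The sum over the entering arrows in \<open>F\<close> is alternating and vanishes unless there are none, that
  is, unless the complement of \<open>U\<close> is closed in \<open>(V, E)\<close>.  What remains is the product of the two
  antipodes on the pieces, with the roles of subobject and quotient exchanged.
\<close>

lemma antipode_mult:
  fixes f g :: "'v lgraph set \<Rightarrow> 'k::field"
  assumes f: "f \<in> carrier (hall_lg_op G)" and g: "g \<in> carrier (hall_lg_op G)"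
  shows "antipode (f \<otimes>\<^bsub>hall_lg_op G\<^esub> g) = antipode f \<otimes>\<^bsub>hall_lg G\<^esub> antipode g"
proof
  fix K :: "'v lgraph set"
  show "antipode (f \<otimes>\<^bsub>hall_lg_op G\<^esub> g) K = (antipode f \<otimes>\<^bsub>hall_lg G\<^esub> antipode g) K"
  proof (cases "K \<in> iso_classes")
    case False
    then show ?thesis by (simp add: antipode_def hall_lg_def hall_algebra_def)
  next
    case True
    then obtain X where X: "X \<in> immersed G" "K = cls X" by (rule iso_classes_cases)
    obtain V E where VE: "X = (V, E)" by (cases X)
    have fin: "finite V" "finite E" "E \<subseteq> V \<times> V"
      using immersedD(1,3)[OF X(1)] VE by (auto intro: finite_subset)
    let ?in = "\<lambda>F U. F \<inter> U \<times> U"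
    let ?s = "\<lambda>U F. (- 1) ^ (card U + card F) :: 'k"
    define \<phi> where "\<phi> U F = ?s U F * f (cls (U, F))" for U F
    define \<gamma> where "\<gamma> U F = ?s U F * g (cls (U, F))" for U F
    \<comment> \<open>An arrow of \<open>F\<close> lies inside of \<open>U\<close>, inside of its complement, or enters \<open>U\<close>.\<close>
    define into where "into U = E \<inter> (V - U) \<times> U" for U
    have inner: "(\<Sum>F \<in> {F \<in> Pow E. F `` U \<subseteq> U}. ?s V F * (f (cls (U, ?in F U)) * g (cls (V - U, ?in F (V - U))))) =
        (if into U = {} then (\<Sum>F\<in>Pow (?in E U). \<phi> U F) * (\<Sum>F\<in>Pow (?in E (V - U)). \<gamma> (V - U) F) else 0)"
      (is "?L = ?R") if U: "U \<subseteq> V" for U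
    proof -
      let ?A = "?in E U" and ?B = "?in E (V - U)" and ?C = "into U"
      have dis: "?A \<inter> ?B = {}" "(?A \<union> ?B) \<inter> ?C = {}" unfolding into_def by blast+
      have "{F \<in> Pow E. F `` U \<subseteq> U} = Pow (?A \<union> ?B \<union> ?C)"
        using fin(3) U unfolding into_def by blast
      then have "?L = (\<Sum>(P, F3)\<in>Pow (?A \<union> ?B) \<times> Pow ?C. ?s V (P \<union> F3) *
          (f (cls (U, ?in (P \<union> F3) U)) * g (cls (V - U, ?in (P \<union> F3) (V - U)))))"
        using sum.reindex_bij_betw[OF bij_betw_Pow_Un[OF dis(2)], symmetric] by (simp add: case_prod_unfold)
      also have "\<dots> = (\<Sum>P\<in>Pow (?A \<union> ?B). \<Sum>F3\<in>Pow ?C. ?s V (P \<union> F3) *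
          (f (cls (U, ?in (P \<union> F3) U)) * g (cls (V - U, ?in (P \<union> F3) (V - U)))))"
        by (simp add: sum.cartesian_product)
      also have "\<dots> = (\<Sum>(F1, F2)\<in>Pow ?A \<times> Pow ?B. \<Sum>F3\<in>Pow ?C. ?s V (F1 \<union> F2 \<union> F3) *
          (f (cls (U, ?in (F1 \<union> F2 \<union> F3) U)) * g (cls (V - U, ?in (F1 \<union> F2 \<union> F3) (V - U)))))"
        using sum.reindex_bij_betw[OF bij_betw_Pow_Un[OF dis(1)], symmetric] by (simp add: case_prod_unfold)
      also have "\<dots> = (\<Sum>F1\<in>Pow ?A. \<Sum>F2\<in>Pow ?B. \<Sum>F3\<in>Pow ?C. ?s V (F1 \<union> F2 \<union> F3) *
          (f (cls (U, ?in (F1 \<union> F2 \<union> F3) U)) * g (cls (V - U, ?in (F1 \<union> F2 \<union> F3) (V - U)))))"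
        by (rule sum.cartesian_product[symmetric])
      also have "\<dots> = (\<Sum>F1\<in>Pow ?A. \<Sum>F2\<in>Pow ?B. \<Sum>F3\<in>Pow ?C. \<phi> U F1 * \<gamma> (V - U) F2 * (- 1) ^ card F3)"
      proof (intro sum.cong[OF HOL.refl])
        fix F1 F2 F3 assume F: "F1 \<in> Pow ?A" "F2 \<in> Pow ?B" "F3 \<in> Pow ?C"
        have "finite F1" "finite F2" "finite F3"
          using F fin(2) unfolding into_def by (auto intro: finite_subset)
        moreover have "F1 \<inter> F2 = {}" "(F1 \<union> F2) \<inter> F3 = {}" using F dis by blast+
        ultimately have c: "card (F1 \<union> F2 \<union> F3) = card F1 + card F2 + card F3"
          by (simp add: card_Un_disjoint)
        have v: "card V = card U + card (V - U)"
          using U fin(1) by (metis card_Diff_subset card_mono finite_subset le_add_diff_inverse)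
        have "?in (F1 \<union> F2 \<union> F3) U = F1" "?in (F1 \<union> F2 \<union> F3) (V - U) = F2"
          using F unfolding into_def by blast+
        then show "?s V (F1 \<union> F2 \<union> F3) *
            (f (cls (U, ?in (F1 \<union> F2 \<union> F3) U)) * g (cls (V - U, ?in (F1 \<union> F2 \<union> F3) (V - U)))) =
            \<phi> U F1 * \<gamma> (V - U) F2 * (- 1) ^ card F3"
          unfolding \<phi>_def \<gamma>_def c v by (simp add: power_add mult_ac)
      qed
      also have "\<dots> = (\<Sum>F1\<in>Pow ?A. \<phi> U F1) * (\<Sum>F2\<in>Pow ?B. \<gamma> (V - U) F2) * (\<Sum>F3\<in>Pow ?C. (- 1) ^ card F3)"
        by (simp only: sum_distrib_left[symmetric] sum_distrib_right[symmetric])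
      also have "\<dots> = ?R"
        using sum_Pow_sign[of "into U", where 'a = 'k] fin(2) unfolding into_def by (simp add: finite_Int)
      finally show ?thesis .
    qed
    have AX: "antipode (f \<otimes>\<^bsub>hall_lg_op G\<^esub> g) K = (\<Sum>F\<in>Pow E. \<Sum>U\<in>{U \<in> Pow V. F `` U \<subseteq> U}.
        ?s V F * (f (cls (U, ?in F U)) * g (cls (V - U, ?in F (V - U)))))"
      unfolding X(2) antipode_cls[OF X(1)]
    proof (rule sum.cong)
      fix F assume F: "F \<in> Pow E"
      have i: "(V, F) \<in> immersed G" using immersed_delete[OF X(1), of F] F VE by simp
      have "(f \<otimes>\<^bsub>hall_lg_op G\<^esub> g) (cls (V, F)) =
          (\<Sum>U\<in>{U \<in> Pow V. F `` U \<subseteq> U}. f (cls (U, ?in F U)) * g (cls (V - U, ?in F (V - U))))"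
        unfolding mult_op_cls[OF f g i] lg_restrict_def succ_closed_def
        by (intro sum.cong) (auto simp: Int_absorb1)
      then show "(- 1) ^ (card (fst X) + card F) * (f \<otimes>\<^bsub>hall_lg_op G\<^esub> g) (cls (fst X, F)) =
          (\<Sum>U\<in>{U \<in> Pow V. F `` U \<subseteq> U}. ?s V F * (f (cls (U, ?in F U)) * g (cls (V - U, ?in F (V - U)))))"
        by (simp add: VE sum_distrib_left)
    qed (simp add: VE)
    also have "\<dots> = (\<Sum>U\<in>Pow V. \<Sum>F\<in>{F \<in> Pow E. F `` U \<subseteq> U}.
        ?s V F * (f (cls (U, ?in F U)) * g (cls (V - U, ?in F (V - U)))))"
      by (rule sum.swap_restrict) (use fin in auto)
    also have "\<dots> = (\<Sum>U\<in>Pow V. if into U = {} then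
        (\<Sum>F\<in>Pow (?in E U). \<phi> U F) * (\<Sum>F\<in>Pow (?in E (V - U)). \<gamma> (V - U) F) else 0)"
      by (rule sum.cong[OF HOL.refl]) (rule inner, simp)
    also have "\<dots> = (\<Sum>U\<in>{U \<in> Pow V. into U = {}}.
        (\<Sum>F\<in>Pow (?in E U). \<phi> U F) * (\<Sum>F\<in>Pow (?in E (V - U)). \<gamma> (V - U) F))"
      by (rule sum.inter_filter[symmetric]) (use fin in simp)
    also have "\<dots> = (\<Sum>U\<in>succ_closed X.
        (\<Sum>F\<in>Pow (?in E (V - U)). \<phi> (V - U) F) * (\<Sum>F\<in>Pow (?in E U). \<gamma> U F))"
    proof (rule sum.reindex_bij_witness[where i = "\<lambda>U. V - U" and j = "\<lambda>U. V - U"])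
      show "V - U \<in> succ_closed X" if "U \<in> {U \<in> Pow V. into U = {}}" for U
        using that fin(3) unfolding succ_closed_def VE into_def by auto
      show "V - U \<in> {U \<in> Pow V. into U = {}}" if "U \<in> succ_closed X" for U
        using that unfolding succ_closed_def VE into_def by auto
    qed (auto simp: succ_closed_def VE double_diff)
    also have "\<dots> = (antipode f \<otimes>\<^bsub>hall_lg G\<^esub> antipode g) K"
      unfolding X(2) mult_cls[OF antipode_carrier[OF f] antipode_carrier[OF g] X(1)]
    proof (rule sum.cong[OF HOL.refl])
      fix U assume "U \<in> succ_closed X"
      then have U: "V \<inter> U = U" "V \<inter> (V - U) = V - U" unfolding succ_closed_def VE by auto
      have r: "lg_restrict X U = (U, ?in E U)" "lg_restrict X (fst X - U) = (V - U, ?in E (V - U))"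
        using U unfolding lg_restrict_def VE by auto
      show "(\<Sum>F\<in>Pow (?in E (V - U)). \<phi> (V - U) F) * (\<Sum>F\<in>Pow (?in E U). \<gamma> U F) =
          antipode f (cls (lg_restrict X (fst X - U))) * antipode g (cls (lg_restrict X U))"
        using antipode_cls[OF immersed_restrict[OF X(1)], of f "fst X - U"]
          antipode_cls[OF immersed_restrict[OF X(1)], of g U]
        unfolding r \<phi>_def \<gamma>_def by simp
    qed
    finally show ?thesis .
  qed
qed

text \<open>
  The coefficient of \<open>f (V, H)\<close> in the double sum is an alternating sum over the sets of arrows
  between \<open>H\<close> and \<open>E\<close>.
\<close>

lemma antipode_involution:
  fixes f :: "'v lgraph set \<Rightarrow> 'k::field"
  assumes f: "{K. f K \<noteq> 0} \<subseteq> iso_classes"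
  shows "antipode (antipode f) = f"
proof
  fix K
  show "antipode (antipode f) K = f K"
  proof (cases "K \<in> iso_classes")
    case False
    then show ?thesis using f by (auto simp: antipode_def)
  next
    case True
    then obtain X where X: "X \<in> immersed G" "K = cls X" by (rule iso_classes_cases)
    obtain V E where VE: "X = (V, E)" by (cases X)
    have fin: "finite V" "finite E"
      using immersedD(1,3)[OF X(1)] VE by (auto intro: finite_subset)
    have "antipode (antipode f) K = (\<Sum>F\<in>Pow E. \<Sum>H\<in>{H \<in> Pow E. H \<subseteq> F}.
        (- 1) ^ (card V + card F) * ((- 1) ^ (card V + card H) * f (cls (V, H))))"
      unfolding X(2) antipode_cls[OF X(1)]
    proof (rule sum.cong)
      fix F assume F: "F \<in> Pow E"
      have i: "(V, F) \<in> immersed G" using immersed_delete[OF X(1), of F] F VE by simp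
      have "Pow F = {H \<in> Pow E. H \<subseteq> F}" using F by auto
      then show "(- 1) ^ (card (fst X) + card F) * antipode f (cls (fst X, F)) =
          (\<Sum>H\<in>{H \<in> Pow E. H \<subseteq> F}. (- 1) ^ (card V + card F) * ((- 1) ^ (card V + card H) * f (cls (V, H))))"
        using antipode_cls[OF i, of f] by (simp add: VE sum_distrib_left)
    qed (simp add: VE)
    also have "\<dots> = (\<Sum>F\<in>Pow E. \<Sum>H\<in>{H \<in> Pow E. H \<subseteq> F}. (- 1) ^ card F * ((- 1) ^ card H * f (cls (V, H))))"
      by (cases "even (card V)") (simp_all add: power_add)
    also have "\<dots> = (\<Sum>H\<in>Pow E. \<Sum>F\<in>{F \<in> Pow E. H \<subseteq> F}. (- 1) ^ card F * ((- 1) ^ card H * f (cls (V, H))))"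
      by (rule sum.swap_restrict) (use fin in auto)
    also have "\<dots> = (\<Sum>H\<in>Pow E. if H = E then f (cls (V, E)) else 0)"
    proof (rule sum.cong[OF HOL.refl])
      fix H assume "H \<in> Pow E"
      then have H: "H \<subseteq> E" "finite H" using fin finite_subset by auto
      have "(\<Sum>F\<in>{F \<in> Pow E. H \<subseteq> F}. (- 1) ^ card F :: 'k) = (\<Sum>F\<in>Pow (E - H). (- 1) ^ (card H + card F))"
      proof (rule sum.reindex_bij_witness[where i = "\<lambda>F. H \<union> F" and j = "\<lambda>F. F - H"])
        fix F assume F: "F \<in> {F \<in> Pow E. H \<subseteq> F}"
        then have "finite F" using fin finite_subset by auto
        then show "(- 1) ^ (card H + card (F - H)) = ((- 1) ^ card F :: 'k)"
          using F H by (simp add: card_Diff_subset card_mono)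
      qed (use H in auto)
      also have "\<dots> = (- 1) ^ card H * (if H = E then 1 else 0)"
        using sum_Pow_sign[of "E - H", where 'a = 'k] H fin by (auto simp: power_add simp flip: sum_distrib_left)
      finally have s: "(\<Sum>F\<in>{F \<in> Pow E. H \<subseteq> F}. (- 1) ^ card F :: 'k) =
          (- 1) ^ card H * (if H = E then 1 else 0)" .
      show "(\<Sum>F\<in>{F \<in> Pow E. H \<subseteq> F}. (- 1) ^ card F * ((- 1) ^ card H * f (cls (V, H)))) =
          (if H = E then f (cls (V, E)) else 0)"
        unfolding sum_distrib_right[symmetric] s by (cases "even (card H)") simp_all
    qed
    also have "\<dots> = f K" using fin by (simp add: X(2) VE)
    finally show ?thesis .
  qed
qed

lemma antipode_one: "antipode \<one>\<^bsub>hall_lg_op G\<^esub> = (\<one>\<^bsub>hall_lg G\<^esub> :: 'v lgraph set \<Rightarrow> 'k::field)"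
proof
  fix K
  have one: "\<one>\<^bsub>hall_lg_op G\<^esub> = (\<lambda>K. if K = cls ({}, {}) then 1 else 0 :: 'k)"
    "\<one>\<^bsub>hall_lg G\<^esub> = (\<lambda>K. if K = cls ({}, {}) then 1 else 0 :: 'k)"
    by (simp_all add: hall_lg_op_def hall_lg_def hall_algebra_def)
  show "antipode \<one>\<^bsub>hall_lg_op G\<^esub> K = (\<one>\<^bsub>hall_lg G\<^esub> :: 'v lgraph set \<Rightarrow> 'k::field) K"
  proof (cases "K \<in> iso_classes")
    case False
    then show ?thesis using cls_in[OF immersed_empty] by (auto simp: antipode_def one)
  next
    case True
    then obtain X where X: "X \<in> immersed G" "K = cls X" by (rule iso_classes_cases)
    obtain V E where VE: "X = (V, E)" by (cases X)
    have empty: "cls (V, F) = cls ({}, {}) \<longleftrightarrow> V = {}" if F: "F \<subseteq> E" for F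
    proof -
      have i: "(V, F) \<in> immersed G" using immersed_delete[OF X(1), of F] F VE by simp
      have "V = {}" if "b \<in> lg_iso (V, F) ({}, {})" for b
        using lg_isoD(1,2)[OF that] by auto
      moreover have "{} \<in> lg_iso (V, F) ({}, {})" if "V = {}"
        using that by (intro lg_isoI) auto
      ultimately show ?thesis using cls_eq_iff[OF i immersed_empty] by blast
    qed
    have E: "E = {}" if "V = {}" using immersedD(3)[OF X(1)] VE that by auto
    show ?thesis
    proof (cases "V = {}")
      case True
      then show ?thesis unfolding X(2) antipode_cls[OF X(1)] one by (simp add: E VE)
    next
      case False
      then have "cls (V, F) \<noteq> cls ({}, {})" if "F \<in> Pow E" for F using empty that by simp
      then show ?thesis unfolding X(2) antipode_cls[OF X(1)] one by (simp add: VE)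
    qed
  qed
qed

lemma hall_lg_op_isomorphic:
  "algebra_isomorphic (hall_lg_op G :: ('k::field, 'v lgraph set \<Rightarrow> 'k) module) (hall_lg G)"
proof -
  let ?A = "hall_lg_op G :: ('k, 'v lgraph set \<Rightarrow> 'k) module"
    and ?B = "hall_lg G :: ('k, 'v lgraph set \<Rightarrow> 'k) module"
  have c: "carrier ?A = carrier ?B" by (simp add: hall_lg_op_def hall_lg_def hall_algebra_def)
  have inv: "antipode (antipode f) = f" if "f \<in> carrier ?A" for f
    using that by (intro antipode_involution) (auto simp: hall_lg_op_def hall_algebra_def)
  have "bij_betw antipode (carrier ?A) (carrier ?B)"
    by (rule bij_betw_byWitness[where f' = antipode]) (use inv antipode_carrier c in auto)
  moreover have "antipode \<in> ring_hom ?A ?B"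
  proof (rule ring_hom_memI)
    fix f g assume fg: "f \<in> carrier ?A" "g \<in> carrier ?A"
    show "antipode f \<in> carrier ?B" by (rule antipode_carrier[OF fg(1)])
    show "antipode (f \<otimes>\<^bsub>?A\<^esub> g) = antipode f \<otimes>\<^bsub>?B\<^esub> antipode g" by (rule antipode_mult[OF fg])
    show "antipode (f \<oplus>\<^bsub>?A\<^esub> g) = antipode f \<oplus>\<^bsub>?B\<^esub> antipode g"
      by (auto simp: hall_lg_op_def hall_lg_def hall_algebra_def antipode_def Let_def sum.distrib distrib_left)
  qed (rule antipode_one)
  ultimately have "antipode \<in> ring_iso ?A ?B" unfolding ring_iso_def by blast
  moreover have "antipode (a \<odot>\<^bsub>?A\<^esub> f) = a \<odot>\<^bsub>?B\<^esub> antipode f" for a f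
    by (auto simp: hall_lg_op_def hall_lg_def hall_algebra_def antipode_def Let_def sum_distrib_left mult_ac)
  ultimately show ?thesis unfolding algebra_isomorphic_def by blast
qed

end

section \<open>Immersions into a forest\<close>

definition adjacent :: "'v pair_pre_digraph \<Rightarrow> 'v \<Rightarrow> 'v \<Rightarrow> bool" where
  "adjacent G u v \<longleftrightarrow> (u, v) \<in> parcs G \<or> (v, u) \<in> parcs G"

text \<open>
  Walks may follow arrows in both directions, but not turn back at once along the same edge.
\<close>

fun nonbacktracking :: "'v pair_pre_digraph \<Rightarrow> 'v list \<Rightarrow> bool" where
  "nonbacktracking G (x # y # z # r) \<longleftrightarrow> adjacent G x y \<and> x \<noteq> z \<and> nonbacktracking G (y # z # r)"
| "nonbacktracking G [x, y] \<longleftrightarrow> adjacent G x y"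
| "nonbacktracking G [x] \<longleftrightarrow> True"
| "nonbacktracking G [] \<longleftrightarrow> True"

lemma nonbacktracking_tl: "nonbacktracking G (x # xs) \<Longrightarrow> nonbacktracking G xs"
  by (cases xs; cases "tl xs") auto

lemma nonbacktracking_prefix: "nonbacktracking G (xs @ ys) \<Longrightarrow> nonbacktracking G xs"
  by (induction G xs rule: nonbacktracking.induct) (auto dest: nonbacktracking_tl, (cases ys; auto)+)

lemma nonbacktracking_imp_successively: "nonbacktracking G xs \<Longrightarrow> successively (adjacent G) xs"
  by (induction G xs rule: nonbacktracking.induct) auto

lemma nonbacktracking_if_distinct:
  "successively (adjacent G) xs \<Longrightarrow> distinct xs \<Longrightarrow> nonbacktracking G xs"
  by (induction G xs rule: nonbacktracking.induct) auto

lemma adjacent_sym: "adjacent G u v \<longleftrightarrow> adjacent G v u"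
  by (auto simp: adjacent_def)

text \<open>
  Two walks that leave \<open>a\<close> along different edges form one walk through \<open>a\<close>.
\<close>

lemma nonbacktracking_join:
  assumes "nonbacktracking G (a # w # r')" "nonbacktracking G (a # v # r)" "w \<noteq> v"
  shows "nonbacktracking G (rev r' @ w # a # v # r)"
  using assms
proof (induction r' arbitrary: a w v r)
  case Nil
  then show ?case by (simp add: adjacent_sym)
next
  case (Cons c r')
  then have "nonbacktracking G (rev r' @ c # w # a # v # r)"
    by (intro Cons.IH) (auto simp: adjacent_sym)
  then show ?case by simp
qed

lemma rtrancl_imp_distinct_walk:
  assumes "(x, y) \<in> R\<^sup>*"
  obtains xs where "xs \<noteq> []" "hd xs = x" "last xs = y" "distinct xs" "successively (\<lambda>u v. (u, v) \<in> R) xs"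
  using assms
proof (induction arbitrary: thesis rule: converse_rtrancl_induct)
  case base
  then show ?case by (metis distinct_singleton last.simps list.distinct(1) list.sel(1) successively.simps(2))
next
  case (step x x')
  from step.IH obtain xs where xs: "xs \<noteq> []" "hd xs = x'" "last xs = y" "distinct xs"
    "successively (\<lambda>u v. (u, v) \<in> R) xs" by metis
  show ?case
  proof (cases "x \<in> set xs")
    case True
    then obtain as bs where "xs = as @ x # bs" by (meson split_list)
    then show ?thesis using xs by (intro step.prems[of "x # bs"]) (auto simp: successively_append_iff)
  next
    case False
    then show ?thesis using xs step.hyps by (intro step.prems[of "x # xs"]) (auto simp: successively_Cons)
  qed
qed

text \<open>
  Closed walks are lists with equal ends, so that a cycle of length three is a list of length four.
\<close>

locale forest_quiver =
  fixes G :: "'v pair_pre_digraph"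
  assumes finite_pverts: "finite (pverts G)"
    and parcs_subset: "parcs G \<subseteq> pverts G \<times> pverts G"
    and no_loop: "(u, u) \<notin> parcs G"
    and no_antiparallel: "(u, v) \<in> parcs G \<Longrightarrow> (v, u) \<notin> parcs G"
    and no_cycle: "successively (adjacent G) vs \<Longrightarrow> hd vs = last vs \<Longrightarrow> 4 \<le> length vs \<Longrightarrow>
      \<not> distinct (tl vs)"
begin

text \<open>
  A first return to a vertex would close a cycle, or be a loop or a step back.
\<close>

lemma nonbacktracking_distinct: "nonbacktracking G vs \<Longrightarrow> distinct vs"
proof (induction vs)
  case (Cons x ys)
  have ys: "distinct ys" using Cons.IH[OF nonbacktracking_tl[OF Cons.prems]] .
  have "x \<notin> set ys"
  proof
    assume "x \<in> set ys"
    then obtain as bs where as: "ys = as @ x # bs" by (meson split_list)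
    then have nb: "nonbacktracking G (x # as @ [x])"
      using Cons.prems nonbacktracking_prefix[of G "x # as @ [x]" bs] by simp
    consider "as = []" | y where "as = [y]" | "length as \<ge> 2"
      by (metis One_nat_def Suc_1 Suc_leI length_0_conv length_Suc_conv less_2_cases not_less)
    then show False
    proof cases
      case 1 then show False using nb no_loop by (simp add: adjacent_def)
    next
      case 2 then show False using nb by simp
    next
      case 3
      then show False
        using no_cycle[of "x # as @ [x]"] nonbacktracking_imp_successively[OF nb] ys as by simp
    qed
  qed
  then show ?case using ys by simp
qed simp

text \<open>
  Where two such walks part, reversing one of them gives a walk from their common end to itself.
\<close>

lemma nonbacktracking_unique:
  assumes "nonbacktracking G vs" "nonbacktracking G ws" "vs \<noteq> []" "ws \<noteq> []" "hd vs = hd ws" "last vs = last ws"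
  shows "vs = ws"
  using assms
proof (induction vs arbitrary: ws)
  case (Cons a vs)
  obtain ws' where ws: "ws = a # ws'" using Cons.prems by (cases ws) auto
  have d: "distinct (a # vs)" "distinct (a # ws')"
    using Cons.prems(1,2) nonbacktracking_distinct ws by blast+
  show ?case
  proof (cases vs)
    case Nil
    then have "last ws = a" using Cons.prems by simp
    then have "ws' = []" using d(2) ws last_in_set[of ws'] by (cases "ws' = []") auto
    then show ?thesis using Nil ws by simp
  next
    case (Cons v r)
    note vs = this
    show ?thesis
    proof (cases ws')
      case Nil
      then have "last (v # r) = a" using Cons.prems ws vs by simp
      then show ?thesis using d(1) last_in_set[of "v # r"] vs by auto
    next
      case (Cons w r')
      show ?thesis
      proof (cases "v = w")
        case True
        then have "vs = ws'"
          using Cons.prems ws vs Cons nonbacktracking_tl by (intro Cons.IH) auto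
        then show ?thesis using ws by simp
      next
        case False
        have nb: "nonbacktracking G (rev r' @ w # a # v # r)"
          using nonbacktracking_join[of G a w r' v r] Cons.prems ws vs Cons False by simp
        have "last (w # r') = last (v # r)" using \<open>last (a # vs) = last ws\<close> ws vs Cons by simp
        then have "last (v # r) \<in> set (rev r' @ [w])" using last_in_set[of "w # r'"] by auto
        moreover have "last (v # r) \<in> set (v # r)" by (rule last_in_set) simp
        ultimately show ?thesis using nonbacktracking_distinct[OF nb] by auto
      qed
    qed
  qed
qed simp

definition connected_in :: "'v set \<Rightarrow> bool" where
  "connected_in J \<longleftrightarrow> (\<forall>u \<in> J. \<forall>v \<in> J. (u, v) \<in> {(x, y). x \<in> J \<and> y \<in> J \<and> adjacent G x y}\<^sup>*)"

text \<open>
  The order \<open>\<preceq>\<close> is defined by paths in the whole quiver, whereas subobjects are closed under the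
  arrows inside \<open>J\<close>.  For connected \<open>J\<close> there is no difference: a directed path between two vertices
  of \<open>J\<close> is the only walk without backtracking between them, hence stays in \<open>J\<close>.
\<close>

lemma connected_in_convex:
  assumes J: "connected_in J" and U: "U \<subseteq> J" "\<And>u v. (u, v) \<in> parcs G \<Longrightarrow> u \<in> U \<Longrightarrow> v \<in> J \<Longrightarrow> v \<in> U"
    and a: "a \<in> U" and b: "b \<in> J" and reach: "(a, b) \<in> (parcs G)\<^sup>*"
  shows "b \<in> U"
proof -
  obtain vs where vs: "vs \<noteq> []" "hd vs = a" "last vs = b" "distinct vs"
    "successively (\<lambda>u v. (u, v) \<in> parcs G) vs"
    using rtrancl_imp_distinct_walk[OF reach] by metis
  have "(a, b) \<in> {(x, y). x \<in> J \<and> y \<in> J \<and> adjacent G x y}\<^sup>*"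
    using J U(1) a b unfolding connected_in_def by blast
  then obtain ws where ws: "ws \<noteq> []" "hd ws = a" "last ws = b" "distinct ws"
    "successively (\<lambda>u v. u \<in> J \<and> v \<in> J \<and> adjacent G u v) ws"
    by (rule rtrancl_imp_distinct_walk) auto
  have "vs = ws"
  proof (rule nonbacktracking_unique)
    show "nonbacktracking G vs"
      by (rule nonbacktracking_if_distinct)
        (use vs in \<open>auto simp: adjacent_def elim: successively_mono\<close>)
    show "nonbacktracking G ws"
      by (rule nonbacktracking_if_distinct) (use ws in \<open>auto elim: successively_mono\<close>)
  qed (use vs ws in auto)
  moreover have "set ws \<subseteq> J" if "ws \<noteq> []" "hd ws \<in> J"
      "successively (\<lambda>u v. u \<in> J \<and> v \<in> J \<and> adjacent G u v) ws" for ws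
    using that by (induction ws rule: induct_list012) auto
  ultimately have "set vs \<subseteq> J" using ws a U(1) by blast
  moreover have "last vs \<in> U" if "vs \<noteq> []" "hd vs \<in> U" "set vs \<subseteq> J"
      "successively (\<lambda>u v. (u, v) \<in> parcs G) vs" for vs
    using that
  proof (induction vs rule: induct_list012)
    case (3 x y zs)
    then have "y \<in> U" using U(2)[of x y] by auto
    then show ?case using 3 by auto
  qed auto
  ultimately show ?thesis using vs a by blast
qed

abbreviation (input) "sym_arrows X \<equiv> snd X \<union> (snd X)\<inverse>"

text \<open>
  An immersion is locally injective, hence does not create backtracking.
\<close>

lemma immersed_walk_nonbacktracking:
  assumes X: "X \<in> immersed G"
  shows "successively (\<lambda>x y. (x, y) \<in> sym_arrows X) xs \<Longrightarrow> distinct xs \<Longrightarrow> nonbacktracking G (map snd xs)"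
proof (induction xs)
  case (Cons x ys)
  note D = immersedD[OF X]
  have adj: "adjacent G (snd x) (snd y)" if "(x, y) \<in> sym_arrows X" for x y
    using that D(4)[of x y] D(4)[of y x] unfolding adjacent_def by auto
  show ?case
  proof (cases ys)
    case Nil then show ?thesis by simp
  next
    case (Cons y zs)
    note ys = this
    have xy: "(x, y) \<in> sym_arrows X" and nb: "nonbacktracking G (map snd ys)"
      using Cons.prems Cons.IH ys by auto
    show ?thesis
    proof (cases zs)
      case Nil then show ?thesis using adj[OF xy] ys by simp
    next
      case (Cons z r)
      then have yz: "(y, z) \<in> sym_arrows X" and "x \<noteq> z" using Cons.prems ys by auto
      have "snd x \<noteq> snd z"
      proof
        assume s: "snd x = snd z"
        \<comment> \<open>Both steps lie over the same arrow of \<open>G\<close>, traversed in opposite directions.\<close>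
        have "(x, y) \<in> snd X \<and> (z, y) \<in> snd X \<or> (y, x) \<in> snd X \<and> (y, z) \<in> snd X"
          using xy yz D(4)[of x y] D(4)[of y x] D(4)[of y z] D(4)[of z y] no_antiparallel s by auto
        then show False using D(7)[of y x z] D(8)[of x y z] s \<open>x \<noteq> z\<close> by auto
      qed
      then show ?thesis using adj[OF xy] ys Cons nb by simp
    qed
  qed
qed simp

lemma immersed_walk_exists:
  assumes "(x, y) \<in> (sym_arrows X)\<^sup>*" and X: "X \<in> immersed G"
  obtains xs where "xs \<noteq> []" "hd xs = x" "last xs = y"
    "successively (\<lambda>x y. (x, y) \<in> sym_arrows X) xs" "distinct (map snd xs)" "nonbacktracking G (map snd xs)"
proof -
  obtain xs where xs: "xs \<noteq> []" "hd xs = x" "last xs = y" "distinct xs"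
    "successively (\<lambda>x y. (x, y) \<in> sym_arrows X) xs"
    using rtrancl_imp_distinct_walk[OF assms(1)] by metis
  show thesis
    using that[OF xs(1,2,3,5)] immersed_walk_nonbacktracking[OF X xs(5,4)] nonbacktracking_distinct by blast
qed

text \<open>
  Together with the next lemma: a connected graph immersed in a forest is a full subquiver.
\<close>

lemma component_label_inj:
  assumes X: "X \<in> immersed G" and xy: "(x, y) \<in> (sym_arrows X)\<^sup>*" and s: "snd x = snd y"
  shows "x = y"
proof -
  obtain xs where xs: "xs \<noteq> []" "hd xs = x" "last xs = y" "distinct (map snd xs)"
    using immersed_walk_exists[OF xy X] by metis
  obtain xs' where xs': "xs = x # xs'" using xs by (cases xs) auto
  have "xs' = []"
  proof (rule ccontr)
    assume "xs' \<noteq> []"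
    then have "y \<in> set xs'" using xs(3) xs' last_in_set[of xs'] by simp
    then have "snd x \<in> snd ` set xs'" using s by (metis imageI)
    then show False using xs(4) xs' by simp
  qed
  then show ?thesis using xs xs' by simp
qed

lemma component_full:
  assumes X: "X \<in> immersed G" and xy: "(x, y) \<in> (sym_arrows X)\<^sup>*" and s: "(snd x, snd y) \<in> parcs G"
  shows "(x, y) \<in> snd X"
proof -
  obtain xs where xs: "xs \<noteq> []" "hd xs = x" "last xs = y" "nonbacktracking G (map snd xs)"
      "successively (\<lambda>x y. (x, y) \<in> sym_arrows X) xs"
    using immersed_walk_exists[OF xy X] by metis
  have "snd x \<noteq> snd y" using s no_loop by auto
  then have "map snd xs = [snd x, snd y]"
    using xs s by (intro nonbacktracking_unique) (auto simp: hd_map last_map adjacent_def)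
  then have "xs = [x, y]" using xs by (cases xs; cases "tl xs") auto
  then have "(x, y) \<in> sym_arrows X" using xs by simp
  moreover have "(y, x) \<notin> snd X" using immersedD(4)[OF X, of y x] no_antiparallel[OF s] by blast
  ultimately show ?thesis by blast
qed

definition S_graph :: "'v sobj \<Rightarrow> 'v lgraph" where
  "S_graph A = (S_verts A, S_arrows G A)"

lemma S_graph_immersed:
  assumes "A \<in> S_obj G" shows "S_graph A \<in> immersed G"
proof -
  have J: "A ! k \<subseteq> pverts G" if "k < length A" for k using assms that unfolding S_obj_def by auto
  have "S_verts A \<subseteq> {..<length A} \<times> pverts G"
    unfolding S_verts_def using J by auto
  then have "finite (S_verts A)"
    using finite_pverts by (meson finite_SigmaI finite_lessThan finite_subset)
  then show ?thesis
    unfolding S_graph_def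
    by (intro immersedI) (use J in \<open>fastforce simp: S_verts_def S_arrows_def\<close>)+
qed

text \<open>
  The connected components of \<open>X\<close> are the members of the list \<open>A\<close>.  That these are connected is
  needed later on, for testing admissibility of morphisms.
\<close>

lemma immersed_realizable:
  assumes X: "X \<in> immersed G"
  obtains A f where "A \<in> S_obj G" "\<And>J. J \<in> set A \<Longrightarrow> connected_in J" "f \<in> lg_iso (S_graph A) X"
proof -
  let ?R = "sym_arrows X"
  note D = immersedD[OF X]
  define r where "r = {(x, y). x \<in> fst X \<and> y \<in> fst X \<and> (x, y) \<in> ?R\<^sup>*}"
  have "sym ?R" by (auto simp: sym_def)
  then have symR: "(x, y) \<in> ?R\<^sup>* \<Longrightarrow> (y, x) \<in> ?R\<^sup>*" for x y
    by (meson sym_rtrancl symD)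
  have eq: "equiv (fst X) r"
  proof (rule equivI)
    show "r \<subseteq> fst X \<times> fst X" "refl_on (fst X) r" unfolding r_def refl_on_def by auto
    show "sym r" unfolding r_def sym_def using symR by auto
    show "trans r" unfolding r_def trans_def by auto
  qed
  have "finite (fst X // r)" using D(1) eq by (metis equiv_type finite_quotient)
  then obtain cs where cs: "set cs = fst X // r" "distinct cs" using finite_distinct_list by metis
  let ?A = "map (\<lambda>C. snd ` C) cs"
  let ?f = "{((k, v), x). k < length cs \<and> x \<in> cs ! k \<and> v = snd x}"
  have csD: "C \<subseteq> fst X" "x \<in> C \<Longrightarrow> y \<in> C \<longleftrightarrow> y \<in> fst X \<and> (x, y) \<in> ?R\<^sup>*" if C: "C \<in> set cs" for C x y
  proof -
    obtain z where z: "C = r `` {z}" "z \<in> fst X" using C unfolding cs(1) by (rule quotientE)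
    then show "C \<subseteq> fst X" by (auto simp: r_def)
    show "y \<in> C \<longleftrightarrow> y \<in> fst X \<and> (x, y) \<in> ?R\<^sup>*" if "x \<in> C"
      using that z symR[of z x] by (auto simp: r_def intro: rtrancl_trans)
  qed
  have A: "?A \<in> S_obj G" unfolding S_obj_def using csD(1) D(2) by auto
  have conn: "connected_in J" if J: "J \<in> set ?A" for J
  proof -
    obtain C where C: "C \<in> set cs" "J = snd ` C" using J by auto
    have "(snd x, snd y) \<in> {(u, v). u \<in> J \<and> v \<in> J \<and> adjacent G u v}\<^sup>*" if x: "x \<in> C" and y: "y \<in> C" for x y
    proof -
      have "(x, y) \<in> ?R\<^sup>*" using csD(2)[OF C(1) x] y by blast
      then show ?thesis using x
      proof (induction rule: converse_rtrancl_induct)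
        case (step x z)
        have "z \<in> C" using csD(2)[OF C(1) step.prems] step.hyps(1) D(5,6) by blast
        moreover have "adjacent G (snd x) (snd z)"
          using step.hyps(1) D(4) unfolding adjacent_def by blast
        ultimately show ?case using step C(2) by (intro converse_rtrancl_into_rtrancl[OF _ step.IH]) auto
      qed simp
    qed
    then show ?thesis unfolding connected_in_def C(2) by blast
  qed
  have mem: "\<exists>k < length cs. x \<in> cs ! k" if "x \<in> fst X" for x
  proof -
    have "r `` {x} \<in> set cs" "x \<in> r `` {x}" using that cs(1) equiv_class_self[OF eq that] by (auto simp: quotientI)
    then show ?thesis by (metis in_set_conv_nth)
  qed
  have same: "k = k'" if "k < length cs" "k' < length cs" "x \<in> cs ! k" "y \<in> cs ! k'" "(x, y) \<in> ?R\<^sup>*" for k k' x y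
  proof -
    have "y \<in> cs ! k" using csD(2)[of "cs ! k" x y] csD(1)[of "cs ! k'"] that by auto
    then have "cs ! k \<inter> cs ! k' \<noteq> {}" using that by blast
    then have "cs ! k = cs ! k'" using quotient_disj[OF eq] cs(1) that nth_mem by metis
    then show ?thesis using cs(2) that nth_eq_iff_index_eq by blast
  qed
  have "?f \<in> lg_iso (S_graph ?A) X"
  proof (rule lg_isoI)
    show "Domain ?f = fst (S_graph ?A)"
      unfolding S_graph_def S_verts_def by force
    show "Range ?f = fst X" using mem csD(1) nth_mem by fastforce
    show "y = z" if "(x, y) \<in> ?f" "(x, z) \<in> ?f" for x y z
    proof -
      have "fst x < length cs" "y \<in> cs ! fst x" "z \<in> cs ! fst x" "snd y = snd z" using that by auto
      then show ?thesis using csD(2)[of "cs ! fst x" y z] component_label_inj[OF X, of y z] by simp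
    qed
    show "x = y" if "(x, z) \<in> ?f" "(y, z) \<in> ?f" for x y z
    proof -
      have k: "fst x < length cs" "fst y < length cs" "z \<in> cs ! fst x" "z \<in> cs ! fst y"
        and "snd x = snd y" using that by auto
      then show ?thesis using same[OF k] by (simp add: prod_eq_iff)
    qed
    show "snd x = snd y" if "(x, y) \<in> ?f" for x y using that by auto
    show "(x, x') \<in> snd (S_graph ?A) \<longleftrightarrow> (y, y') \<in> snd X" if "(x, y) \<in> ?f" "(x', y') \<in> ?f" for x y x' y'
    proof -
      obtain k k' where k: "x = (k, snd y)" "k < length cs" "y \<in> cs ! k"
          "x' = (k', snd y')" "k' < length cs" "y' \<in> cs ! k'"
        using \<open>(x, y) \<in> ?f\<close> \<open>(x', y') \<in> ?f\<close> by auto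
      have "(x, x') \<in> snd (S_graph ?A) \<longleftrightarrow> k = k' \<and> (snd y, snd y') \<in> parcs G"
        using k by (auto simp: S_graph_def S_arrows_def S_verts_def)
      also have "\<dots> \<longleftrightarrow> (y, y') \<in> snd X"
      proof
        assume "k = k' \<and> (snd y, snd y') \<in> parcs G"
        then show "(y, y') \<in> snd X"
          using csD(2)[of "cs ! k" y y'] k component_full[OF X, of y y'] by simp
      next
        assume "(y, y') \<in> snd X"
        then show "k = k' \<and> (snd y, snd y') \<in> parcs G"
          using same[of k k' y y'] k D(4) by auto
      qed
      finally show ?thesis .
    qed
  qed
  then show thesis using that A conn by blast
qed

text \<open>
  This makes every representation nilpotent.
\<close>

lemma directed_walk_bound:
  assumes "pre_digraph.awalk (with_proj G) u p v"
  shows "length p < card (pverts G)"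
proof -
  interpret pair_wf_digraph G by unfold_locales (use parcs_subset in auto)
  have nb: "nonbacktracking G (pawalk_verts u p)" if "set p \<subseteq> parcs G" "pcas u p v" for u p
    using that
  proof (induction p arbitrary: u)
    case (Cons e p)
    then show ?case
      by (cases p rule: list.exhaust; cases "tl p") (auto simp: adjacent_def no_antiparallel dest: no_antiparallel)
  qed simp
  have p: "set p \<subseteq> parcs G" "pcas u p v" "u \<in> pverts G" using assms unfolding awalk_def by auto
  have "distinct (pawalk_verts u p)" using nb[OF p(1,2)] nonbacktracking_distinct by blast
  moreover have "set (pawalk_verts u p) \<subseteq> pverts G"
    using p awalk_verts_in_verts by blast
  moreover have "length (pawalk_verts u p) = length p + 1" by (induction p arbitrary: u) auto
  ultimately show ?thesis
    by (metis Suc_eq_plus1 Suc_le_lessD card_mono distinct_card finite_pverts)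
qed

end

text \<open>
  A closed walk given by its vertices is turned into a cycle, which is a list of arcs.
\<close>

lemma underlying_tree_forest_quiver:
  assumes tree: "underlying_tree (with_proj G)" and fin: "finite (pverts G)"
    and arcs: "parcs G \<subseteq> pverts G \<times> pverts G"
  shows "forest_quiver G"
proof
  note T = tree[unfolded underlying_tree_def]
  show loop: "(u, u) \<notin> parcs G" for u using T by fastforce
  have inj: "inj_on (\<lambda>e. {fst e, snd e}) (parcs G)" using T by simp
  show "(v, u) \<notin> parcs G" if uv: "(u, v) \<in> parcs G" for u v
  proof
    assume "(v, u) \<in> parcs G"
    then have "(u, v) = (v, u)" by (intro inj_onD[OF inj _ uv]) auto
    then have "u = v" by (elim Pair_inject)
    then show False using uv loop by metis
  qed
  let ?H = "mk_symmetric (with_proj G)"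
  have "parcs ?H = parcs G \<union> (parcs G)\<inverse>"
    unfolding parcs_mk_symmetric by auto
  then have H: "pverts ?H = pverts G" "(u, v) \<in> parcs ?H \<longleftrightarrow> adjacent G u v" for u v
    by (simp_all add: adjacent_def)
  have cas: "pcas (hd vs) (zip vs (tl vs)) (last vs)" "pawalk_verts (hd vs) (zip vs (tl vs)) = vs"
      "successively (adjacent G) vs \<Longrightarrow> set (zip vs (tl vs)) \<subseteq> parcs ?H" if "vs \<noteq> []" for vs
    using that by (induction vs rule: induct_list012) (simp_all add: H)
  show "\<not> distinct (tl vs)" if vs: "successively (adjacent G) vs" "hd vs = last vs" "4 \<le> length vs" for vs
  proof
    assume d: "distinct (tl vs)"
    let ?p = "zip vs (tl vs)"
    have "vs \<noteq> []" using vs by auto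
    note c = cas[OF this]
    obtain a b r where ab: "vs = a # b # r" using vs(3) by (cases vs; cases "tl vs") auto
    then have "hd vs \<in> pverts G" using vs(1) arcs by (auto simp: adjacent_def)
    then have "pre_digraph.awalk (with_proj ?H) (hd vs) ?p (hd vs)"
      unfolding pre_digraph.awalk_def using c vs H(1) by (simp add: cas_with_proj_eq)
    moreover have "3 \<le> length ?p" using vs(3) by simp
    moreover have "?p \<noteq> []" using ab by simp
    ultimately have "pre_digraph.cycle (with_proj ?H) ?p"
      unfolding pre_digraph.cycle_def using c d by (auto simp: awalk_verts_with_proj_eq)
    then show False using T \<open>3 \<le> length ?p\<close> by blast
  qed
qed (use fin arcs in auto)

section \<open>The category of subobject quivers\<close>

lemma relcomp_Id_on: "Range f \<subseteq> U \<Longrightarrow> f O Id_on U = f" "Domain f \<subseteq> U \<Longrightarrow> Id_on U O f = f"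
  by auto

context forest_quiver
begin

text \<open>
  Having an inverse up to relational composition forces a partial isomorphism to be total and
  surjective.
\<close>

lemma S_iso_eq: "S_iso G A B = lg_iso (S_graph A) (S_graph B)"
proof (intro equalityI subsetI)
  fix f assume "f \<in> S_iso G A B"
  then obtain g where f: "f \<in> S_hom G A B" and g: "g \<in> S_hom G B A"
    and fg: "f O g = Id_on (S_verts A)" "g O f = Id_on (S_verts B)"
    unfolding S_iso_def S_id_def by blast
  have "Domain f = S_verts A"
  proof
    show "S_verts A \<subseteq> Domain f" using fg(1) Id_onI[of _ "S_verts A"] by blast
  qed (use f in \<open>auto simp: S_hom_def\<close>)
  moreover have "Range f = S_verts B"
  proof
    show "S_verts B \<subseteq> Range f" using fg(2) Id_onI[of _ "S_verts B"] by blast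
  qed (use f in \<open>auto simp: S_hom_def\<close>)
  ultimately show "f \<in> lg_iso (S_graph A) (S_graph B)"
    using f unfolding S_hom_def lg_iso_def S_graph_def by simp
next
  have *: "f \<in> S_hom G A B" if "f \<in> lg_iso (S_graph A) (S_graph B)" for f A B
    using that lg_iso_subset[OF that] unfolding S_hom_def lg_iso_def S_graph_def by simp
  fix f assume f: "f \<in> lg_iso (S_graph A) (S_graph B)"
  show "f \<in> S_iso G A B"
    using *[OF f] *[OF lg_iso_converse[OF f]] lg_iso_O_converse[OF f]
    unfolding S_iso_def S_id_def by (auto simp: S_graph_def)
qed

lemma S_hom_comp: "f \<in> S_hom G A B \<Longrightarrow> g \<in> S_hom G B C \<Longrightarrow> f O g \<in> S_hom G A C"
proof -
  assume f: "f \<in> S_hom G A B" and g: "g \<in> S_hom G B C"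
  have "single_valued (f O g)" "single_valued ((f O g)\<inverse>)"
    using f g unfolding S_hom_def converse_relcomp by (auto intro: single_valued_relcomp)
  moreover have "snd x = snd z" if "(x, y) \<in> f" "(y, z) \<in> g" for x y z
    using f g that unfolding S_hom_def by fastforce
  moreover have "(x, x') \<in> S_arrows G A \<longleftrightarrow> (z, z') \<in> S_arrows G C"
    if "(x, y) \<in> f" "(y, z) \<in> g" "(x', y') \<in> f" "(y', z') \<in> g" for x y z x' y' z'
  proof -
    have "(x, x') \<in> S_arrows G A \<longleftrightarrow> (y, y') \<in> S_arrows G B"
      using f that(1,3) unfolding S_hom_def by blast
    also have "\<dots> \<longleftrightarrow> (z, z') \<in> S_arrows G C"
      using g that(2,4) unfolding S_hom_def by blast
    finally show ?thesis .
  qed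
  moreover have "f O g \<subseteq> S_verts A \<times> S_verts C" using f g unfolding S_hom_def by blast
  ultimately show ?thesis unfolding S_hom_def by blast
qed

lemma S_hom_converse: "f \<in> S_hom G A B \<Longrightarrow> f\<inverse> \<in> S_hom G B A"
  unfolding S_hom_def by (auto 0 3)

lemma lg_iso_restrict_S_hom:
  assumes "f \<in> lg_iso (S_graph A) (lg_restrict (S_graph B) U)" shows "f \<in> S_hom G A B"
proof -
  have sub: "f \<subseteq> S_verts A \<times> (S_verts B \<inter> U)"
    using lg_iso_subset[OF assms] by (simp add: S_graph_def lg_restrict_def)
  have "(x, x') \<in> S_arrows G A \<longleftrightarrow> (y, y') \<in> S_arrows G B" if "(x, y) \<in> f" "(x', y') \<in> f" for x y x' y'
    using lg_isoD(6)[OF assms that] sub that by (auto simp: S_graph_def lg_restrict_def)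
  then show ?thesis
    unfolding S_hom_def using sub lg_isoD(3,4,5)[OF assms] by blast
qed

text \<open>
  The combinatorial content of an admissible exact sequence \<open>A \<rightarrow> B \<rightarrow> C\<close>; the set \<open>U\<close> is the image
  of \<open>A\<close>.
\<close>

definition S_split :: "'v sobj \<Rightarrow> 'v sobj \<Rightarrow> 'v sobj \<Rightarrow> 'v smor \<Rightarrow> 'v smor \<Rightarrow> bool" where
  "S_split A B C i p \<longleftrightarrow> (\<exists>U \<in> succ_closed (S_graph B).
     i \<in> lg_iso (S_graph A) (lg_restrict (S_graph B) U) \<and>
     p \<in> lg_iso (lg_restrict (S_graph B) (S_verts B - U)) (S_graph C))"

text \<open>
  The mediating morphisms are \<open>f O i\<inverse>\<close> and \<open>p\<inverse> O f\<close>.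
\<close>

lemma S_split_bicartesian:
  assumes "S_split A B C i p"
  shows "S_bicartesian G A B C i p"
proof -
  obtain U where U: "U \<subseteq> S_verts B"
    and i: "i \<in> lg_iso (S_graph A) (lg_restrict (S_graph B) U)"
    and p: "p \<in> lg_iso (lg_restrict (S_graph B) (S_verts B - U)) (S_graph C)"
    using assms unfolding S_split_def succ_closed_def by (auto simp: S_graph_def)
  have ih: "i \<in> S_hom G A B" using lg_iso_restrict_S_hom[OF i] .
  have ph: "p \<in> S_hom G B C"
    using S_hom_converse[OF lg_iso_restrict_S_hom[OF lg_iso_converse[OF p]]] by simp
  have Ri: "Range i = U" "Domain i = S_verts A"
    and Dp: "Domain p = S_verts B - U" "Range p = S_verts C"
    using lg_isoD(1,2)[OF i] lg_isoD(1,2)[OF p] U by (auto simp: S_graph_def lg_restrict_def)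
  have ii: "i O i\<inverse> = Id_on (S_verts A)" "i\<inverse> O i = Id_on U"
    using lg_iso_O_converse[OF i] U by (simp_all add: S_graph_def lg_restrict_def Int_absorb1)
  have pp: "p O p\<inverse> = Id_on (S_verts B - U)" "p\<inverse> O p = Id_on (S_verts C)"
    using lg_iso_O_converse[OF p] by (simp_all add: S_graph_def lg_restrict_def Int_absorb1)
  have ip: "i O p = {}" using Ri Dp by blast
  have empty: "g = {}" if "g \<in> S_hom G T [] \<or> g \<in> S_hom G [] T" for g T
    using that by (auto simp: S_hom_def S_verts_def)
  have "S_pullback G A B [] C i {} p {}"
    unfolding S_pullback_def
  proof (intro conjI ballI impI)
    fix T f g assume f: "f \<in> S_hom G T B" and g: "g \<in> S_hom G T []" and fp: "f O p = g O {}"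
    have "Range f \<subseteq> U" using fp f Dp(1) unfolding S_hom_def by blast
    then have f1: "(f O i\<inverse>) O i = f" unfolding O_assoc ii by (rule relcomp_Id_on)
    have uniq: "h = f O i\<inverse>" if "h \<in> S_hom G T A" "h O i = f" for h
    proof -
      have "h O Id_on (S_verts A) = h" using that(1) unfolding S_hom_def by (intro relcomp_Id_on) auto
      then show ?thesis using that(2) ii(1) O_assoc by metis
    qed
    show "\<exists>!h. h \<in> S_hom G T A \<and> h O i = f \<and> h O {} = g"
    proof (rule ex1I[of _ "f O i\<inverse>"])
      show "f O i\<inverse> \<in> S_hom G T A \<and> (f O i\<inverse>) O i = f \<and> (f O i\<inverse>) O {} = g"
        using S_hom_comp[OF f S_hom_converse[OF ih]] f1 empty[of g T] g by simp
    qed (use uniq in simp)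
  qed (simp add: ip)
  moreover have "S_pushout G A B [] C i {} p {}"
    unfolding S_pushout_def
  proof (intro conjI ballI impI)
    fix T f g assume f: "f \<in> S_hom G B T" and g: "g \<in> S_hom G [] T" and fi: "i O f = {} O g"
    have "Domain f \<subseteq> S_verts B - U" using fi f Ri(1) unfolding S_hom_def by blast
    then have f1: "p O (p\<inverse> O f) = f" unfolding O_assoc[symmetric] pp by (rule relcomp_Id_on)
    have uniq: "h = p\<inverse> O f" if "h \<in> S_hom G C T" "p O h = f" for h
    proof -
      have "Id_on (S_verts C) O h = h" using that(1) unfolding S_hom_def by (intro relcomp_Id_on) auto
      then show ?thesis using that(2) pp(2) O_assoc by metis
    qed
    show "\<exists>!h. h \<in> S_hom G C T \<and> p O h = f \<and> {} O h = g"
    proof (rule ex1I[of _ "p\<inverse> O f"])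
      show "p\<inverse> O f \<in> S_hom G C T \<and> p O p\<inverse> O f = f \<and> {} O p\<inverse> O f = g"
        using S_hom_comp[OF S_hom_converse[OF ph] f] f1 empty[of g T] g by simp
    qed (use uniq in simp)
  qed (simp add: ip)
  ultimately show ?thesis unfolding S_bicartesian_def by blast
qed

lemma S_arrows_reach: "(x, y) \<in> S_arrows G A \<Longrightarrow> A \<in> S_obj G \<Longrightarrow> S_prec G (snd y) (snd x)"
proof -
  assume "(x, y) \<in> S_arrows G A" "A \<in> S_obj G"
  then have e: "(snd x, snd y) \<in> parcs G" by (auto simp: S_arrows_def)
  then have "snd x \<in> pverts G" "snd y \<in> pverts G" using parcs_subset by auto
  then show ?thesis
    unfolding S_prec_def reachable_def using e
    by (simp add: rtrancl_on_into_rtrancl_on[OF rtrancl_on_refl])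
qed

lemma S_prec_rtrancl: "S_prec G b a \<Longrightarrow> (a, b) \<in> (parcs G)\<^sup>*"
  unfolding S_prec_def reachable_def by (simp add: rtrancl_on_rtranclI)

lemma S_graph_sublist:
  assumes "list_all2 (\<subseteq>) Js Hs"
  shows "S_verts Js \<subseteq> S_verts Hs" "S_graph Js = lg_restrict (S_graph Hs) (S_verts Js)"
proof -
  show sub: "S_verts Js \<subseteq> S_verts Hs"
    using assms by (auto simp: S_verts_def list_all2_conv_all_nth)
  show "S_graph Js = lg_restrict (S_graph Hs) (S_verts Js)"
    using sub by (auto simp: S_graph_def lg_restrict_def S_arrows_def)
qed

lemma embedding_lg_iso:
  assumes a: "a \<in> lg_iso (S_graph A) (S_graph Js)" and b: "b \<in> lg_iso (S_graph Hs) (S_graph B)"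
    and sub: "list_all2 (\<subseteq>) Js Hs"
  shows "a O Id_on (S_verts Js) O b \<in> lg_iso (S_graph A) (lg_restrict (S_graph B) (b `` S_verts Js))"
proof -
  have "b \<inter> S_verts Js \<times> UNIV \<in> lg_iso (S_graph Js) (lg_restrict (S_graph B) (b `` S_verts Js))"
    using lg_iso_restrict[OF b, of "S_verts Js"] S_graph_sublist[OF sub] by (simp add: S_graph_def)
  moreover have "Id_on (S_verts Js) O b = b \<inter> S_verts Js \<times> UNIV" by blast
  ultimately show ?thesis using lg_iso_O[OF a] by metis
qed

text \<open>
  The zero composite makes image and coimage disjoint.  They cover \<open>B\<close> because a vertex outside of
  both, as a morphism from a one-vertex quiver to \<open>B\<close>, would have to factor through the kernel \<open>i\<close>.
\<close>

lemma adm_seq_split: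
  assumes B: "B \<in> S_obj G" and i: "i \<in> S_adm_mono G A B" and p: "p \<in> S_adm_epi G B C"
    and bi: "S_bicartesian G A B C i p"
  shows "S_split A B C i p"
proof -
  obtain Js Hs a b where a: "a \<in> lg_iso (S_graph A) (S_graph Js)" and b: "b \<in> lg_iso (S_graph Hs) (S_graph B)"
    and m: "list_all2 (basic_mono G) Js Hs" and i_eq: "i = a O Id_on (S_verts Js) O b"
    using i unfolding S_adm_mono_def S_iso_eq by blast
  have sub: "list_all2 (\<subseteq>) Js Hs" using m by (rule list_all2_mono) (simp add: basic_mono_def)
  have Hs: "Hs \<in> S_obj G"
    using m unfolding S_obj_def list_all2_conv_all_nth basic_mono_def mem_Collect_eq
    by (metis in_set_conv_nth)
  define U where "U = b `` S_verts Js"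
  have i': "i \<in> lg_iso (S_graph A) (lg_restrict (S_graph B) U)"
    unfolding i_eq U_def by (rule embedding_lg_iso[OF a b sub])
  have "S_verts Js \<in> succ_closed (S_graph Hs)"
  proof -
    have "y \<in> S_verts Js" if x: "x \<in> S_verts Js" and xy: "(x, y) \<in> S_arrows G Hs" for x y
    proof -
      have k: "fst x < length Js" "snd x \<in> Js ! fst x" using x by (auto simp: S_verts_def)
      then have "basic_mono G (Js ! fst x) (Hs ! fst x)" using m by (auto simp: list_all2_conv_all_nth)
      moreover have "snd y \<in> Hs ! fst x" "fst y = fst x" using xy by (auto simp: S_arrows_def S_verts_def)
      ultimately have "snd y \<in> Js ! fst x"
        using S_arrows_reach[OF xy Hs] k(2) unfolding basic_mono_def by blast
      then show ?thesis using k \<open>fst y = fst x\<close> by (auto simp: S_verts_def)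
    qed
    then show ?thesis
      using S_graph_sublist(1)[OF sub] unfolding succ_closed_def S_graph_def by auto
  qed
  then have U: "U \<in> succ_closed (S_graph B)"
    unfolding U_def using lg_iso_succ_closed[OF b] immersedD(3)[OF S_graph_immersed[OF B]] by blast
  obtain Hs' Ks b' c where b': "b' \<in> lg_iso (S_graph B) (S_graph Hs')" and c: "c \<in> lg_iso (S_graph Ks) (S_graph C)"
    and e: "list_all2 (basic_epi G) Hs' Ks" and p_eq: "p = b' O Id_on (S_verts Ks) O c"
    using p unfolding S_adm_epi_def S_iso_eq by blast
  have sub': "list_all2 (\<subseteq>) Ks Hs'"
    using e unfolding list_all2_conv_all_nth basic_epi_def by auto
  define D where "D = b'\<inverse> `` S_verts Ks"
  have "p\<inverse> = c\<inverse> O Id_on (S_verts Ks) O b'\<inverse>"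
    unfolding p_eq converse_relcomp converse_Id_on O_assoc ..
  then have "p\<inverse> \<in> lg_iso (S_graph C) (lg_restrict (S_graph B) D)"
    unfolding D_def using embedding_lg_iso[OF lg_iso_converse[OF c] lg_iso_converse[OF b'] sub'] by simp
  then have p': "p \<in> lg_iso (lg_restrict (S_graph B) D) (S_graph C)"
    using lg_iso_converse by fastforce
  have Ri: "Range i = S_verts B \<inter> U" and Dp: "Domain p = S_verts B \<inter> D"
    using lg_isoD(2)[OF i'] lg_isoD(1)[OF p'] by (simp_all add: S_graph_def lg_restrict_def)
  have pb: "S_pullback G A B [] C i {} p {}" using bi unfolding S_bicartesian_def by blast
  have "i O p = {}" using pb unfolding S_pullback_def by simp
  then have disj: "S_verts B \<inter> U \<inter> D = {}" using Ri Dp by blast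
  have cover: "x \<in> U \<union> D" if x: "x \<in> S_verts B" for x
  proof (rule ccontr)
    assume n: "x \<notin> U \<union> D"
    let ?T = "[{snd x}]" and ?f = "{((0 :: nat, snd x), x)}"
    have "snd x \<in> pverts G" using immersedD(2)[OF S_graph_immersed[OF B], of x] x by (simp add: S_graph_def)
    then have T: "?T \<in> S_obj G" by (simp add: S_obj_def)
    have f: "?f \<in> S_hom G ?T B"
      using x no_loop by (auto simp: S_hom_def S_verts_def S_arrows_def single_valued_def)
    have g: "{} \<in> S_hom G ?T []" by (simp add: S_hom_def single_valued_def)
    have "?f O p = {} O {}" using n Dp by blast
    then have "\<exists>!h. h \<in> S_hom G ?T A \<and> h O i = ?f \<and> h O {} = ({} :: 'v smor)"
      using conjunct2[OF pb[unfolded S_pullback_def], THEN bspec, OF T, THEN bspec, OF f, THEN bspec, OF g]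
      by (rule rev_mp)
    then obtain h where "h O i = ?f" by (elim ex1E conjE)
    then have "x \<in> Range i" by blast
    then show False using Ri n by blast
  qed
  have "lg_restrict (S_graph B) D = lg_restrict (S_graph B) (S_verts B - U)"
  proof -
    have "S_verts B \<inter> D = S_verts B - U" using disj cover by blast
    moreover have "S_arrows G B \<subseteq> S_verts B \<times> S_verts B" by (auto simp: S_arrows_def)
    ultimately show ?thesis unfolding lg_restrict_def S_graph_def by auto
  qed
  then show ?thesis unfolding S_split_def using U i' p' by metis
qed

text \<open>
  A basic admissible monomorphism has to respect paths of the whole quiver, even those that leave
  the subquiver in question.  Replacing \<open>B\<close> by the list of its connected components reduces this to
  the closure under arrows.
\<close>

lemma split_adm_seq:
  assumes A: "A \<in> S_obj G" and B: "B \<in> S_obj G" and C: "C \<in> S_obj G" and split: "S_split A B C i p"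
  shows "i \<in> S_adm_mono G A B" "p \<in> S_adm_epi G B C"
proof -
  obtain U where U: "U \<in> succ_closed (S_graph B)"
    and i: "i \<in> lg_iso (S_graph A) (lg_restrict (S_graph B) U)"
    and p: "p \<in> lg_iso (lg_restrict (S_graph B) (S_verts B - U)) (S_graph C)"
    using split unfolding S_split_def by blast
  have UB: "U \<subseteq> S_verts B" using U unfolding succ_closed_def S_graph_def by auto
  obtain Hs b where Hs: "Hs \<in> S_obj G" "\<And>J. J \<in> set Hs \<Longrightarrow> connected_in J"
    and b: "b \<in> lg_iso (S_graph Hs) (S_graph B)"
    using immersed_realizable[OF S_graph_immersed[OF B]] by metis
  note b' = lg_iso_converse[OF b]
  define U' where "U' = b\<inverse> `` U"
  have U': "U' \<in> succ_closed (S_graph Hs)"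
    unfolding U'_def using lg_iso_succ_closed[OF b' U] immersedD(3)[OF S_graph_immersed[OF Hs(1)]] .
  then have U'H: "U' \<subseteq> S_verts Hs" unfolding succ_closed_def S_graph_def by auto
  define part where "part Y = map (\<lambda>k. {v \<in> Hs ! k. (k, v) \<in> Y}) [0..<length Hs]" for Y
  have part: "length (part Y) = length Hs" "k < length Hs \<Longrightarrow> part Y ! k = {v \<in> Hs ! k. (k, v) \<in> Y}"
      "S_verts (part Y) = S_verts Hs \<inter> Y" "list_all2 (\<subseteq>) (part Y) Hs" for Y k
    by (auto simp: part_def S_verts_def list_all2_conv_all_nth)
  \<comment> \<open>A connected full subquiver of a forest contains every directed path of the forest between
     two of its vertices, so that closure under arrows gives closure under paths.\<close>
  have closed: "w \<in> part U' ! k" if k: "k < length Hs" and v: "v \<in> part U' ! k" and w: "w \<in> Hs ! k"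
      and prec: "S_prec G w v" for k v w
  proof (rule connected_in_convex[of "Hs ! k" "part U' ! k" v w])
    show "connected_in (Hs ! k)" using Hs(2) k by simp
    show "part U' ! k \<subseteq> Hs ! k" using part(2)[OF k] by auto
    show "v' \<in> part U' ! k" if "(u, v') \<in> parcs G" "u \<in> part U' ! k" "v' \<in> Hs ! k" for u v'
    proof -
      have "((k, u), (k, v')) \<in> S_arrows G Hs"
        using that k part(2)[OF k] by (auto simp: S_arrows_def S_verts_def)
      moreover have "(k, u) \<in> U'" using that part(2)[OF k] by auto
      ultimately have "(k, v') \<in> U'" using U' unfolding succ_closed_def S_graph_def by auto
      then show ?thesis using that part(2)[OF k] by simp
    qed
  qed (use v w S_prec_rtrancl[OF prec] in auto)
  have Hk: "Hs ! k \<subseteq> pverts G" if "k < length Hs" for k using Hs(1) that unfolding S_obj_def by auto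
  have mono: "list_all2 (basic_mono G) (part U') Hs"
    unfolding list_all2_conv_all_nth basic_mono_def
  proof (intro conjI allI impI ballI)
    show "{b \<in> Hs ! k. S_prec G b a} \<subseteq> part U' ! k" if "k < length (part U')" "a \<in> part U' ! k" for k a
      using closed that part(1) by auto
  qed (use Hk part(1,2) in auto)
  have epi: "list_all2 (basic_epi G) Hs (part (- U'))"
    unfolding list_all2_conv_all_nth basic_epi_def
  proof (intro conjI allI impI ballI)
    fix k a assume k: "k < length Hs" and a: "a \<in> part (- U') ! k"
    show "{b \<in> Hs ! k. S_prec G a b} \<subseteq> part (- U') ! k"
    proof
      fix w assume w: "w \<in> {b \<in> Hs ! k. S_prec G a b}"
      have "a \<in> part U' ! k" if "w \<in> part U' ! k"
        using closed[OF k that, of a] a w part(2)[OF k] by auto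
      then show "w \<in> part (- U') ! k" using a w part(2)[OF k] by auto
    qed
  qed (use Hk part(1,2) in auto)
  have emb: "\<exists>a \<in> lg_iso (S_graph Z) (S_graph (part (b\<inverse> `` Y))). j = a O Id_on (S_verts (part (b\<inverse> `` Y))) O b"
    if Y: "Y \<subseteq> S_verts B" and j: "j \<in> lg_iso (S_graph Z) (lg_restrict (S_graph B) Y)" for j Y Z
  proof -
    have Y': "S_verts (part (b\<inverse> `` Y)) = b\<inverse> `` Y"
      unfolding part(3) using lg_isoD(9)[OF b] by (auto simp: S_graph_def)
    have Rj: "Range j = Y" using lg_isoD(2)[OF j] Y by (auto simp: S_graph_def lg_restrict_def)
    have r: "b\<inverse> \<inter> Y \<times> UNIV \<in> lg_iso (lg_restrict (S_graph B) Y) (S_graph (part (b\<inverse> `` Y)))"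
      using lg_iso_restrict[OF b', of Y] Y S_graph_sublist(2)[OF part(4)[of "b\<inverse> `` Y"]] Y'
      by (simp add: S_graph_def)
    have "j O (b\<inverse> \<inter> Y \<times> UNIV) O Id_on (b\<inverse> `` Y) O b = j O Id_on Y O (b\<inverse> O b)" by blast
    also have "\<dots> = j"
      using lg_iso_O_converse(2)[OF b] Rj Y
      by (simp add: S_graph_def relcomp_Id_on(1) flip: O_assoc)
    finally have "j = (j O (b\<inverse> \<inter> Y \<times> UNIV)) O Id_on (S_verts (part (b\<inverse> `` Y))) O b"
      unfolding Y' O_assoc by simp
    then show ?thesis using lg_iso_O[OF j r] by (rule bexI)
  qed
  obtain a where "a \<in> lg_iso (S_graph A) (S_graph (part U'))" "i = a O Id_on (S_verts (part U')) O b"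
    using emb[OF UB i] unfolding U'_def by blast
  then show "i \<in> S_adm_mono G A B"
    unfolding S_adm_mono_def S_iso_eq using mono b by blast
  have compl: "part (b\<inverse> `` (S_verts B - U)) = part (- U')"
  proof -
    have "b\<inverse> `` (S_verts B - U) = S_verts Hs - U'"
      unfolding U'_def using lg_iso_Image_Diff[OF b'] UB by (simp add: S_graph_def)
    moreover have "part (S_verts Hs - U') = part (- U')" unfolding part_def by (auto simp: S_verts_def)
    ultimately show ?thesis by simp
  qed
  obtain c where c: "c \<in> lg_iso (S_graph C) (S_graph (part (- U')))" "p\<inverse> = c O Id_on (S_verts (part (- U'))) O b"
    using emb[OF _ lg_iso_converse[OF p]] unfolding compl by blast
  have "p = b\<inverse> O Id_on (S_verts (part (- U'))) O c\<inverse>"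
    using c(2) by (metis O_assoc converse_Id_on converse_converse converse_relcomp)
  then show "p \<in> S_adm_epi G B C"
    unfolding S_adm_epi_def S_iso_eq using epi b' lg_iso_converse[OF c(1)] by blast
qed

lemma S_adm_seqs_eq:
  assumes "A \<in> S_obj G" "C \<in> S_obj G"
  shows "S_adm_seqs G C A B =
    {(B', i, p). B' \<in> S_obj G \<and> lg_iso (S_graph B') (S_graph B) \<noteq> {} \<and> S_split A B' C i p}"
  unfolding S_adm_seqs_def S_iso_eq
  using adm_seq_split split_adm_seq[OF assms(1) _ assms(2)] S_split_bicartesian by blast

lemma S_splitD:
  assumes "S_split A B C i p"
  shows "Range i \<in> succ_closed (S_graph B)" "i \<in> lg_iso (S_graph A) (lg_restrict (S_graph B) (Range i))"
    "p \<in> lg_iso (lg_restrict (S_graph B) (S_verts B - Range i)) (S_graph C)"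
    "Domain p = S_verts B - Range i" "single_valued (p\<inverse>)"
proof -
  obtain U where U: "U \<in> succ_closed (S_graph B)"
    and i: "i \<in> lg_iso (S_graph A) (lg_restrict (S_graph B) U)"
    and p: "p \<in> lg_iso (lg_restrict (S_graph B) (S_verts B - U)) (S_graph C)"
    using assms unfolding S_split_def by blast
  have "Range i = U"
    using lg_isoD(2)[OF i] U by (auto simp: S_graph_def lg_restrict_def succ_closed_def)
  then show "Range i \<in> succ_closed (S_graph B)" "i \<in> lg_iso (S_graph A) (lg_restrict (S_graph B) (Range i))"
    "p \<in> lg_iso (lg_restrict (S_graph B) (S_verts B - Range i)) (S_graph C)"
    using U i p by simp_all
  show "Domain p = S_verts B - Range i"
    using lg_isoD(1)[OF p] \<open>Range i = U\<close> by (auto simp: S_graph_def lg_restrict_def)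
  show "single_valued (p\<inverse>)" by (rule lg_isoD(4)[OF p])
qed

lemma S_split_iso:
  assumes split: "S_split A B C i p" and h: "h \<in> lg_iso (S_graph B) (S_graph B')" and B': "B' \<in> S_obj G"
  shows "S_split A B' C (i O h) (h\<inverse> O p)"
proof -
  note D = S_splitD[OF split]
  let ?U = "Range i"
  have U: "?U \<subseteq> S_verts B" using D(1) unfolding succ_closed_def S_graph_def by auto
  have "h `` ?U \<in> succ_closed (S_graph B')"
    using lg_iso_succ_closed[OF h D(1) immersedD(3)[OF S_graph_immersed[OF B']]] .
  moreover have "i O h \<in> lg_iso (S_graph A) (lg_restrict (S_graph B') (h `` ?U))"
  proof -
    have "i O h = i O (h \<inter> ?U \<times> UNIV)" by blast
    then show ?thesis using lg_iso_O[OF D(2) lg_iso_restrict[OF h]] U by (simp add: S_graph_def)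
  qed
  moreover have "h\<inverse> O p \<in> lg_iso (lg_restrict (S_graph B') (S_verts B' - h `` ?U)) (S_graph C)"
  proof -
    let ?V = "S_verts B - ?U"
    have "h\<inverse> O p = (h \<inter> ?V \<times> UNIV)\<inverse> O p" using D(4) by blast
    moreover have "h `` ?V = S_verts B' - h `` ?U"
      using lg_iso_Image_Diff[OF h] U by (simp add: S_graph_def)
    moreover have "h \<inter> ?V \<times> UNIV \<in> lg_iso (lg_restrict (S_graph B) ?V) (lg_restrict (S_graph B') (h `` ?V))"
      using lg_iso_restrict[OF h, of ?V] by (simp add: S_graph_def)
    ultimately show ?thesis using lg_iso_O[OF lg_iso_converse D(3)] by metis
  qed
  ultimately show ?thesis unfolding S_split_def by blast
qed

lemma finite_S_split:
  assumes "A \<in> S_obj G" "B \<in> S_obj G" "C \<in> S_obj G"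
  shows "finite {(i, p). S_split A B C i p}"
proof -
  have fin: "finite (S_verts X)" if "X \<in> S_obj G" for X
    using immersedD(1)[OF S_graph_immersed[OF that]] by (simp add: S_graph_def)
  have "i \<subseteq> S_verts A \<times> S_verts B \<and> p \<subseteq> S_verts B \<times> S_verts C" if "S_split A B C i p" for i p
    using lg_iso_subset[OF S_splitD(2)[OF that]] lg_iso_subset[OF S_splitD(3)[OF that]]
    by (auto simp: S_graph_def lg_restrict_def)
  then have "{(i, p). S_split A B C i p} \<subseteq> Pow (S_verts A \<times> S_verts B) \<times> Pow (S_verts B \<times> S_verts C)"
    by blast
  then show ?thesis by (rule finite_subset) (use fin assms in simp)
qed

text \<open>
  For each admissible \<open>U\<close> the two isomorphisms can be chosen independently.
\<close>

lemma card_S_split: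
  assumes "A \<in> S_obj G" "B \<in> S_obj G" "C \<in> S_obj G"
  shows "card {(i, p). S_split A B C i p} =
    card (lg_iso (S_graph A) (S_graph A)) * card (lg_iso (S_graph C) (S_graph C)) *
      lg_coeff (S_graph C) (S_graph A) (S_graph B)"
proof -
  let ?i = "\<lambda>U. lg_iso (S_graph A) (lg_restrict (S_graph B) U)"
  let ?p = "\<lambda>U. lg_iso (lg_restrict (S_graph B) (S_verts B - U)) (S_graph C)"
  let ?n = "card (lg_iso (S_graph A) (S_graph A)) * card (lg_iso (S_graph C) (S_graph C))"
  let ?S = "succ_closed (S_graph B)"
  have fin: "finite (fst (S_graph X))" if "X \<in> S_obj G" for X
    using immersedD(1)[OF S_graph_immersed[OF that]] .
  have finS: "finite ?S"
    unfolding succ_closed_def using fin[OF assms(2)] by (auto intro: finite_subset[of _ "Pow (fst (S_graph B))"])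
  have "{(i, p). S_split A B C i p} = (\<Union>U\<in>?S. ?i U \<times> ?p U)" unfolding S_split_def by blast
  also have "card \<dots> = (\<Sum>U\<in>?S. card (?i U \<times> ?p U))"
  proof (rule card_UN_disjoint[OF finS])
    have fr: "finite (fst (lg_restrict (S_graph B) Y))" for Y
      using fin[OF assms(2)] by (simp add: lg_restrict_def)
    show "\<forall>U\<in>?S. finite (?i U \<times> ?p U)" 
      by (intro ballI finite_cartesian_product finite_lg_iso fin fr assms)
    have R: "Range i = U" if "U \<in> ?S" "i \<in> ?i U" for U i
      using lg_isoD(2)[OF that(2)] that(1) by (auto simp: lg_restrict_def succ_closed_def)
    show "\<forall>U\<in>?S. \<forall>U'\<in>?S. U \<noteq> U' \<longrightarrow> (?i U \<times> ?p U) \<inter> (?i U' \<times> ?p U') = {}"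
      using R by blast
  qed
  also have "\<dots> = (\<Sum>U\<in>?S. if lg_iso (lg_restrict (S_graph B) U) (S_graph A) \<noteq> {} \<and> ?p U \<noteq> {} then ?n else 0)"
  proof (rule sum.cong[OF HOL.refl])
    fix U
    have "?i U \<noteq> {} \<longleftrightarrow> lg_iso (lg_restrict (S_graph B) U) (S_graph A) \<noteq> {}"
      using lg_iso_converse by blast
    moreover have "card (?i U) = card (lg_iso (S_graph A) (S_graph A))" if "?i U \<noteq> {}"
      using that card_lg_iso(1) by blast
    moreover have "card (?p U) = card (lg_iso (S_graph C) (S_graph C))" if "?p U \<noteq> {}"
      using that card_lg_iso(2) by blast
    ultimately show "card (?i U \<times> ?p U) =
        (if lg_iso (lg_restrict (S_graph B) U) (S_graph A) \<noteq> {} \<and> ?p U \<noteq> {} then ?n else 0)"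
      by (auto simp: card_cartesian_product)
  qed
  also have "\<dots> = (\<Sum>U\<in>{U \<in> ?S. lg_iso (lg_restrict (S_graph B) U) (S_graph A) \<noteq> {} \<and> ?p U \<noteq> {}}. ?n)"
    by (rule sum.inter_filter[OF finS, symmetric])
  also have "\<dots> = ?n * lg_coeff (S_graph C) (S_graph A) (S_graph B)"
    unfolding lg_coeff_def by (simp add: S_graph_def)
  finally show ?thesis .
qed

text \<open>
  Equivalent sequences are those in one orbit under transport of structure along isomorphisms of
  the middle term.
\<close>

lemma S_ext_equiv_iff:
  assumes "A \<in> S_obj G" "C \<in> S_obj G"
  shows "((B1, i1, p1), (B2, i2, p2)) \<in> S_ext_equiv G C A B \<longleftrightarrow>
    (B1, i1, p1) \<in> S_adm_seqs G C A B \<and> B2 \<in> S_obj G \<and>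
    (\<exists>h \<in> lg_iso (S_graph B1) (S_graph B2). i2 = i1 O h \<and> p2 = h\<inverse> O p1)"
proof -
  have "(B2, i2, p2) \<in> S_adm_seqs G C A B \<and> i1 O h = i2 \<and> h O p2 = p1 \<longleftrightarrow>
      B2 \<in> S_obj G \<and> i2 = i1 O h \<and> p2 = h\<inverse> O p1"
    if s: "(B1, i1, p1) \<in> S_adm_seqs G C A B" and h: "h \<in> lg_iso (S_graph B1) (S_graph B2)" for h
  proof
    note hh = lg_iso_O_converse[OF h]
    have s1: "lg_iso (S_graph B1) (S_graph B) \<noteq> {}" "S_split A B1 C i1 p1"
      using s unfolding S_adm_seqs_eq[OF assms] by auto
    assume l: "(B2, i2, p2) \<in> S_adm_seqs G C A B \<and> i1 O h = i2 \<and> h O p2 = p1"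
    then have s2: "B2 \<in> S_obj G" "S_split A B2 C i2 p2" unfolding S_adm_seqs_eq[OF assms] by auto
    have "h\<inverse> O p1 = Id_on (S_verts B2) O p2"
      using l hh(2) O_assoc[of "h\<inverse>" h p2] by (simp add: S_graph_def)
    also have "\<dots> = p2" using S_splitD(4)[OF s2(2)] by (intro relcomp_Id_on) auto
    finally show "B2 \<in> S_obj G \<and> i2 = i1 O h \<and> p2 = h\<inverse> O p1" using l s2 by blast
  next
    note hh = lg_iso_O_converse[OF h]
    have s1: "lg_iso (S_graph B1) (S_graph B) \<noteq> {}" "S_split A B1 C i1 p1"
      using s unfolding S_adm_seqs_eq[OF assms] by auto
    assume r: "B2 \<in> S_obj G \<and> i2 = i1 O h \<and> p2 = h\<inverse> O p1"
    have "h O p2 = Id_on (S_verts B1) O p1"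
      using r hh(1) O_assoc[of h "h\<inverse>" p1] by (simp add: S_graph_def)
    also have "\<dots> = p1" using S_splitD(4)[OF s1(2)] by (intro relcomp_Id_on) auto
    finally have "h O p2 = p1" .
    moreover have "lg_iso (S_graph B2) (S_graph B) \<noteq> {}"
      using s1(1) lg_iso_O[OF lg_iso_converse[OF h]] by blast
    ultimately show "(B2, i2, p2) \<in> S_adm_seqs G C A B \<and> i1 O h = i2 \<and> h O p2 = p1"
      unfolding S_adm_seqs_eq[OF assms] using S_split_iso[OF s1(2) h] r by simp
  qed
  note step = this
  have "((B1, i1, p1), (B2, i2, p2)) \<in> S_ext_equiv G C A B \<longleftrightarrow>
      (B1, i1, p1) \<in> S_adm_seqs G C A B \<and> (\<exists>h \<in> lg_iso (S_graph B1) (S_graph B2).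
        (B2, i2, p2) \<in> S_adm_seqs G C A B \<and> i1 O h = i2 \<and> h O p2 = p1)"
    unfolding S_ext_equiv_def S_iso_eq by simp
  also have "\<dots> \<longleftrightarrow> (B1, i1, p1) \<in> S_adm_seqs G C A B \<and> (\<exists>h \<in> lg_iso (S_graph B1) (S_graph B2).
      B2 \<in> S_obj G \<and> i2 = i1 O h \<and> p2 = h\<inverse> O p1)"
    by (rule conj_cong[OF HOL.refl], rule bex_cong[OF HOL.refl], rule step)
  finally show ?thesis by simp
qed

lemma equiv_S_ext_equiv:
  assumes AC: "A \<in> S_obj G" "C \<in> S_obj G"
  shows "equiv (S_adm_seqs G C A B) (S_ext_equiv G C A B)"
proof (rule equivI)
  let ?S = "S_adm_seqs G C A B" and ?R = "S_ext_equiv G C A B"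
  show "?R \<subseteq> ?S \<times> ?S" unfolding S_ext_equiv_def by auto
  show "refl_on ?S ?R"
  proof (rule refl_onI)
    fix s assume "s \<in> ?S"
    then obtain B1 i p where s: "s = (B1, i, p)" "(B1, i, p) \<in> ?S" by (cases s) auto
    then have B1: "B1 \<in> S_obj G" and sp: "S_split A B1 C i p" unfolding S_adm_seqs_eq[OF AC] by auto
    have "i = i O Id_on (S_verts B1)" "p = (Id_on (S_verts B1))\<inverse> O p"
      using S_splitD(1,4)[OF sp] relcomp_Id_on by (auto simp: succ_closed_def S_graph_def)
    then show "(s, s) \<in> ?R"
      unfolding s(1) S_ext_equiv_iff[OF AC]
      using s(2) B1 lg_iso_Id[of "S_graph B1", unfolded S_graph_def fst_conv, folded S_graph_def] by blast
  qed
  show "sym ?R"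
  proof (rule symI)
    fix s t assume st: "(s, t) \<in> ?R"
    obtain B1 i1 p1 B2 i2 p2 where s: "s = (B1, i1, p1)" "t = (B2, i2, p2)" by (cases s; cases t) auto
    obtain h where h: "h \<in> lg_iso (S_graph B1) (S_graph B2)" "i1 O h = i2" "h O p2 = p1"
      and m: "s \<in> ?S" "t \<in> ?S" using st unfolding s S_ext_equiv_def S_iso_eq by auto
    have B1: "B1 \<in> S_obj G" and sp: "S_split A B1 C i1 p1" using m(1) unfolding s S_adm_seqs_eq[OF AC] by auto
    have "i2 O h\<inverse> = i1 O Id_on (S_verts B1)"
      using h(2) lg_iso_O_converse(1)[OF h(1)] O_assoc[of i1 h "h\<inverse>"] by (simp add: S_graph_def)
    also have "\<dots> = i1" using S_splitD(1)[OF sp] by (intro relcomp_Id_on) (auto simp: succ_closed_def S_graph_def)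
    finally show "(t, s) \<in> ?R"
      unfolding s S_ext_equiv_iff[OF AC] using m(2) B1 h(3) lg_iso_converse[OF h(1)]
      by (intro conjI bexI[of _ "h\<inverse>"]) (simp_all add: s)
  qed
  show "trans ?R"
  proof (rule transI)
    fix s t u assume st: "(s, t) \<in> ?R" and tu: "(t, u) \<in> ?R"
    obtain B1 i1 p1 B2 i2 p2 B3 i3 p3 where s: "s = (B1, i1, p1)" "t = (B2, i2, p2)" "u = (B3, i3, p3)"
      by (cases s; cases t; cases u) auto
    obtain h k where "h \<in> lg_iso (S_graph B1) (S_graph B2)" "i2 = i1 O h" "p2 = h\<inverse> O p1"
      "k \<in> lg_iso (S_graph B2) (S_graph B3)" "i3 = i2 O k" "p3 = k\<inverse> O p2" "s \<in> ?S" "B3 \<in> S_obj G"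
      using st tu unfolding s S_ext_equiv_iff[OF AC] by auto
    then show "(s, u) \<in> ?R"
      unfolding s S_ext_equiv_iff[OF AC]
      by (intro conjI bexI[of _ "h O k"]) (simp_all add: s O_assoc converse_relcomp lg_iso_O)
  qed
qed

text \<open>
  Every class of extensions contains sequences with middle term \<open>B\<close> itself, and these form one orbit
  under the automorphisms of \<open>B\<close>.  The action is free, so that all orbits have the same size.
\<close>

lemma card_S_Ext:
  assumes A: "A \<in> S_obj G" and B: "B \<in> S_obj G" and C: "C \<in> S_obj G"
  shows "card (lg_iso (S_graph B) (S_graph B)) * card (S_Ext G C A B) = card {(i, p). S_split A B C i p}"
proof -
  let ?S = "S_adm_seqs G C A B" and ?R = "S_ext_equiv G C A B" and ?T = "{(i, p). S_split A B C i p}"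
  let ?Aut = "lg_iso (S_graph B) (S_graph B)"
  define slice where "slice X = {(i, p). (B, i, p) \<in> X}" for X :: "('v sobj \<times> 'v smor \<times> 'v smor) set"
  note eq = equiv_S_ext_equiv[OF A C, of B] and iff = S_ext_equiv_iff[OF A C]
  have memS: "(B, i, p) \<in> ?S \<longleftrightarrow> S_split A B C i p" for i p
    unfolding S_adm_seqs_eq[OF A C] using B lg_iso_Id by blast
  have ne: "slice X \<noteq> {}" if X: "X \<in> ?S // ?R" for X
  proof -
    obtain s where s: "s \<in> ?S" "X = ?R `` {s}" using X by (rule quotientE)
    obtain B' i p where s': "s = (B', i, p)" by (cases s) auto
    obtain h where h: "h \<in> lg_iso (S_graph B') (S_graph B)"
      using s(1) unfolding s' S_adm_seqs_eq[OF A C] by auto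
    have "(s, (B, i O h, h\<inverse> O p)) \<in> ?R"
      using s(1) B h unfolding s' iff by blast
    then show ?thesis unfolding s(2) slice_def by blast
  qed
  have card_slice: "card (slice X) = card ?Aut" if X: "X \<in> ?S // ?R" for X
  proof -
    obtain i p where ip: "(B, i, p) \<in> X" using ne[OF X] unfolding slice_def by blast
    then have S: "(B, i, p) \<in> ?S" using X in_quotient_imp_subset[OF eq] by blast
    have X': "X = ?R `` {(B, i, p)}" using class_of_member[OF eq X ip] by simp
    have sp: "S_split A B C i p" using S memS by simp
    \<comment> \<open>An automorphism is determined by its effect on the subobject and on the quotient.\<close>
    have sub: "h \<subseteq> h'" if h: "h \<in> ?Aut" "h' \<in> ?Aut" and i: "i O h = i O h'" and p: "h\<inverse> O p = h'\<inverse> O p" for h h'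
    proof
      fix e assume e: "e \<in> h"
      obtain x y where xy: "e = (x, y)" by (cases e)
      then have x: "x \<in> S_verts B" using e lg_isoD(9)[OF h(1)] by (auto simp: S_graph_def)
      show "e \<in> h'"
      proof (cases "x \<in> Range i")
        case True
        then obtain a where a: "(a, x) \<in> i" by blast
        then have "(a, y) \<in> i O h'" using e xy i by blast
        then obtain x2 where x2: "(a, x2) \<in> i" "(x2, y) \<in> h'" by blast
        have "x2 = x" using lg_isoD(7)[OF S_splitD(2)[OF sp] x2(1) a] .
        then show ?thesis using x2 xy by simp
      next
        case False
        then have "x \<in> Domain p" using x S_splitD(4)[OF sp] by blast
        then obtain c where c: "(x, c) \<in> p" by blast
        then have "(y, c) \<in> h'\<inverse> O p" using e xy p by blast
        then obtain x2 where x2: "(x2, y) \<in> h'" "(x2, c) \<in> p" by blast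
        have "x2 = x" using lg_isoD(8)[OF S_splitD(3)[OF sp] x2(2) c] .
        then show ?thesis using x2 xy by simp
      qed
    qed
    have "bij_betw (\<lambda>h. (i O h, h\<inverse> O p)) ?Aut (slice X)"
      unfolding bij_betw_def
    proof
      show "inj_on (\<lambda>h. (i O h, h\<inverse> O p)) ?Aut"
      proof (rule inj_onI)
        fix h h' assume hh: "h \<in> ?Aut" "h' \<in> ?Aut" and e: "(i O h, h\<inverse> O p) = (i O h', h'\<inverse> O p)"
        then have e': "i O h = i O h'" "h\<inverse> O p = h'\<inverse> O p" by blast+
        show "h = h'" using sub[OF hh e'] sub[OF hh(2,1) e'[symmetric]] by blast
      qed
      show "(\<lambda>h. (i O h, h\<inverse> O p)) ` ?Aut = slice X"
        unfolding X' slice_def using S B by (auto simp: iff)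
    qed
    then show ?thesis by (simp add: bij_betw_same_card)
  qed
  have disj: "slice X \<inter> slice Y = {}" if "X \<in> ?S // ?R" "Y \<in> ?S // ?R" "X \<noteq> Y" for X Y
    using quotient_disj[OF eq that(1,2)] that(3) unfolding slice_def by blast
  have inj: "inj_on slice (?S // ?R)"
  proof (rule inj_onI, rule ccontr)
    fix X Y assume XY: "X \<in> ?S // ?R" "Y \<in> ?S // ?R" "slice X = slice Y" "X \<noteq> Y"
    then show False using disj[of X Y] ne by simp
  qed
  have Un: "\<Union>(slice ` (?S // ?R)) = ?T"
  proof
    show "\<Union>(slice ` (?S // ?R)) \<subseteq> ?T"
      unfolding slice_def using in_quotient_imp_subset[OF eq] memS by blast
    show "?T \<subseteq> \<Union>(slice ` (?S // ?R))"
    proof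
      fix t assume "t \<in> ?T"
      then obtain i p where t: "t = (i, p)" "(B, i, p) \<in> ?S" using memS by auto
      have "(B, i, p) \<in> ?R `` {(B, i, p)}" using equiv_class_self[OF eq t(2)] .
      then have "t \<in> slice (?R `` {(B, i, p)})" unfolding slice_def t(1) by blast
      then show "t \<in> \<Union>(slice ` (?S // ?R))" using quotientI[OF t(2), of ?R] by blast
    qed
  qed
  have finT: "finite ?T" by (rule finite_S_split[OF A B C])
  have "finite (slice ` (?S // ?R))" using finT Un by (metis finite_UnionD)
  then have "card ?Aut * card (slice ` (?S // ?R)) = card (\<Union>(slice ` (?S // ?R)))"
  proof (rule card_partition)
    show "finite (\<Union>(slice ` (?S // ?R)))" using finT Un by simp
  qed (use card_slice disj in auto)
  then show ?thesis unfolding Un card_image[OF inj] S_Ext_def .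
qed

text \<open>
  The weight of \<open>A\<close> is \<open>|Aut A|\<close>, as required by the two previous counts.
\<close>

lemma hall_S_isomorphic:
  "algebra_isomorphic (hall_S G :: ('k::field_char_0, 'v sobj set \<Rightarrow> 'k) module) (hall_lg_op G)"
proof -
  let ?w = "\<lambda>A. of_nat (card (lg_iso (S_graph A) (S_graph A))) :: 'k"
  have rel: "(A, B) \<in> S_iso_rel G \<longleftrightarrow> A \<in> S_obj G \<and> B \<in> S_obj G \<and> (S_graph A, S_graph B) \<in> lg_iso_rel G" for A B
    using S_graph_immersed unfolding S_iso_rel_def lg_iso_rel_def S_iso_eq by auto
  have gz: "S_graph [] = ({}, {})" by (simp add: S_graph_def S_verts_def S_arrows_def)
  have "hall_equivalence (S_obj G) (S_iso_rel G) [] (\<lambda>A C B. card (S_Ext G C A B))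
    (immersed G) (lg_iso_rel G) ({}, {}) (\<lambda>M N. lg_coeff N M) S_graph ?w"
  proof
    show "equiv (S_obj G) (S_iso_rel G)"
    proof (rule equivI)
      show "S_iso_rel G \<subseteq> S_obj G \<times> S_obj G" using rel by auto
      note e = equiv_lg_iso_rel[of G]
      show "refl_on (S_obj G) (S_iso_rel G)" unfolding refl_on_def
        using rel S_graph_immersed e by (meson equivE refl_onD)
      show "sym (S_iso_rel G)" unfolding sym_def using rel e by (meson equivE symD)
      show "trans (S_iso_rel G)" unfolding trans_def using rel e by (meson equivE transD)
    qed
    show "equiv (immersed G) (lg_iso_rel G)" by (rule equiv_lg_iso_rel)
    show "S_graph A \<in> immersed G" if "A \<in> S_obj G" for A using S_graph_immersed[OF that] .
    show "(S_graph A, S_graph B) \<in> lg_iso_rel G \<longleftrightarrow> (A, B) \<in> S_iso_rel G" if "A \<in> S_obj G" "B \<in> S_obj G" for A B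
      using rel that by blast
    show "\<exists>A\<in>S_obj G. (S_graph A, Y) \<in> lg_iso_rel G" if Y: "Y \<in> immersed G" for Y
    proof -
      obtain A f where "A \<in> S_obj G" "f \<in> lg_iso (S_graph A) Y" using immersed_realizable[OF Y] by metis
      then show ?thesis using Y S_graph_immersed unfolding lg_iso_rel_def by blast
    qed
    show "[] \<in> S_obj G" by (simp add: S_obj_def)
    show "(S_graph [], ({}, {})) \<in> lg_iso_rel G"
      unfolding gz lg_iso_rel_def using immersed_empty lg_iso_Id by blast
    have fin: "finite (lg_iso (S_graph A) (S_graph A))" if "A \<in> S_obj G" for A
      using finite_lg_iso immersedD(1)[OF S_graph_immersed[OF that]] by blast
    show "?w A \<noteq> 0" if "A \<in> S_obj G" for A
      using fin[OF that] lg_iso_Id[of "S_graph A"] by auto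
    show "?w A = 1" if z: "([], A) \<in> S_iso_rel G" for A
    proof -
      obtain f where f: "f \<in> lg_iso (S_graph []) (S_graph A)" using z unfolding rel lg_iso_rel_def by blast
      have "lg_iso ({}, {}) ({}, {}) = {{} :: 'v smor}"
        using lg_iso_subset[of _ "({}, {})" "({}, {})"] lg_iso_Id[of "({}, {})"] by auto
      then show ?thesis using card_lg_iso[OF f] gz by simp
    qed
    show "?w K * of_nat (card (S_Ext G C A K)) = ?w A * ?w C * of_nat (lg_coeff (S_graph C) (S_graph A) (S_graph K))"
      if "A \<in> S_obj G" "C \<in> S_obj G" "K \<in> S_obj G" for A C K
      using card_S_Ext[OF that(1,3,2)] card_S_split[OF that(1,3,2)]
      by (simp flip: of_nat_mult)
    show "lg_coeff Y X Z = lg_coeff Y' X' Z'"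
      if "(X, X') \<in> lg_iso_rel G" "(Y, Y') \<in> lg_iso_rel G" "(Z, Z') \<in> lg_iso_rel G" for X X' Y Y' Z Z'
      using lg_coeff_cong that by blast
  qed
  then show ?thesis unfolding hall_S_def hall_lg_op_def by (rule hall_equivalence.transport_iso)
qed

end

section \<open>Representations over the field with one element\<close>

lemma F1_map_compose:
  assumes "F1_map f V v0 W w0" "F1_map g W w0 Z z0" shows "F1_map (\<lambda>x. g (f x)) V v0 Z z0"
proof -
  have "inj_on (\<lambda>x. g (f x)) {x \<in> V. g (f x) \<noteq> z0}"
  proof (rule inj_onI)
    fix x y assume x: "x \<in> {x \<in> V. g (f x) \<noteq> z0}" and y: "y \<in> {x \<in> V. g (f x) \<noteq> z0}" and e: "g (f x) = g (f y)"
    have ne: "f x \<noteq> w0" "f y \<noteq> w0" using x y assms unfolding F1_map_def by auto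
    have f: "f x = f y"
      by (rule inj_onD[of g "{x \<in> W. g x \<noteq> z0}"]) (use assms e x y in \<open>auto simp: F1_map_def\<close>)
    show "x = y"
      by (rule inj_onD[of f "{x \<in> V. f x \<noteq> w0}", OF _ f]) (use assms x y ne in \<open>auto simp: F1_map_def\<close>)
  qed
  then show ?thesis using assms unfolding F1_map_def by auto
qed

context forest_quiver
begin

abbreviation (input) walk :: "'v \<Rightarrow> ('v \<times> 'v) list \<Rightarrow> 'v \<Rightarrow> bool" where
  "walk \<equiv> pre_digraph.awalk (with_proj G)"

lemma walk_Nil [simp]: "walk u [] v \<longleftrightarrow> u = v \<and> u \<in> pverts G"
  by (auto simp: pre_digraph.awalk_def cas_with_proj_eq)

lemma walk_Cons [simp]: "walk u (e # p) v \<longleftrightarrow> e \<in> parcs G \<and> fst e = u \<and> walk (snd e) p v"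
  using parcs_subset by (auto simp: pre_digraph.awalk_def cas_with_proj_eq)

lemma walk_end: "walk u p v \<Longrightarrow> u \<in> pverts G \<and> v \<in> pverts G"
  using parcs_subset by (induction p arbitrary: u) auto

lemma walk_last: "walk u p v \<Longrightarrow> pre_digraph.awlast (with_proj G) u p = v"
proof (induction p arbitrary: u)
  case (Cons e p)
  have "pawalk_verts (snd e) p \<noteq> []" by (cases p) auto
  then show ?case using Cons by (auto simp: awalk_verts_with_proj_eq)
qed (simp add: awalk_verts_with_proj_eq)

lemma F1_nilpotent_if_forest: "F1_nilpotent (with_proj G) M"
  unfolding F1_nilpotent_def using directed_walk_bound by (meson not_le)

lemma F1_obj_eq: "F1_obj (with_proj G) = {M. is_F1_rep (with_proj G) M}"
  unfolding F1_obj_def using F1_nilpotent_if_forest by blast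

lemma F1_repD:
  assumes "is_F1_rep (with_proj G) M"
  shows "v \<in> pverts G \<Longrightarrow> finite (pts M v)" "v \<in> pverts G \<Longrightarrow> bpt M v \<in> pts M v"
    "walk u p v \<Longrightarrow> F1_map (act M u p) (pts M u) (bpt M u) (pts M v) (bpt M v)"
    "v \<in> pverts G \<Longrightarrow> x \<in> pts M v \<Longrightarrow> act M v [] x = x"
    "walk u p v \<Longrightarrow> walk v q w \<Longrightarrow> x \<in> pts M u \<Longrightarrow> act M u (p @ q) x = act M v q (act M u p x)"
  using assms unfolding is_F1_rep_def with_proj_simps by blast+

lemma F1_actD:
  assumes "is_F1_rep (with_proj G) M" "walk u p v"
  shows "act M u p (bpt M u) = bpt M v" "x \<in> pts M u \<Longrightarrow> act M u p x \<in> pts M v"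
    "x \<in> pts M u \<Longrightarrow> y \<in> pts M u \<Longrightarrow> act M u p x = act M u p y \<Longrightarrow> act M u p x \<noteq> bpt M v \<Longrightarrow> x = y"
proof -
  note m = F1_repD(3)[OF assms]
  show "act M u p (bpt M u) = bpt M v" "x \<in> pts M u \<Longrightarrow> act M u p x \<in> pts M v"
    using m unfolding F1_map_def by auto
  show "x = y" if "x \<in> pts M u" "y \<in> pts M u" "act M u p x = act M u p y" "act M u p x \<noteq> bpt M v"
    by (rule inj_onD[of "act M u p" "{x \<in> pts M u. act M u p x \<noteq> bpt M v}"]) (use m that in \<open>auto simp: F1_map_def\<close>)
qed

lemma F1_act_Cons:
  assumes "is_F1_rep (with_proj G) M" "walk u (e # p) v" "x \<in> pts M u"
  shows "act M u (e # p) x = act M (snd e) p (act M u [e] x)"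
proof -
  have "walk u [e] (snd e)" "walk (snd e) p v" using assms(2) walk_end by auto
  then show ?thesis using F1_repD(5)[OF assms(1), of u "[e]" "snd e" p v x] assms(3) by simp
qed

text \<open>
  The coefficient quiver: the base points are removed, and arrows of \<open>G\<close> that send a point to the
  base point are not drawn.
\<close>

definition rep_graph :: "('v, 'v \<times> 'v) F1_rep \<Rightarrow> 'v lgraph" where
  "rep_graph M = (let V = {(x, v). v \<in> pverts G \<and> x \<in> pts M v \<and> x \<noteq> bpt M v} in
     (V, {((x, u), (y, v)). (x, u) \<in> V \<and> (y, v) \<in> V \<and> (u, v) \<in> parcs G \<and> act M u [(u, v)] x = y}))"

lemma rep_graph_verts: "(x, v) \<in> fst (rep_graph M) \<longleftrightarrow> v \<in> pverts G \<and> x \<in> pts M v \<and> x \<noteq> bpt M v"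
  by (simp add: rep_graph_def Let_def)

lemma rep_graph_arrows: "((x, u), (y, v)) \<in> snd (rep_graph M) \<longleftrightarrow>
    (x, u) \<in> fst (rep_graph M) \<and> (y, v) \<in> fst (rep_graph M) \<and> (u, v) \<in> parcs G \<and> act M u [(u, v)] x = y"
  by (simp add: rep_graph_def Let_def)

lemma walk_arc: "(u, v) \<in> parcs G \<Longrightarrow> walk u [(u, v)] v"
  using parcs_subset by auto

lemma rep_graph_immersed:
  assumes M: "is_F1_rep (with_proj G) M"
  shows "rep_graph M \<in> immersed G"
proof -
  have "fst (rep_graph M) \<subseteq> (\<lambda>(v, x). (x, v)) ` (SIGMA v:pverts G. pts M v)"
    by (auto simp: rep_graph_def Let_def image_iff)
  moreover have "finite ((\<lambda>(v, x). (x, v)) ` (SIGMA v:pverts G. pts M v))"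
    using finite_pverts F1_repD(1)[OF M] by simp
  ultimately have fin: "finite (fst (rep_graph M))" by (rule finite_subset)
  have "(fst (rep_graph M), snd (rep_graph M)) \<in> immersed G"
  proof (rule immersedI[OF fin])
    show "snd x \<in> pverts G" if "x \<in> fst (rep_graph M)" for x
      using that by (cases x) (simp add: rep_graph_verts)
    show "snd (rep_graph M) \<subseteq> fst (rep_graph M) \<times> fst (rep_graph M)"
      by (auto simp: rep_graph_arrows)
    show "(snd x, snd y) \<in> parcs G" if "(x, y) \<in> snd (rep_graph M)" for x y
      using that by (cases x; cases y) (simp add: rep_graph_arrows)
    show "y = y'" if "(x, y) \<in> snd (rep_graph M)" "(x, y') \<in> snd (rep_graph M)" "snd y = snd y'" for x y y'
      using that by (cases x; cases y; cases y') (simp add: rep_graph_arrows)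
    show "x = x'" if e: "(x, y) \<in> snd (rep_graph M)" "(x', y) \<in> snd (rep_graph M)" "snd x = snd x'" for x x' y
    proof -
      obtain a u a' b v where x: "x = (a, u)" "x' = (a', u)" "y = (b, v)"
        using e(3) by (cases x; cases x'; cases y) auto
      have h: "a \<in> pts M u" "a' \<in> pts M u" "act M u [(u, v)] a = b" "act M u [(u, v)] a' = b"
          "b \<noteq> bpt M v" "(u, v) \<in> parcs G"
        using e unfolding x by (auto simp: rep_graph_arrows rep_graph_verts)
      then show ?thesis using F1_actD(3)[OF M walk_arc[OF h(6)] h(1,2)] x by simp
    qed
  qed
  then show ?thesis by simp
qed

definition hom_of_iso :: "'v smor \<Rightarrow> ('v, 'v \<times> 'v) F1_rep \<Rightarrow> ('v, 'v \<times> 'v) F1_rep \<Rightarrow> 'v \<Rightarrow> nat \<Rightarrow> nat" where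
  "hom_of_iso f M N v x = (if x = bpt M v then bpt N v else THE y. ((x, v), (y, v)) \<in> f)"

lemma hom_of_iso:
  assumes f: "f \<in> lg_iso (rep_graph M) (rep_graph N)" and v: "v \<in> pverts G" and x: "x \<in> pts M v" "x \<noteq> bpt M v"
  shows "((x, v), (hom_of_iso f M N v x, v)) \<in> f"
proof -
  have "(x, v) \<in> fst (rep_graph M)" using v x by (simp add: rep_graph_verts)
  then obtain e where e: "((x, v), e) \<in> f" using lg_isoD(11)[OF f] by blast
  then have "snd e = v" using lg_isoD(5)[OF f e] by simp
  then obtain y where y: "((x, v), (y, v)) \<in> f" using e by (cases e) auto
  then have "(THE y. ((x, v), (y, v)) \<in> f) = y" using lg_isoD(7)[OF f y] by blast
  then show ?thesis using y x(2) by (simp add: hom_of_iso_def)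
qed

lemma hom_of_iso_eq:
  assumes f: "f \<in> lg_iso (rep_graph M) (rep_graph N)" and e: "((x, v), (y, v)) \<in> f"
  shows "hom_of_iso f M N v x = y"
proof -
  have x: "v \<in> pverts G" "x \<in> pts M v" "x \<noteq> bpt M v"
    using lg_isoD(9)[OF f e] by (simp_all add: rep_graph_verts)
  show ?thesis using lg_isoD(7)[OF f hom_of_iso[OF f x] e] by simp
qed

text \<open>
  Compatibility with a single arrow is compatibility with the arrows of the coefficient quivers,
  except that a point may go to the base point on one side; then it must do so on the other side,
  since otherwise an arrow of the second graph would have no counterpart in the first.
\<close>

lemma hom_of_iso_hom:
  assumes f: "f \<in> lg_iso (rep_graph M) (rep_graph N)"
    and M: "is_F1_rep (with_proj G) M" and N: "is_F1_rep (with_proj G) N"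
  shows "hom_of_iso f M N \<in> F1_hom (with_proj G) M N"
proof -
  let ?h = "hom_of_iso f M N"
  have bp: "?h v (bpt M v) = bpt N v" for v by (simp add: hom_of_iso_def)
  have mem: "?h v x \<in> pts N v" "x \<noteq> bpt M v \<Longrightarrow> ?h v x \<noteq> bpt N v" if "v \<in> pverts G" "x \<in> pts M v" for v x
    using lg_isoD(10)[OF f hom_of_iso[OF f that]] bp[of v] F1_repD(2)[OF N that(1)]
    by (cases "x = bpt M v"; simp add: rep_graph_verts)+
  have inj: "x = y" if "v \<in> pverts G" "x \<in> pts M v" "y \<in> pts M v" "?h v x = ?h v y" for v x y
  proof (cases "x = bpt M v \<or> y = bpt M v")
    case True
    then show ?thesis using mem(2)[OF that(1,2)] mem(2)[OF that(1,3)] that(4) bp[of v] by metis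
  next
    case False
    then have "((x, v), (?h v x, v)) \<in> f" "((y, v), (?h v x, v)) \<in> f"
      using hom_of_iso[OF f that(1,2)] hom_of_iso[OF f that(1,3)] that(4) by simp_all
    then show ?thesis using lg_isoD(8)[OF f] by blast
  qed
  have arc: "?h v (act M u [(u, v)] x) = act N u [(u, v)] (?h u x)" if uv: "(u, v) \<in> parcs G" and x: "x \<in> pts M u" for u v x
  proof (cases "x = bpt M u")
    case True
    then show ?thesis using F1_actD(1)[OF M walk_arc[OF uv]] F1_actD(1)[OF N walk_arc[OF uv]] bp by simp
  next
    case False
    have V: "u \<in> pverts G" "v \<in> pverts G" using uv parcs_subset by auto
    note xf = hom_of_iso[OF f V(1) x False]
    let ?y = "act M u [(u, v)] x" and ?z = "act N u [(u, v)] (?h u x)"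
    have y: "?y \<in> pts M v" using F1_actD(2)[OF M walk_arc[OF uv] x] .
    have z: "?z \<in> pts N v" using F1_actD(2)[OF N walk_arc[OF uv] mem(1)[OF V(1) x]] .
    have xV: "(x, u) \<in> fst (rep_graph M)" "(?h u x, u) \<in> fst (rep_graph N)"
      using lg_isoD(9,10)[OF f xf] .
    show ?thesis
    proof (cases "?y = bpt M v")
      case False
      note yf = hom_of_iso[OF f V(2) y False]
      have "((x, u), (?y, v)) \<in> snd (rep_graph M)"
        using xV uv lg_isoD(9)[OF f yf] by (simp add: rep_graph_arrows)
      then have "((?h u x, u), (?h v ?y, v)) \<in> snd (rep_graph N)" using lg_isoD(6)[OF f xf yf] by simp
      then show ?thesis by (simp add: rep_graph_arrows)
    next
      case True
      have "?z = bpt N v"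
      proof (rule ccontr)
        assume n: "?z \<noteq> bpt N v"
        then have zV: "(?z, v) \<in> fst (rep_graph N)" using z V by (simp add: rep_graph_verts)
        then obtain e where e: "(e, (?z, v)) \<in> f" using lg_isoD(12)[OF f] by blast
        then obtain w where w: "e = (w, v)" using lg_isoD(5)[OF f e] by (cases e) auto
        have "((?h u x, u), (?z, v)) \<in> snd (rep_graph N)" using xV zV uv by (simp add: rep_graph_arrows)
        then have "((x, u), (w, v)) \<in> snd (rep_graph M)" using lg_isoD(6)[OF f xf e[unfolded w]] by simp
        then show False using True by (auto simp: rep_graph_arrows rep_graph_verts)
      qed
      then show ?thesis using True bp by simp
    qed
  qed
  have nat: "?h v (act M u p x) = act N u p (?h u x)" if "walk u p v" "x \<in> pts M u" for u p v x
    using that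
  proof (induction p arbitrary: u x)
    case Nil
    then show ?case using F1_repD(4)[OF M] F1_repD(4)[OF N] mem(1) by auto
  next
    case (Cons e p)
    then have u: "u \<in> pverts G" and e: "e \<in> parcs G" "fst e = u" "walk (snd e) p v"
      using parcs_subset by auto
    have w: "walk u [e] (snd e)" using e walk_end by auto
    have "?h v (act M u (e # p) x) = ?h v (act M (snd e) p (act M u [e] x))"
      using F1_act_Cons[OF M Cons.prems] by simp
    also have "\<dots> = act N (snd e) p (?h (snd e) (act M u [e] x))"
      using Cons.IH[OF e(3)] F1_actD(2)[OF M w Cons.prems(2)] by simp
    also have "?h (snd e) (act M u [e] x) = act N u [e] (?h u x)"
      using arc[of u "snd e" x] e Cons.prems(2) by (cases e) auto
    also have "act N (snd e) p \<dots> = act N u (e # p) (?h u x)"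
      using F1_act_Cons[OF N Cons.prems(1) mem(1)[OF u Cons.prems(2)]] by simp
    finally show ?case .
  qed
  have "F1_map (?h v) (pts M v) (bpt M v) (pts N v) (bpt N v)" if "v \<in> pverts G" for v
    unfolding F1_map_def using mem(1)[OF that] bp inj[OF that] by (auto intro!: inj_onI)
  then show ?thesis unfolding F1_hom_def using nat by simp
qed

text \<open>
  An isomorphism matches base points with base points, and everything else is recorded by the
  coefficient quivers.
\<close>

lemma F1_isomorphic_iff:
  assumes M: "is_F1_rep (with_proj G) M" and N: "is_F1_rep (with_proj G) N"
  shows "F1_isomorphic (with_proj G) M N \<longleftrightarrow> lg_iso (rep_graph M) (rep_graph N) \<noteq> {}"
proof
  assume "F1_isomorphic (with_proj G) M N"
  then obtain \<phi> \<psi> where \<phi>: "\<phi> \<in> F1_hom (with_proj G) M N" and \<psi>: "\<psi> \<in> F1_hom (with_proj G) N M"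
    and inv: "\<And>v x. v \<in> pverts G \<Longrightarrow> x \<in> pts M v \<Longrightarrow> \<psi> v (\<phi> v x) = x"
      "\<And>v y. v \<in> pverts G \<Longrightarrow> y \<in> pts N v \<Longrightarrow> \<phi> v (\<psi> v y) = y"
    unfolding F1_isomorphic_def by auto
  have bp: "\<phi> v (bpt M v) = bpt N v" "\<psi> v (bpt N v) = bpt M v"
    and mem: "x \<in> pts M v \<Longrightarrow> \<phi> v x \<in> pts N v" "y \<in> pts N v \<Longrightarrow> \<psi> v y \<in> pts M v"
    if "v \<in> pverts G" for v x y
    using \<phi> \<psi> that unfolding F1_hom_def F1_map_def by auto
  have V: "(\<phi> v x, v) \<in> fst (rep_graph N)" if "(x, v) \<in> fst (rep_graph M)" for x v
    using that mem(1)[of v x] bp[of v] inv(1)[of v x] by (auto simp: rep_graph_verts)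
  have V': "(\<psi> v y, v) \<in> fst (rep_graph M)" if "(y, v) \<in> fst (rep_graph N)" for y v
    using that mem(2)[of v y] bp[of v] inv(2)[of v y] by (auto simp: rep_graph_verts)
  let ?f = "{((x, v), (\<phi> v x, v)) |x v. (x, v) \<in> fst (rep_graph M)}"
  have "?f \<in> lg_iso (rep_graph M) (rep_graph N)"
  proof (rule lg_isoI)
    show "Domain ?f = fst (rep_graph M)" by auto
    show "Range ?f = fst (rep_graph N)"
    proof
      show "Range ?f \<subseteq> fst (rep_graph N)" using V by auto
      show "fst (rep_graph N) \<subseteq> Range ?f"
      proof
        fix e assume e: "e \<in> fst (rep_graph N)"
        obtain y v where y: "e = (y, v)" by (cases e)
        then have "((\<psi> v y, v), (\<phi> v (\<psi> v y), v)) \<in> ?f" using e V' by blast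
        moreover have "\<phi> v (\<psi> v y) = y" using e inv(2) unfolding y by (simp add: rep_graph_verts)
        ultimately have "((\<psi> v y, v), (y, v)) \<in> ?f" by (simp only:)
        then show "e \<in> Range ?f" unfolding y by (rule RangeI)
      qed
    qed
    show "y = z" if "(x, y) \<in> ?f" "(x, z) \<in> ?f" for x y z using that by auto
    show "snd x = snd y" if "(x, y) \<in> ?f" for x y using that by auto
    have inj: "x = y" if "(x, v) \<in> fst (rep_graph M)" "(y, v) \<in> fst (rep_graph M)" "\<phi> v x = \<phi> v y" for x y v
      using that inv(1) by (metis rep_graph_verts)
    show "x = y" if xz: "(x, z) \<in> ?f" and yz: "(y, z) \<in> ?f" for x y z
    proof -
      obtain a v where a: "x = (a, v)" "z = (\<phi> v a, v)" "(a, v) \<in> fst (rep_graph M)" using xz by auto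
      obtain b where b: "y = (b, v)" "\<phi> v a = \<phi> v b" "(b, v) \<in> fst (rep_graph M)" using yz a(2) by auto
      show ?thesis using inj[OF a(3) b(3,2)] a(1) b(1) by simp
    qed
    show "(x, x') \<in> snd (rep_graph M) \<longleftrightarrow> (y, y') \<in> snd (rep_graph N)" if xy: "(x, y) \<in> ?f" "(x', y') \<in> ?f" for x y x' y'
    proof -
      obtain a u b v where a: "x = (a, u)" "y = (\<phi> u a, u)" "x' = (b, v)" "y' = (\<phi> v b, v)"
        "(a, u) \<in> fst (rep_graph M)" "(b, v) \<in> fst (rep_graph M)" using xy by auto
      have "act M u [(u, v)] a = b \<longleftrightarrow> act N u [(u, v)] (\<phi> u a) = \<phi> v b" if uv: "(u, v) \<in> parcs G"
      proof -
        have nat: "\<phi> v (act M u [(u, v)] a) = act N u [(u, v)] (\<phi> u a)"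
          using \<phi> walk_arc[OF uv] a(5) unfolding F1_hom_def by (simp add: rep_graph_verts)
        have m: "act M u [(u, v)] a \<in> pts M v"
          using F1_actD(2)[OF M walk_arc[OF uv]] a(5) by (simp add: rep_graph_verts)
        have "v \<in> pverts G" "b \<in> pts M v" using a(6) by (simp_all add: rep_graph_verts)
        then have "\<phi> v (act M u [(u, v)] a) = \<phi> v b \<longleftrightarrow> act M u [(u, v)] a = b"
          using inv(1) m by metis
        then show ?thesis unfolding nat by (rule HOL.sym)
      qed
      then show ?thesis using a V by (auto simp: rep_graph_arrows)
    qed
  qed
  then show "lg_iso (rep_graph M) (rep_graph N) \<noteq> {}" by blast
next
  have inv: "hom_of_iso (f\<inverse>) N M v (hom_of_iso f M N v x) = x"
    if f: "f \<in> lg_iso (rep_graph M) (rep_graph N)" and v: "v \<in> pverts G" "x \<in> pts M v" for f v x M N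
  proof (cases "x = bpt M v")
    case False
    then show ?thesis using hom_of_iso[OF f v] by (intro hom_of_iso_eq[OF lg_iso_converse[OF f]]) simp
  qed (simp add: hom_of_iso_def)
  assume "lg_iso (rep_graph M) (rep_graph N) \<noteq> {}"
  then obtain f where f: "f \<in> lg_iso (rep_graph M) (rep_graph N)" by blast
  note f' = lg_iso_converse[OF f]
  show "F1_isomorphic (with_proj G) M N"
    unfolding F1_isomorphic_def
    using hom_of_iso_hom[OF f M N] hom_of_iso_hom[OF f' N M] inv[OF f] inv[OF f']
    by (intro bexI[of _ "hom_of_iso f M N"] bexI[of _ "hom_of_iso (f\<inverse>) N M"]) simp_all
qed

text \<open>
  The point \<open>0\<close> is the base point, so that the vertex \<open>(n, v)\<close> becomes the point \<open>Suc n\<close> over \<open>v\<close>.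
\<close>

definition step_along :: "((nat \<times> 'v) \<times> (nat \<times> 'v)) set \<Rightarrow> 'v \<times> 'v \<Rightarrow> nat \<Rightarrow> nat" where
  "step_along E e x = (if \<exists>n m. x = Suc n \<and> ((n, fst e), (m, snd e)) \<in> E
     then Suc (THE m. ((x - 1, fst e), (m, snd e)) \<in> E) else 0)"

definition graph_rep :: "'v lgraph \<Rightarrow> ('v, 'v \<times> 'v) F1_rep" where
  "graph_rep X = \<lparr> pts = (\<lambda>v. insert 0 (Suc ` {n. (n, v) \<in> fst X})), bpt = (\<lambda>v. 0),
     act = (\<lambda>u p. fold (step_along (snd X)) p) \<rparr>"

lemma step_along:
  assumes X: "X \<in> immersed G"
  shows "step_along (snd X) (u, v) 0 = 0"
    "((n, u), (m, v)) \<in> snd X \<Longrightarrow> step_along (snd X) (u, v) (Suc n) = Suc m"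
    "step_along (snd X) (u, v) x = Suc m \<Longrightarrow> \<exists>n. x = Suc n \<and> ((n, u), (m, v)) \<in> snd X"
proof -
  show "step_along (snd X) (u, v) 0 = 0" by (simp add: step_along_def)
  have S: "step_along (snd X) (u, v) (Suc n) = Suc m" if "((n, u), (m, v)) \<in> snd X" for n m
  proof -
    have "(THE m. ((n, u), (m, v)) \<in> snd X) = m"
    proof (rule the_equality)
      show "((n, u), (m, v)) \<in> snd X" by (rule that)
      show "m' = m" if "((n, u), (m', v)) \<in> snd X" for m'
        using immersedD(7)[OF X that \<open>((n, u), (m, v)) \<in> snd X\<close>] by simp
    qed
    moreover have "\<exists>m. ((n, u), (m, v)) \<in> snd X" using that by blast
    ultimately show ?thesis by (simp add: step_along_def)
  qed
  then show "((n, u), (m, v)) \<in> snd X \<Longrightarrow> step_along (snd X) (u, v) (Suc n) = Suc m" .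
  assume x: "step_along (snd X) (u, v) x = Suc m"
  then obtain n m' where n: "x = Suc n" "((n, u), (m', v)) \<in> snd X"
    unfolding step_along_def by (auto split: if_splits)
  then show "\<exists>n. x = Suc n \<and> ((n, u), (m, v)) \<in> snd X" using S[OF n(2)] x by auto
qed

lemma graph_rep:
  assumes X: "X \<in> immersed G"
  shows "is_F1_rep (with_proj G) (graph_rep X)"
    and "lg_iso (rep_graph (graph_rep X)) X \<noteq> {}"
proof -
  let ?M = "graph_rep X"
  note s = step_along[OF X] and D = immersedD[OF X]
  have M: "pts ?M v = insert 0 (Suc ` {n. (n, v) \<in> fst X})" "bpt ?M v = 0"
    "act ?M u p = fold (step_along (snd X)) p" for u v p by (simp_all add: graph_rep_def)
  have fin: "finite {n. (n, v) \<in> fst X}" for v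
    by (rule finite_subset[of _ "fst ` fst X"]) (use D(1) in force)+
  have arc: "F1_map (step_along (snd X) e) (pts ?M (fst e)) 0 (pts ?M (snd e)) 0" for e
  proof -
    obtain u v where e: "e = (u, v)" by (cases e)
    have "step_along (snd X) (u, v) x \<in> pts ?M v" for x
      using s(3)[of u v x] D(6) by (cases "step_along (snd X) (u, v) x") (auto simp: M)
    moreover have "inj_on (step_along (snd X) (u, v)) {x \<in> pts ?M u. step_along (snd X) (u, v) x \<noteq> 0}"
    proof (rule inj_onI)
      fix x y assume x: "x \<in> {x \<in> pts ?M u. step_along (snd X) (u, v) x \<noteq> 0}"
        and xy: "step_along (snd X) (u, v) x = step_along (snd X) (u, v) y"
      then obtain m where m: "step_along (snd X) (u, v) x = Suc m" using not0_implies_Suc by blast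
      obtain n where n: "x = Suc n" "((n, u), (m, v)) \<in> snd X" using s(3)[OF m] by blast
      obtain n' where n': "y = Suc n'" "((n', u), (m, v)) \<in> snd X" using s(3)[of u v y m] m xy by auto
      show "x = y" using D(8)[OF n(2) n'(2)] n(1) n'(1) by simp
    qed
    ultimately show ?thesis unfolding e F1_map_def using s(1) by auto
  qed
  have map: "F1_map (fold (step_along (snd X)) p) (pts ?M u) 0 (pts ?M v) 0" if "walk u p v" for u p v
    using that
  proof (induction p arbitrary: u)
    case Nil
    then show ?case by (auto simp: F1_map_def)
  next
    case (Cons e p)
    then have "F1_map (fold (step_along (snd X)) p) (pts ?M (snd e)) 0 (pts ?M v) 0" by simp
    moreover have "fst e = u" using Cons.prems by simp
    ultimately show ?case using F1_map_compose[OF arc[of e]] by (simp add: comp_def)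
  qed
  show "is_F1_rep (with_proj G) ?M"
    unfolding is_F1_rep_def using map fin by (simp add: M)
  let ?f = "{((Suc n, v), (n, v)) |n v. (n, v) \<in> fst X}"
  have V: "e \<in> fst (rep_graph ?M) \<longleftrightarrow> (\<exists>n v. e = (Suc n, v) \<and> (n, v) \<in> fst X)" for e
    using D(2) by (cases e) (auto simp: rep_graph_verts M)
  have "?f \<in> lg_iso (rep_graph ?M) X"
  proof (rule lg_isoI)
    show "Domain ?f = fst (rep_graph ?M)" unfolding set_eq_iff V Domain_iff by blast
    show "Range ?f = fst X" 
    proof
      show "fst X \<subseteq> Range ?f"
      proof
        fix e assume "e \<in> fst X"
        then have "((Suc (fst e), snd e), (fst e, snd e)) \<in> ?f" by auto
        then show "e \<in> Range ?f" unfolding prod.collapse by (rule RangeI)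
      qed
    qed auto
    show "(x, x') \<in> snd (rep_graph ?M) \<longleftrightarrow> (y, y') \<in> snd X" if "(x, y) \<in> ?f" "(x', y') \<in> ?f" for x y x' y'
    proof -
      obtain n u m v where a: "x = (Suc n, u)" "y = (n, u)" "x' = (Suc m, v)" "y' = (m, v)"
        "(n, u) \<in> fst X" "(m, v) \<in> fst X" using \<open>(x, y) \<in> ?f\<close> \<open>(x', y') \<in> ?f\<close> by auto
      have "(x, x') \<in> snd (rep_graph ?M) \<longleftrightarrow> (u, v) \<in> parcs G \<and> step_along (snd X) (u, v) (Suc n) = Suc m"
        unfolding a rep_graph_arrows using a(5,6) V by (simp add: M)
      also have "\<dots> \<longleftrightarrow> (y, y') \<in> snd X"
        unfolding a using s(2)[of n u m v] s(3)[of u v "Suc n" m] D(4)[of "(n, u)" "(m, v)"] by auto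
      finally show ?thesis .
    qed
  qed auto
  then show "lg_iso (rep_graph ?M) X \<noteq> {}" by blast
qed

definition sub_verts :: "('v, 'v \<times> 'v) F1_rep \<Rightarrow> ('v \<Rightarrow> nat set) \<Rightarrow> (nat \<times> 'v) set" where
  "sub_verts R U = {(x, v). v \<in> pverts G \<and> x \<in> U v \<and> x \<noteq> bpt R v}"

lemma sub_repD:
  assumes "U \<in> F1_subreps (with_proj G) R"
  shows "v \<in> pverts G \<Longrightarrow> U v \<subseteq> pts R v" "v \<in> pverts G \<Longrightarrow> bpt R v \<in> U v" "v \<notin> pverts G \<Longrightarrow> U v = {}"
    "walk u p v \<Longrightarrow> x \<in> U u \<Longrightarrow> act R u p x \<in> U v"
  using assms unfolding F1_subreps_def with_proj_simps by blast+

lemma sub_verts_closed: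
  assumes "U \<in> F1_subreps (with_proj G) R"
  shows "sub_verts R U \<in> succ_closed (rep_graph R)"
proof -
  note D = sub_repD[OF assms]
  have "x \<in> U v \<Longrightarrow> x \<in> pts R v" for x v using D(1,3) by blast
  then have "sub_verts R U \<subseteq> fst (rep_graph R)"
    by (auto simp: sub_verts_def rep_graph_verts)
  moreover have "(y, v) \<in> sub_verts R U" if "((x, u), (y, v)) \<in> snd (rep_graph R)" "(x, u) \<in> sub_verts R U" for x u y v
    using that D(4)[OF walk_arc, of u v x] by (auto simp: sub_verts_def rep_graph_verts rep_graph_arrows)
  ultimately show ?thesis unfolding succ_closed_def by auto
qed

text \<open>
  Closure under arrows of the coefficient quiver amounts to closure under single arrows of \<open>G\<close>,
  because base points are in every subrepresentation, and then under all paths.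
\<close>

lemma sub_verts_bij:
  assumes R: "is_F1_rep (with_proj G) R"
  shows "bij_betw (sub_verts R) (F1_subreps (with_proj G) R) (succ_closed (rep_graph R))"
proof (rule bij_betw_byWitness[where f' = "\<lambda>Y v. if v \<in> pverts G then insert (bpt R v) {x. (x, v) \<in> Y} else {}"])
  let ?inv = "\<lambda>Y v. if v \<in> pverts G then insert (bpt R v) {x. (x, v) \<in> Y} else {}"
  show "\<forall>U \<in> F1_subreps (with_proj G) R. ?inv (sub_verts R U) = U"
  proof (intro ballI ext)
    fix U v assume U: "U \<in> F1_subreps (with_proj G) R"
    show "?inv (sub_verts R U) v = U v"
      using sub_repD(2)[OF U, of v] sub_repD(3)[OF U, of v] by (auto simp: sub_verts_def)
  qed
  show "\<forall>Y \<in> succ_closed (rep_graph R). sub_verts R (?inv Y) = Y"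
  proof
    fix Y assume "Y \<in> succ_closed (rep_graph R)"
    then have "Y \<subseteq> fst (rep_graph R)" unfolding succ_closed_def by blast
    then have "(x, v) \<in> Y \<Longrightarrow> v \<in> pverts G \<and> x \<noteq> bpt R v" for x v using rep_graph_verts by blast
    then show "sub_verts R (?inv Y) = Y" by (auto simp: sub_verts_def)
  qed
  show "sub_verts R ` F1_subreps (with_proj G) R \<subseteq> succ_closed (rep_graph R)"
    using sub_verts_closed by blast
  show "?inv ` succ_closed (rep_graph R) \<subseteq> F1_subreps (with_proj G) R"
  proof
    fix U assume "U \<in> ?inv ` succ_closed (rep_graph R)"
    then obtain Y where Y: "Y \<in> succ_closed (rep_graph R)" "U = ?inv Y" by blast
    have YV: "v \<in> pverts G \<and> x \<in> pts R v" if "(x, v) \<in> Y" for x v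
      using Y(1) that rep_graph_verts unfolding succ_closed_def by blast
    have sub: "U v \<subseteq> pts R v" "bpt R v \<in> U v" if "v \<in> pverts G" for v
      using that YV F1_repD(2)[OF R that] unfolding Y(2) by auto
    have arc: "act R u [(u, v)] x \<in> U v" if uv: "(u, v) \<in> parcs G" and x: "x \<in> U u" for u v x
    proof (cases "act R u [(u, v)] x = bpt R v \<or> x = bpt R u")
      case True
      then show ?thesis using F1_actD(1)[OF R walk_arc[OF uv]] sub(2) parcs_subset uv by auto
    next
      case False
      have V: "u \<in> pverts G" "v \<in> pverts G" using uv parcs_subset by auto
      have xY: "(x, u) \<in> Y" using x False V unfolding Y(2) by auto
      have "((x, u), (act R u [(u, v)] x, v)) \<in> snd (rep_graph R)"
        using False V uv YV[OF xY] F1_actD(2)[OF R walk_arc[OF uv]] by (simp add: rep_graph_arrows rep_graph_verts)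
      then have "(act R u [(u, v)] x, v) \<in> Y" using Y(1) xY unfolding succ_closed_def by blast
      then show ?thesis unfolding Y(2) using V by simp
    qed
    have "act R u p x \<in> U v" if "walk u p v" "x \<in> U u" for u p v x
      using that
    proof (induction p arbitrary: u x)
      case Nil
      then have "act R u [] x = x" using F1_repD(4)[OF R, of u x] sub(1)[of u] by auto
      then show ?case using Nil by simp
    next
      case (Cons e p)
      have u: "u \<in> pverts G" using Cons.prems walk_end by blast
      have "act R u [e] x \<in> U (snd e)" using arc[of u "snd e" x] Cons.prems by (cases e) auto
      then show ?case
        using Cons F1_act_Cons[OF R Cons.prems(1)] sub(1)[OF u] by auto
    qed
    moreover have "U v = {}" if "v \<notin> pverts G" for v using that by (simp add: Y(2))
    ultimately show "U \<in> F1_subreps (with_proj G) R"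
      unfolding F1_subreps_def with_proj_simps using sub by blast
  qed
qed

lemma F1_restrict:
  assumes R: "is_F1_rep (with_proj G) R" and U: "U \<in> F1_subreps (with_proj G) R"
  shows "is_F1_rep (with_proj G) (F1_restrict R U)"
    and "rep_graph (F1_restrict R U) = lg_restrict (rep_graph R) (sub_verts R U)"
proof -
  note D = sub_repD[OF U]
  have sub: "x \<in> U v \<Longrightarrow> x \<in> pts R v" for x v using D(1,3) by blast
  have map: "F1_map (act R u p) (U u) (bpt R u) (U v) (bpt R v)" if w: "walk u p v" for u p v
  proof -
    have "inj_on (act R u p) {x \<in> U u. act R u p x \<noteq> bpt R v}"
      using F1_actD(3)[OF R w] sub by (auto intro!: inj_onI)
    then show ?thesis unfolding F1_map_def using D(4)[OF w] F1_actD(1)[OF R w] by auto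
  qed
  have "finite (U v) \<and> bpt R v \<in> U v" if "v \<in> pverts G" for v
    using F1_repD(1)[OF R that] D(1,2)[OF that] finite_subset by blast
  then show "is_F1_rep (with_proj G) (F1_restrict R U)"
    unfolding is_F1_rep_def with_proj_simps F1_restrict_def F1_rep.simps
    using map F1_repD(4,5)[OF R] sub by blast
  have V: "fst (rep_graph (F1_restrict R U)) = fst (rep_graph R) \<inter> sub_verts R U"
    using sub by (auto simp: rep_graph_verts sub_verts_def F1_restrict_def)
  have "snd (rep_graph (F1_restrict R U)) = snd (rep_graph R) \<inter> sub_verts R U \<times> sub_verts R U"
    by (auto simp: rep_graph_arrows V) (auto simp: F1_restrict_def)
  then show "rep_graph (F1_restrict R U) = lg_restrict (rep_graph R) (sub_verts R U)"
    unfolding lg_restrict_def using V by (metis prod.collapse)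
qed

lemma F1_quotient:
  assumes R: "is_F1_rep (with_proj G) R" and U: "U \<in> F1_subreps (with_proj G) R"
  shows "is_F1_rep (with_proj G) (F1_quotient (with_proj G) R U)"
    and "rep_graph (F1_quotient (with_proj G) R U) =
      lg_restrict (rep_graph R) (fst (rep_graph R) - sub_verts R U)"
proof -
  note D = sub_repD[OF U]
  let ?Q = "F1_quotient (with_proj G) R U"
  have Q: "pts ?Q v = insert (bpt R v) (pts R v - U v)" "bpt ?Q v = bpt R v" for v
    by (simp_all add: F1_quotient_def)
  have a: "act ?Q u p x = (if act R u p x \<in> U v then bpt R v else act R u p x)" if "walk u p v" for u p v x
    using walk_last[OF that] by (simp add: F1_quotient_def Let_def)
  have bU: "act R u p (bpt R u) \<in> U v" if "walk u p v" for u p v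
    using F1_actD(1)[OF R that] D(2) walk_end[OF that] by simp
  have ptsR: "x \<in> pts R v" if "v \<in> pverts G" "x \<in> pts ?Q v" for x v
    using that F1_repD(2)[OF R] by (auto simp: Q)
  have map: "F1_map (act ?Q u p) (pts ?Q u) (bpt ?Q u) (pts ?Q v) (bpt ?Q v)" if w: "walk u p v" for u p v
  proof -
    have u: "u \<in> pverts G" and v: "v \<in> pverts G" using walk_end[OF w] by auto
    have "inj_on (act ?Q u p) {x \<in> pts ?Q u. act ?Q u p x \<noteq> bpt ?Q v}"
    proof (rule inj_onI)
      fix x y assume x: "x \<in> {x \<in> pts ?Q u. act ?Q u p x \<noteq> bpt ?Q v}"
        and y: "y \<in> {x \<in> pts ?Q u. act ?Q u p x \<noteq> bpt ?Q v}" and e: "act ?Q u p x = act ?Q u p y"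
      have "act R u p x \<notin> U v" "act R u p y \<notin> U v" using x y by (auto simp: a[OF w] Q)
      then have "act R u p x = act R u p y" "act R u p x \<noteq> bpt R v"
        using e D(2)[OF v] by (auto simp: a[OF w])
      then show "x = y"
        using F1_actD(3)[OF R w, of x y] ptsR[OF u] x y by simp
    qed
    moreover have "act ?Q u p x \<in> pts ?Q v" if "x \<in> pts ?Q u" for x
      using F1_actD(2)[OF R w ptsR[OF u that]] by (auto simp: a[OF w] Q)
    moreover have "act ?Q u p (bpt ?Q u) = bpt ?Q v"
      using bU[OF w] by (simp add: a[OF w] Q)
    ultimately show ?thesis unfolding F1_map_def by blast
  qed
  have comp: "act ?Q u (p @ q) x = act ?Q v q (act ?Q u p x)"
    if w: "walk u p v" "walk v q z" and x: "x \<in> pts ?Q u" for u p v q z x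
  proof -
    have u: "u \<in> pverts G" using walk_end[OF w(1)] by auto
    have wpq: "walk u (p @ q) z"
      using w by (induction p arbitrary: u) auto
    have e: "act R u (p @ q) x = act R v q (act R u p x)"
      using F1_repD(5)[OF R w ptsR[OF u x]] .
    show ?thesis
      using D(4)[OF w(2), of "act R u p x"] bU[OF w(2)] e
      by (auto simp: a[OF wpq] a[OF w(1)] a[OF w(2)])
  qed
  have id: "act ?Q v [] x = x" if v: "v \<in> pverts G" and x: "x \<in> pts ?Q v" for v x
  proof -
    have "act R v [] x = x" using F1_repD(4)[OF R v ptsR[OF v x]] .
    then have "act ?Q v [] x = (if x \<in> U v then bpt R v else x)" using a[of v "[]" v x] v by simp
    then show ?thesis using x by (auto simp: Q)
  qed
  have "finite (pts ?Q v) \<and> bpt ?Q v \<in> pts ?Q v" if "v \<in> pverts G" for v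
    using F1_repD(1)[OF R that] by (simp add: Q)
  then show "is_F1_rep (with_proj G) ?Q"
    unfolding is_F1_rep_def with_proj_simps using map comp id by blast
  have V: "fst (rep_graph ?Q) = fst (rep_graph R) \<inter> (fst (rep_graph R) - sub_verts R U)"
    by (auto simp: rep_graph_verts sub_verts_def Q)
  have "((x, u), (y, v)) \<in> snd (rep_graph ?Q) \<longleftrightarrow>
      ((x, u), (y, v)) \<in> snd (rep_graph R) \<inter> (fst (rep_graph R) - sub_verts R U) \<times> (fst (rep_graph R) - sub_verts R U)"
    for x u y v
    unfolding rep_graph_arrows[of x u y v ?Q] V
    using a[OF walk_arc, of u v x] by (auto simp: rep_graph_arrows sub_verts_def rep_graph_verts)
  then have "snd (rep_graph ?Q) = snd (rep_graph R) \<inter>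
      (fst (rep_graph R) - sub_verts R U) \<times> (fst (rep_graph R) - sub_verts R U)"
    by (simp only: set_eq_iff split_paired_All) blast
  then show "rep_graph ?Q = lg_restrict (rep_graph R) (fst (rep_graph R) - sub_verts R U)"
    unfolding lg_restrict_def using V by (metis prod.collapse)
qed

lemma F1_coeff_eq:
  assumes M: "is_F1_rep (with_proj G) M" and N: "is_F1_rep (with_proj G) N" and R: "is_F1_rep (with_proj G) R"
  shows "card {U \<in> F1_subreps (with_proj G) R. F1_isomorphic (with_proj G) (F1_restrict R U) N \<and>
      F1_isomorphic (with_proj G) (F1_quotient (with_proj G) R U) M} =
    lg_coeff (rep_graph M) (rep_graph N) (rep_graph R)"
proof -
  let ?P = "\<lambda>U. F1_isomorphic (with_proj G) (F1_restrict R U) N \<and>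
      F1_isomorphic (with_proj G) (F1_quotient (with_proj G) R U) M"
  let ?P' = "\<lambda>Y. lg_iso (lg_restrict (rep_graph R) Y) (rep_graph N) \<noteq> {} \<and>
      lg_iso (lg_restrict (rep_graph R) (fst (rep_graph R) - Y)) (rep_graph M) \<noteq> {}"
  let ?S = "F1_subreps (with_proj G) R" and ?C = "succ_closed (rep_graph R)"
  note b = sub_verts_bij[OF R]
  have P: "?P U \<longleftrightarrow> ?P' (sub_verts R U)" if "U \<in> ?S" for U
    using F1_isomorphic_iff[OF F1_restrict(1)[OF R that] N] F1_isomorphic_iff[OF F1_quotient(1)[OF R that] M]
      F1_restrict(2)[OF R that] F1_quotient(2)[OF R that] by simp
  have "{Y \<in> ?C. ?P' Y} = {Y \<in> sub_verts R ` ?S. ?P' Y}" using b unfolding bij_betw_def by simp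
  also have "\<dots> = sub_verts R ` {U \<in> ?S. ?P' (sub_verts R U)}" by blast
  also have "\<dots> = sub_verts R ` {U \<in> ?S. ?P U}" using P by (intro arg_cong[where f = "image (sub_verts R)"] Collect_cong) blast
  finally have "sub_verts R ` {U \<in> ?S. ?P U} = {Y \<in> ?C. ?P' Y}" by simp
  moreover have "inj_on (sub_verts R) {U \<in> ?S. ?P U}"
    using b unfolding bij_betw_def by (auto intro: inj_on_subset)
  ultimately show ?thesis unfolding lg_coeff_def using card_image[of "sub_verts R" "{U \<in> ?S. ?P U}"] by simp
qed

text \<open>
  Both algebras count subobjects, so the weight is one here.
\<close>

lemma hall_F1_isomorphic:
  "algebra_isomorphic (hall_lg G :: ('k::field, 'v lgraph set \<Rightarrow> 'k) module) (hall_F1 (with_proj G))"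
proof -
  let ?Ob = "F1_obj (with_proj G)" and ?R = "F1_iso_rel (with_proj G)"
  let ?c = "\<lambda>M N R. card {U \<in> F1_subreps (with_proj G) R. F1_isomorphic (with_proj G) (F1_restrict R U) N \<and>
      F1_isomorphic (with_proj G) (F1_quotient (with_proj G) R U) M}"
  have rel: "(M, N) \<in> ?R \<longleftrightarrow> is_F1_rep (with_proj G) M \<and> is_F1_rep (with_proj G) N \<and>
      (rep_graph M, rep_graph N) \<in> lg_iso_rel G" for M N
    using F1_isomorphic_iff rep_graph_immersed unfolding F1_iso_rel_def F1_obj_eq lg_iso_rel_def by auto
  have gr: "(rep_graph (graph_rep X), X) \<in> lg_iso_rel G" if "X \<in> immersed G" for X
    using graph_rep[OF that] rep_graph_immersed that unfolding lg_iso_rel_def by blast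
  note e = equiv_lg_iso_rel[of G]
  have sy: "(Y, X) \<in> lg_iso_rel G" if "(X, Y) \<in> lg_iso_rel G" for X Y
    using e that by (meson equivE symD)
  have tr: "(X, Z) \<in> lg_iso_rel G" if "(X, Y) \<in> lg_iso_rel G" "(Y, Z) \<in> lg_iso_rel G" for X Y Z
    using e that by (meson equivE transD)
  have "hall_equivalence (immersed G) (lg_iso_rel G) ({}, {}) lg_coeff ?Ob ?R F1_zero ?c graph_rep (\<lambda>_. 1 :: 'k)"
  proof
    show "equiv (immersed G) (lg_iso_rel G)" by (rule e)
    show "equiv ?Ob ?R"
    proof (rule equivI)
      show "?R \<subseteq> ?Ob \<times> ?Ob" by (auto simp: F1_iso_rel_def)
      show "refl_on ?Ob ?R"
      proof (rule refl_onI)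
        fix M assume "M \<in> ?Ob"
        then have M: "is_F1_rep (with_proj G) M" by (simp add: F1_obj_eq)
        have "(rep_graph M, rep_graph M) \<in> lg_iso_rel G"
          unfolding lg_iso_rel_def using rep_graph_immersed[OF M] lg_iso_Id by blast
        then show "(M, M) \<in> ?R" unfolding rel using M by blast
      qed
      show "sym ?R" unfolding sym_def using rel sy by blast
      show "trans ?R" unfolding trans_def using rel tr by blast
    qed
    show "graph_rep X \<in> ?Ob" if "X \<in> immersed G" for X
      using graph_rep(1)[OF that] by (simp add: F1_obj_eq)
    show "(graph_rep X, graph_rep Y) \<in> ?R \<longleftrightarrow> (X, Y) \<in> lg_iso_rel G" if "X \<in> immersed G" "Y \<in> immersed G" for X Y
      unfolding rel using graph_rep(1)[OF that(1)] graph_rep(1)[OF that(2)]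
        gr[OF that(1)] gr[OF that(2)] sy tr by blast
    show "\<exists>X\<in>immersed G. (graph_rep X, M) \<in> ?R" if "M \<in> ?Ob" for M
    proof -
      have M: "is_F1_rep (with_proj G) M" using that by (simp add: F1_obj_eq)
      then show ?thesis using rel gr graph_rep(1) rep_graph_immersed[OF M] by blast
    qed
    show "({}, {}) \<in> immersed G" by (rule immersed_empty)
    have zero: "is_F1_rep (with_proj G) (F1_zero :: ('v, 'v \<times> 'v) F1_rep)"
      by (auto simp: is_F1_rep_def F1_zero_def F1_map_def)
    have "rep_graph F1_zero = ({}, {})" by (auto simp: rep_graph_def F1_zero_def Let_def)
    then show "(graph_rep ({}, {}), F1_zero) \<in> ?R"
      unfolding rel using gr[OF immersed_empty] graph_rep(1)[OF immersed_empty] zero by simp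
    show "1 * of_nat (lg_coeff X Y Z) = 1 * 1 * (of_nat (?c (graph_rep X) (graph_rep Y) (graph_rep Z)) :: 'k)"
      if "X \<in> immersed G" "Y \<in> immersed G" "Z \<in> immersed G" for X Y Z
      using F1_coeff_eq[OF graph_rep(1) graph_rep(1) graph_rep(1), OF that]
        lg_coeff_cong[OF gr gr gr, OF that] by simp
    show "?c M N R = ?c M' N' R'" if "(M, M') \<in> ?R" "(N, N') \<in> ?R" "(R, R') \<in> ?R" for M M' N N' R R'
    proof -
      have "?c M N R = lg_coeff (rep_graph M) (rep_graph N) (rep_graph R)"
        "?c M' N' R' = lg_coeff (rep_graph M') (rep_graph N') (rep_graph R')"
        using that unfolding rel by (simp_all add: F1_coeff_eq)
      moreover have "(rep_graph M, rep_graph M') \<in> lg_iso_rel G" "(rep_graph N, rep_graph N') \<in> lg_iso_rel G"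
        "(rep_graph R, rep_graph R') \<in> lg_iso_rel G" using that unfolding rel by blast+
      ultimately show ?thesis using lg_coeff_cong by simp
    qed
  qed simp_all
  then show ?thesis unfolding hall_F1_def hall_lg_def by (rule hall_equivalence.transport_iso)
qed

end

section \<open>The comparison of the two Hall algebras\<close>

theorem theorem3p25:
  fixes W :: "('g, 'm) monoid_scheme"
    and s :: "'n::finite \<Rightarrow> 'g"
    and Q :: "'n list"
    and \<pi> :: 'g
    and I :: "nat set"
  assumes "irreducible_quadruple W s Q \<pi> I"
    and "root_independent W s Q I"
    and "underlying_tree (with_proj (root_config_quiver W s Q I))"
  shows "algebra_isomorphic
    (hall_S (root_config_quiver W s Q I)
      :: ('k::field_char_0, nat sobj set \<Rightarrow> 'k) module)
    (hall_F1 (with_proj (root_config_quiver W s Q I))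
      :: ('k, (nat, nat \<times> nat) F1_rep set \<Rightarrow> 'k) module)"
proof -
  let ?G = "root_config_quiver W s Q I"
  have "I \<subseteq> {..<length Q}"
    using assms(1) unfolding irreducible_quadruple_def quadruple_def subword_complex_def by blast
  then have "finite (pverts ?G)" using finite_subset by (auto simp: root_config_quiver_def)
  moreover have "parcs ?G \<subseteq> pverts ?G \<times> pverts ?G" by (auto simp: root_config_quiver_def)
  ultimately interpret forest_quiver ?G by (rule underlying_tree_forest_quiver[OF assms(3)])
  show ?thesis
    by (rule algebra_isomorphic_trans[OF algebra_isomorphic_trans[OF hall_S_isomorphic
      quiver.hall_lg_op_isomorphic] hall_F1_isomorphic])
qed

end
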